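(* Let $p$ be a prime and let $c$ be an integer. Then \[ \sum_{\substack{r\in\mathbb{Z},\ |r|<2\sqrt p,\\ r\equiv c\pmod 7}}H(4p-r^2)= \begin{cases} \frac{p+1}{3}, & c\equiv 0\pmod 7,\ p\equiv 3,5\pmod 7,\\ \frac{p-5}{3}, & c\equiv 0\pmod 7,\ p\equiv 6\pmod 7,\\ \frac{p-2}{3}, & c\equiv \pm(p+1)\pmod 7,\ p\equiv 2,3,4,5\pmod 7,\\ \frac{p+1}{3}, & c\equiv\pm 2\pmod 7,\ p\equiv 6\pmod 7. \end{cases} \]
   Context: $H(N)$ denotes the Hurwitz class number: for an integer $N\ge 0$, $H(0)=-1/12$; $H(N)=0$ if $N\equiv 1,2\pmod 4$; otherwise $H(N)$ is the number of $\mathrm{SL}_2(\mathbb{Z})$-equivalence classes of (not necessarily primitive) positive definite binary quadratic forms of discriminant $-N$, where classes containing a multiple of $x^2+y^2$ are counted with weight $1/2$ and classes containing a multiple of $x^2+xy+y^2$ are counted with weight $1/3$. The sum runs over all integers $r$ (positive, negative and zero) satisfying the stated conditions. *)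

theory Defs
  imports "HOL-Number_Theory.Number_Theory"
begin

text \<open>Integral binary quadratic forms a x^2 + b x y + c y^2, represented as triples (a,b,c).\<close>
type_synonym bqf = "int \<times> int \<times> int"

definition bqf_disc :: "bqf \<Rightarrow> int" where
  "bqf_disc f = (case f of (a, b, c) \<Rightarrow> b^2 - 4*a*c)"

text \<open>Substitution f(\<alpha> x + \<beta> y, \<gamma> x + \<delta> y).\<close>
definition bqf_act :: "bqf \<Rightarrow> int \<Rightarrow> int \<Rightarrow> int \<Rightarrow> int \<Rightarrow> bqf" where
  "bqf_act f \<alpha> \<beta> \<gamma> \<delta> = (case f of (a, b, c) \<Rightarrow>
     (a*\<alpha>^2 + b*\<alpha>*\<gamma> + c*\<gamma>^2,
      2*a*\<alpha>*\<beta> + b*(\<alpha>*\<delta> + \<beta>*\<gamma>) + 2*c*\<gamma>*\<delta>,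
      a*\<beta>^2 + b*\<beta>*\<delta> + c*\<delta>^2))"

definition bqf_equiv :: "(bqf \<times> bqf) set" where
  "bqf_equiv = {(f, g). \<exists>\<alpha> \<beta> \<gamma> \<delta>. \<alpha>*\<delta> - \<beta>*\<gamma> = 1 \<and> g = bqf_act f \<alpha> \<beta> \<gamma> \<delta>}"

definition pd_forms :: "int \<Rightarrow> bqf set" where
  "pd_forms N = {f. bqf_disc f = -N \<and> fst f > 0 \<and> bqf_disc f < 0}"

definition pd_classes :: "int \<Rightarrow> bqf set set" where
  "pd_classes N = pd_forms N // (bqf_equiv \<inter> (pd_forms N \<times> pd_forms N))"

definition class_weight :: "bqf set \<Rightarrow> real" where
  "class_weight C = (if \<exists>k. (k, 0, k) \<in> C then 1/2
                     else if \<exists>k. (k, k, k) \<in> C then 1/3 else 1)"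

definition hurwitz_H :: "int \<Rightarrow> real" where
  "hurwitz_H N = (if N = 0 then -1/12
                  else if N mod 4 = 1 \<or> N mod 4 = 2 then 0
                  else (\<Sum>C\<in>pd_classes N. class_weight C))"

end

theory Submission
  imports Defs
begin

text \<open>
  Following the algebraic approach of Popa and Zagier, the class number sums are evaluated through a trace
  formula for the Hecke correspondence on X_1(7), a curve of genus 0, using sums of finite support only.

  Let f be the indicator function of the half plane Re z < 0, and g that of the region between the
  geodesics from rho = exp(2 pi i/3) to 0 and to infinity that contains i, with mean values on
  boundaries. With S = (0, -1; 1, 0) and U = (0, -1; 1, 1), the sum of f over z, S z and the sum of g
  over z, U z, U^2 z are 1, and f + g - 1 is the indicator function of a fundamental domain of SL_2(Z).
  Weight an integral matrix M of determinant p by c(M) = f(M i) + g(M rho) - 1.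
  Replacing M i and M rho by the fixed point of M changes the sum of c(M) over all M of given trace by
  sums that are antisymmetric under conjugation by S, respectively U, hence vanish. Therefore the
  matrices of trace r with r^2 < 4 p contribute 2 H(4 p - r^2), and among the hyperbolic ones only the
  traces p + 1 and -p - 1 contribute.

  On the other hand, let K(x, y) be the sum of c(M) over all M with M x = y, where x and y run over the
  24 elements of (F_7^2 - 0)/{1, -1}. The symmetries of f and g give linear relations for K coming
  from S, U and the cusps, and these determine the trace of K because X_1(7) has genus 0. Comparing
  with the number of fixed vectors of M modulo 7 yields the sums over a residue class of r.
\<close>

subsection \<open>Sums of finite support\<close>

text \<open>For fixed z each of f(M z) and g(M z) is nonzero for infinitely many M, so neither can
  be summed over M; only the combination f + g - 1 and differences at two points have finite
  support. The base points i and rho in c(M) are chosen because S fixes i and U fixes rho: right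
  multiplication by S preserves f(M i), right multiplication by U preserves g(M rho). This is the
  source of the relations. K(x, y) + K(x, S y) does not change when x is replaced by U x, the sum of
  K(x, y) over the U-orbit of y does not change when x is replaced by S x, and c(M) - c(M S) = g(M
  rho) - g(M T rho) telescopes along powers of T, leaving only terms from matrices that send the
  cusp infinity to infinity or 0. On the 24 vectors S has 12 orbits, U has 8 and T has 6; 8 - 12 + 6
  = 2 is the Euler characteristic of a sphere, so nothing escapes these relations.\<close>

lemma sum'_reindex:
  assumes "bij_betw h A B"
  shows "sum' (\<lambda>x. f (h x)) A = sum' f B"
proof -
  have bij: "bij_betw h {x\<in>A. f (h x) \<noteq> 0} {x\<in>B. f x \<noteq> 0}"
    using assms by (auto simp: bij_betw_def inj_on_def)
  then show ?thesis
    using bij_betw_finite[OF bij] sum.reindex_bij_betw[OF bij, of f]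
    by (simp add: sum.G_def)
qed

lemma sum'_eq_sum:
  assumes "finite B" "B \<subseteq> A" "\<And>x. x \<in> A \<Longrightarrow> x \<notin> B \<Longrightarrow> f x = 0"
  shows "sum' f A = sum f B"
  using sum.mono_neutral_left'[of B A f] assms by auto

lemma sum'_uminus: "sum' (\<lambda>x. - f x) A = - sum' f A" for f :: "_ \<Rightarrow> real"
  by (simp add: sum.G_def sum_negf)

lemma sum'_cmult: "sum' (\<lambda>x. c * f x) A = c * sum' f A" for f :: "_ \<Rightarrow> real"
  by (cases "c = 0") (auto simp: sum.G_def sum_distrib_left)

text \<open>An infinite support gives \<open>sum'\<close> the default value 0, so additivity depends
  on the finiteness of both supports. Supplying it is the recurring task of the development.\<close>

lemma sum'_diff:
  fixes f g :: "_ \<Rightarrow> real"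
  assumes "finite {x\<in>A. f x \<noteq> 0}" "finite {x\<in>A. g x \<noteq> 0}"
  shows "sum' (\<lambda>x. f x - g x) A = sum' f A - sum' g A"
  using sum.distrib'[of A f "\<lambda>x. - g x"] assms by (simp add: sum'_uminus)

text \<open>Reindexing by h turns the sum into its own negative. In the uses for matrices h is left
  multiplication by S, which has order 4 there.\<close>

lemma sum'_antisym:
  fixes f :: "_ \<Rightarrow> real"
  assumes "bij_betw h A A" "finite {x\<in>A. f x \<noteq> 0}" "\<And>x. x \<in> A \<Longrightarrow> f x + f (h x) = 0"
  shows "sum' f A = 0"
proof -
  have "sum' f A = sum' (\<lambda>x. f (h x)) A" using sum'_reindex[OF assms(1), of f] by simp
  also have "\<dots> = sum' (\<lambda>x. - f x) A"
    using assms(3) by (intro sum.cong') (auto simp: add_eq_0_iff)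
  finally show ?thesis by (simp add: sum'_uminus)
qed

lemma finite_supp_bij:
  assumes "bij_betw h A B"
  shows "finite {x\<in>A. f (h x) \<noteq> 0} \<longleftrightarrow> finite {x\<in>B. f x \<noteq> 0}"
proof -
  have "bij_betw h {x\<in>A. f (h x) \<noteq> 0} {x\<in>B. f x \<noteq> 0}"
    using assms by (auto simp: bij_betw_def inj_on_def)
  then show ?thesis by (rule bij_betw_finite)
qed

lemmas finite_supp_reindex = finite_supp_bij[THEN iffD2]

lemma sum'_antirot:
  fixes f :: "_ \<Rightarrow> real"
  assumes "bij_betw h A A" "finite {x\<in>A. f x \<noteq> 0}"
    "\<And>x. x \<in> A \<Longrightarrow> f x + f (h x) + f (h (h x)) = 0"
  shows "sum' f A = 0"
proof -
  have bij2: "bij_betw (\<lambda>x. h (h x)) A A"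
    using bij_betw_trans[OF assms(1) assms(1)] by (simp add: comp_def)
  have fin: "finite {x\<in>A. f (h x) \<noteq> 0}" "finite {x\<in>A. f (h (h x)) \<noteq> 0}"
    using finite_supp_reindex[OF assms(1,2)] finite_supp_reindex[OF bij2 assms(2)] by auto
  have "0 = sum' (\<lambda>x. (f x + f (h x)) + f (h (h x))) A"
    using sum.cong'[of A A "\<lambda>x. (f x + f (h x)) + f (h (h x))" "\<lambda>_. 0"] assms(3)
    by (simp add: sum.G_def)
  also have "\<dots> = sum' (\<lambda>x. f x + f (h x)) A + sum' (\<lambda>x. f (h (h x))) A"
    by (intro sum.distrib' fin finite_subset[OF _ finite_UnI[OF assms(2) fin(1)]]) auto
  also have "sum' (\<lambda>x. f x + f (h x)) A = sum' f A + sum' (\<lambda>x. f (h x)) A"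
    by (intro sum.distrib' fin assms)
  finally show ?thesis
    using sum'_reindex[OF assms(1), of f] sum'_reindex[OF bij2, of f] by simp
qed

lemma sum_sum'_swap:
  fixes f :: "_ \<Rightarrow> _ \<Rightarrow> real"
  assumes "finite Y" "\<And>y. y \<in> Y \<Longrightarrow> finite {x\<in>A. f y x \<noteq> 0}"
  shows "(\<Sum>y\<in>Y. sum' (f y) A) = sum' (\<lambda>x. \<Sum>y\<in>Y. f y x) A"
    and "finite {x\<in>A. (\<Sum>y\<in>Y. f y x) \<noteq> 0}"
proof -
  define B where "B = (\<Union>y\<in>Y. {x\<in>A. f y x \<noteq> 0})"
  have B: "finite B" "B \<subseteq> A" using assms by (auto simp: B_def)
  have 0: "(\<Sum>y\<in>Y. f y x) = 0" if "x \<in> A" "x \<notin> B" for x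
    using that by (intro sum.neutral) (auto simp: B_def)
  have "(\<Sum>y\<in>Y. sum' (f y) A) = (\<Sum>y\<in>Y. sum (f y) B)"
    using B by (intro sum.cong sum'_eq_sum) (auto simp: B_def)
  also have "\<dots> = (\<Sum>x\<in>B. \<Sum>y\<in>Y. f y x)" by (rule sum.swap)
  also have "\<dots> = sum' (\<lambda>x. \<Sum>y\<in>Y. f y x) A"
    using B 0 by (intro sum'_eq_sum[symmetric]) auto
  finally show "(\<Sum>y\<in>Y. sum' (f y) A) = sum' (\<lambda>x. \<Sum>y\<in>Y. f y x) A" .
  show "finite {x\<in>A. (\<Sum>y\<in>Y. f y x) \<noteq> 0}"
    using 0 by (intro finite_subset[OF _ B(1)]) auto
qed

lemma sum'_group:
  fixes f :: "_ \<Rightarrow> real"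
  assumes "finite {x\<in>A. f x \<noteq> 0}" "finite R" "\<And>x. x \<in> A \<Longrightarrow> f x \<noteq> 0 \<Longrightarrow> g x \<in> R"
  shows "sum' f A = (\<Sum>r\<in>R. sum' f {x\<in>A. g x = r})"
proof -
  define B where "B = {x\<in>A. f x \<noteq> 0}"
  have "sum' f A = sum f B" using assms(1) by (intro sum'_eq_sum) (auto simp: B_def)
  also have "\<dots> = (\<Sum>r\<in>R. sum f {x\<in>B. g x = r})"
    using assms by (intro sum.group[symmetric]) (auto simp: B_def)
  also have "\<dots> = (\<Sum>r\<in>R. sum' f {x\<in>A. g x = r})"
    using assms(1)
    by (intro sum.cong refl sum'_eq_sum[symmetric]) (auto simp: B_def intro: rev_finite_subset)
  finally show ?thesis .
qed

lemmas ring_eqs = power2_eq_square algebra_simps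

subsection \<open>Matrices acting on positive definite forms\<close>

text \<open>The tuple (a, b, c, d) is the matrix with rows (a, b) and (c, d).\<close>

type_synonym imat = "int \<times> int \<times> int \<times> int"

definition det_mats :: "int \<Rightarrow> imat set" where
  "det_mats n = {(a, b, c, d). a * d - b * c = n}"

definition hstep :: "int \<Rightarrow> real" where
  "hstep t = (if t > 0 then 1 else if t = 0 then 1/2 else 0)"

text \<open>A unit mass is shared equally among the largest of the three arguments, and the first
  one receives its share; hence the three cyclic values add up to 1 also on boundaries.\<close>

definition maxw :: "int \<Rightarrow> int \<Rightarrow> int \<Rightarrow> real" where
  "maxw e a c = (if e < a \<or> e < c then 0 else if e = a \<and> e = c then 1/3
     else if e = a \<or> e = c then 1/2 else 1)"

lemma hstep_uminus: "hstep (- t) = 1 - hstep t"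
  by (auto simp: hstep_def)

lemma maxw_rot: "maxw e a c + maxw a c e + maxw c e a = 1"
  by (auto simp: maxw_def)

fun qval :: "bqf \<Rightarrow> int \<Rightarrow> int \<Rightarrow> int" where
  "qval (k, l, m) x y = k * x^2 + l * x * y + m * y^2"

text \<open>If z is the root of Q in the upper half plane, then Q(c, d), Q(a, b) and Q(a + c, b + d) are the values
  at (1, 0), (0, 1) and (1, -1) of the form attached to M z. In these terms f and g at M z are
  \<open>side\<close> and \<open>sector\<close>, and \<open>domw\<close> is f + g - 1.\<close>

fun side :: "bqf \<Rightarrow> imat \<Rightarrow> real" where
  "side Q (a, b, c, d) = hstep (qval Q c d + qval Q a b - qval Q (a + c) (b + d))"

fun sector :: "bqf \<Rightarrow> imat \<Rightarrow> real" where
  "sector Q (a, b, c, d) = maxw (qval Q (a + c) (b + d)) (qval Q c d) (qval Q a b)"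

definition domw :: "bqf \<Rightarrow> imat \<Rightarrow> real" where
  "domw Q M = side Q M + sector Q M - 1"

text \<open>Left multiplication by S = (0, -1, 1, 0) and U = (0, -1, 1, 1).\<close>

fun Sl :: "imat \<Rightarrow> imat" where "Sl (a, b, c, d) = (- c, - d, a, b)"
fun Ul :: "imat \<Rightarrow> imat" where "Ul (a, b, c, d) = (- c, - d, a + c, b + d)"

definition posdef :: "bqf \<Rightarrow> bool" where
  "posdef Q \<longleftrightarrow> fst Q > 0 \<and> bqf_disc Q < 0"

lemma bij_Sl: "bij_betw Sl (det_mats n) (det_mats n)"
  by (rule bij_betw_byWitness[where f' = "\<lambda>(a, b, c, d). (c, d, - a, - b)"])
     (auto simp: det_mats_def algebra_simps)

lemma bij_Ul: "bij_betw Ul (det_mats n) (det_mats n)"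
  by (rule bij_betw_byWitness[where f' = "\<lambda>(a, b, c, d). (a + c, b + d, - a, - b)"])
     (auto simp: det_mats_def algebra_simps)

lemma side_Sl: "side Q (Sl M) = 1 - side Q M"
proof (cases Q; cases M)
  fix k l m a b c d assume Q: "Q = (k, l, m)" and M: "M = (a, b, c, d)"
  have "qval Q a b + qval Q (-c) (-d) - qval Q (-c + a) (-d + b)
      = - (qval Q c d + qval Q a b - qval Q (a + c) (b + d))"
    by (simp add: Q ring_eqs)
  then show ?thesis
    using hstep_uminus by (simp only: M side.simps Sl.simps)
qed

lemma qval_uminus: "qval Q (- x) (- y) = qval Q x y"
  by (cases Q) auto

lemma sector_Ul: "sector Q M + sector Q (Ul M) + sector Q (Ul (Ul M)) = 1"
proof (cases M)
  case (fields a b c d)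
  have 1: "qval Q (-a - c) (- b - d) = qval Q (a + c) (b + d)"
    using qval_uminus[of Q "a + c" "b + d"] by (simp add: algebra_simps)
  show ?thesis
    using maxw_rot[of "qval Q (a + c) (b + d)" "qval Q c d" "qval Q a b"]
    by (simp add: fields qval_uminus 1 algebra_simps)
qed

lemma posdef_complete_square:
  "4 * k * qval (k, l, m) x y = (2 * k * x + l * y)^2 - bqf_disc (k, l, m) * y^2"
  by (simp add: bqf_disc_def ring_eqs)

lemma qval_pos:
  assumes "posdef Q" "x \<noteq> 0 \<or> y \<noteq> 0"
  shows "qval Q x y > 0"
proof (cases Q)
  case (fields k l m)
  have k: "k > 0" and D: "bqf_disc (k, l, m) < 0" using assms by (auto simp: fields posdef_def)
  have "0 < (2 * k * x + l * y)^2 - bqf_disc (k, l, m) * y^2"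
  proof (cases "y = 0")
    case True then show ?thesis using assms(2) k by simp
  next
    case False
    then have "bqf_disc (k, l, m) * y^2 < 0" using D by (simp add: mult_neg_pos)
    then show ?thesis using zero_le_power2[of "2 * k * x + l * y"] by linarith
  qed
  then have "0 < 4 * k * qval (k, l, m) x y" by (simp only: posdef_complete_square)
  then show ?thesis using k by (simp add: fields zero_less_mult_iff)
qed

lemma finite_qval_le:
  assumes "posdef Q"
  shows "finite {(x, y). qval Q x y \<le> L}"
proof (cases Q)
  case (fields k l m)
  have k: "k > 0" and D: "bqf_disc (k, l, m) < 0" using assms by (auto simp: fields posdef_def)
  define B where "B = 4 * k * \<bar>L\<bar>"
  have "\<bar>y\<bar> \<le> B \<and> \<bar>x\<bar> \<le> B + \<bar>l\<bar> * B" if "qval Q x y \<le> L" for x y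
  proof -
    have "4 * k * qval Q x y \<le> B"
      using that k by (simp add: B_def mult_left_mono abs_if)
    then have le: "(2 * k * x + l * y)^2 + (- bqf_disc (k, l, m)) * y^2 \<le> B"
      using posdef_complete_square[of k l m x y] by (simp add: fields)
    have "y^2 \<le> (- bqf_disc (k, l, m)) * y^2"
      using D mult_right_mono[of 1 "- bqf_disc (k, l, m)" "y^2"] by simp
    then have y2: "y^2 \<le> B" and z2: "(2 * k * x + l * y)^2 \<le> B"
      using le zero_le_power2[of y] zero_le_power2[of "2 * k * x + l * y"] by linarith+
    have sq: "\<bar>t\<bar> \<le> t^2" for t :: int
      using self_le_power[of "\<bar>t\<bar>" 2] by (cases "t = 0") auto
    have y: "\<bar>y\<bar> \<le> B" and z: "\<bar>2 * k * x + l * y\<bar> \<le> B"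
      using sq[of y] sq[of "2 * k * x + l * y"] y2 z2 by linarith+
    have "\<bar>x\<bar> \<le> \<bar>2 * k * x\<bar>"
      using k mult_right_mono[of 1 "2 * k" "\<bar>x\<bar>"] by (simp add: abs_mult)
    also have "\<dots> \<le> B + \<bar>l * y\<bar>" using z by linarith
    also have "\<bar>l * y\<bar> \<le> \<bar>l\<bar> * B" using y by (simp add: abs_mult mult_left_mono)
    finally show ?thesis using y by simp
  qed
  then have "\<And>x y. qval Q x y \<le> L \<Longrightarrow> - (B + \<bar>l\<bar> * B) \<le> x \<and> x \<le> B + \<bar>l\<bar> * B \<and> - B \<le> y \<and> y \<le> B"
    by (fastforce simp: abs_le_iff)
  then have "{(x, y). qval Q x y \<le> L} \<subseteq> {- (B + \<bar>l\<bar> * B)..B + \<bar>l\<bar> * B} \<times> {- B..B}"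
    by auto
  then show ?thesis by (rule finite_subset) simp
qed

lemma finite_rows_le:
  assumes "posdef Q"
  shows "finite {(a, b, c, d). qval Q a b \<le> L \<and> qval Q c d \<le> L}"
proof -
  have "{(a, b, c, d). qval Q a b \<le> L \<and> qval Q c d \<le> L}
      \<subseteq> (\<lambda>((a, b), (c, d)). (a, b, c, d)) ` ({(x, y). qval Q x y \<le> L} \<times> {(x, y). qval Q x y \<le> L})"
    by force
  then show ?thesis
    using finite_qval_le[OF assms] finite_subset by blast
qed

text \<open>The polarized discriminant: it is invariant under simultaneous substitution in both forms, which
  confines a separated pair of points M z, M z' to finitely many matrices M of determinant n.\<close>

fun qjoint :: "bqf \<Rightarrow> bqf \<Rightarrow> int" where
  "qjoint (k, l, m) (k', l', m') = 2 * k * m' + 2 * k' * m - l * l'"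

lemma qjoint_rows:
  assumes "a * d - b * c = n"
  shows "2 * qval Q c d * qval Q' a b + 2 * qval Q' c d * qval Q a b
     - (qval Q c d + qval Q a b - qval Q (a + c) (b + d))
       * (qval Q' c d + qval Q' a b - qval Q' (a + c) (b + d)) = n^2 * qjoint Q Q'"
  unfolding assms[symmetric]
  by (cases Q; cases Q') (simp add: ring_eqs)

lemma joint_bound_side:
  fixes A C B A' C' B' J :: int
  assumes "A > 0" "C > 0" "A' > 0" "C' > 0" "B * B' \<le> 0" "2 * A * C' + 2 * A' * C - B * B' = J"
  shows "A \<le> J \<and> C \<le> J"
proof -
  have "A \<le> A * C'" "C \<le> A' * C" "0 < A * C'" "0 < A' * C" using assms by auto
  then show ?thesis using assms(5,6) by linarith
qed

lemma joint_bound_sector: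
  fixes A C E A' C' E' J :: int
  assumes "A > 0" "C > 0" "E > 0" "A' > 0" "C' > 0" "E' > 0"
    and "C \<le> A" "E \<le> A" "A' \<le> C'" "E' \<le> C'"
    and "2 * A * C' + 2 * A' * C - (A + C - E) * (A' + C' - E') = J"
  shows "A \<le> J \<and> C \<le> J \<and> E \<le> J"
proof -
  \<comment> \<open>The first triple is maximal at A and the second at C', which makes every summand
    here nonnegative; the summand E' A alone is at least A.\<close>
  have J: "J = - ((A - C) * (A' - C')) + E * A' + E' * A + E' * C + E * (C' - E')"
    unfolding assms(11)[symmetric] by (simp add: algebra_simps)
  have "(A - C) * (A' - C') \<le> 0" "0 < E * A'" "0 < E' * C" "0 \<le> E * (C' - E')" "A \<le> E' * A"
    using assms by (auto simp: mult_nonneg_nonpos)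
  then have "A \<le> J" unfolding J by linarith
  then show ?thesis using assms by linarith
qed

lemma det_mats_rows_pos:
  assumes "posdef Q" "(a, b, c, d) \<in> det_mats n" "n \<noteq> 0"
  shows "qval Q a b > 0" "qval Q c d > 0" "qval Q (a + c) (b + d) > 0"
proof -
  have n: "a * d - b * c = n" using assms(2) by (simp add: det_mats_def)
  have "a \<noteq> 0 \<or> b \<noteq> 0" "c \<noteq> 0 \<or> d \<noteq> 0" using n assms(3) by auto
  moreover have "a + c \<noteq> 0 \<or> b + d \<noteq> 0"
  proof (rule ccontr)
    assume "\<not> ?thesis"
    then have "c = - a" "d = - b" by auto
    then show False using n assms(3) by simp
  qed
  ultimately show "qval Q a b > 0" "qval Q c d > 0" "qval Q (a + c) (b + d) > 0"
    using qval_pos[OF assms(1)] by auto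
qed

section \<open>Finite supports: differences at two points, and the fundamental domain weight\<close>

lemma finite_side_diff:
  assumes "posdef Q" "posdef Q'" "n \<noteq> 0"
  shows "finite {M \<in> det_mats n. side Q M - side Q' M \<noteq> 0}"
proof -
  have "{M \<in> det_mats n. side Q M - side Q' M \<noteq> 0}
      \<subseteq> {(a, b, c, d). qval Q a b \<le> n^2 * qjoint Q Q' \<and> qval Q c d \<le> n^2 * qjoint Q Q'}"
  proof clarify
    fix a b c d assume M: "(a, b, c, d) \<in> det_mats n" and ne: "side Q (a, b, c, d) - side Q' (a, b, c, d) \<noteq> 0"
    define B where "B = qval Q c d + qval Q a b - qval Q (a + c) (b + d)"
    define B' where "B' = qval Q' c d + qval Q' a b - qval Q' (a + c) (b + d)"
    have "hstep B \<noteq> hstep B'" using ne by (simp add: B_def B'_def)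
    then have "B * B' \<le> 0"
      by (auto simp: hstep_def mult_le_0_iff split: if_splits)
    moreover have "2 * qval Q c d * qval Q' a b + 2 * qval Q' c d * qval Q a b - B * B' = n^2 * qjoint Q Q'"
      unfolding B_def B'_def by (rule qjoint_rows) (use M in \<open>simp add: det_mats_def\<close>)
    ultimately show "qval Q a b \<le> n^2 * qjoint Q Q' \<and> qval Q c d \<le> n^2 * qjoint Q Q'"
      using joint_bound_side[of "qval Q c d" "qval Q a b" "qval Q' c d" "qval Q' a b" B B']
        det_mats_rows_pos[OF assms(1) M assms(3)] det_mats_rows_pos[OF assms(2) M assms(3)] by auto
  qed
  then show ?thesis using finite_rows_le[OF assms(1)] finite_subset by blast
qed

text \<open>If the shares differ, there are two different positions such that the first triple is
  maximal at one and the second triple at the other. The six cases are the ordered pairs of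
  positions.\<close>

lemma maxw_neq_cases:
  assumes "maxw e a c \<noteq> maxw e' a' c'"
  shows "(c \<le> a \<and> e \<le> a \<and> a' \<le> c' \<and> e' \<le> c') \<or> (a \<le> c \<and> e \<le> c \<and> c' \<le> a' \<and> e' \<le> a')
    \<or> (c \<le> a \<and> e \<le> a \<and> a' \<le> e' \<and> c' \<le> e') \<or> (a \<le> e \<and> c \<le> e \<and> c' \<le> a' \<and> e' \<le> a')
    \<or> (a \<le> e \<and> c \<le> e \<and> a' \<le> c' \<and> e' \<le> c') \<or> (a \<le> c \<and> e \<le> c \<and> a' \<le> e' \<and> c' \<le> e')"
  using assms unfolding maxw_def by (smt (verit))

lemma finite_sector_diff:
  assumes "posdef Q" "posdef Q'" "n \<noteq> 0"
  shows "finite {M \<in> det_mats n. sector Q M - sector Q' M \<noteq> 0}"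
proof -
  have "{M \<in> det_mats n. sector Q M - sector Q' M \<noteq> 0}
      \<subseteq> {(a, b, c, d). qval Q a b \<le> n^2 * qjoint Q Q' \<and> qval Q c d \<le> n^2 * qjoint Q Q'}"
  proof clarify
    fix a b c d assume M: "(a, b, c, d) \<in> det_mats n" and ne: "sector Q (a, b, c, d) - sector Q' (a, b, c, d) \<noteq> 0"
    define A C E where "A = qval Q c d" "C = qval Q a b" "E = qval Q (a + c) (b + d)"
    define A' C' E' where "A' = qval Q' c d" "C' = qval Q' a b" "E' = qval Q' (a + c) (b + d)"
    note defs = A_C_E_def A'_C'_E'_def
    have pos: "A > 0" "C > 0" "E > 0" "A' > 0" "C' > 0" "E' > 0"
      using det_mats_rows_pos[OF assms(1) M assms(3)] det_mats_rows_pos[OF assms(2) M assms(3)]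
      by (auto simp: defs)
    have J: "2 * A * C' + 2 * A' * C - (A + C - E) * (A' + C' - E') = n^2 * qjoint Q Q'" (is "_ = ?J")
      unfolding defs by (rule qjoint_rows) (use M in \<open>simp add: det_mats_def\<close>)
    then have J2: "2 * C * A' + 2 * C' * A - (C + A - E) * (C' + A' - E') = ?J"
      "2 * A * E' + 2 * A' * E - (A + E - C) * (A' + E' - C') = ?J"
      "2 * E * A' + 2 * E' * A - (E + A - C) * (E' + A' - C') = ?J"
      "2 * C * E' + 2 * C' * E - (C + E - A) * (C' + E' - A') = ?J"
      "2 * E * C' + 2 * E' * C - (E + C - A) * (E' + C' - A') = ?J"
      by (auto simp: algebra_simps)
    have "maxw E A C \<noteq> maxw E' A' C'" using ne by (simp add: defs)
    then have "A \<le> ?J \<and> C \<le> ?J"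
      using maxw_neq_cases[of E A C E' A' C']
        joint_bound_sector[OF pos(1,2,3,4,5,6) _ _ _ _ J]
        joint_bound_sector[OF pos(2,1,3,5,4,6) _ _ _ _ J2(1)]
        joint_bound_sector[OF pos(1,3,2,4,6,5) _ _ _ _ J2(2)]
        joint_bound_sector[OF pos(3,1,2,6,4,5) _ _ _ _ J2(3)]
        joint_bound_sector[OF pos(2,3,1,5,6,4) _ _ _ _ J2(4)]
        joint_bound_sector[OF pos(3,2,1,6,5,4) _ _ _ _ J2(5)]
      by blast
    then show "qval Q a b \<le> n^2 * qjoint Q Q' \<and> qval Q c d \<le> n^2 * qjoint Q Q'"
      by (simp add: defs)
  qed
  then show ?thesis using finite_rows_le[OF assms(1)] finite_subset by blast
qed

text \<open>With B = A + C - E this is 0 <= B <= min(A, C), the closed fundamental domain with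
  vertices rho, 0 and infinity. It is symmetric in A and C, unlike Gauss reduction, because the
  domain has a cusp at 0 as well.\<close>

lemma maxw_hstep_eq_0:
  assumes "A > 0" "C > 0" "hstep (A + C - E) + maxw E A C \<noteq> 1"
  shows "0 \<le> A + C - E" "A + C - E \<le> A" "A + C - E \<le> C"
  using assms by (auto simp: hstep_def maxw_def split: if_splits)

lemma domw_neq_0:
  assumes "posdef Q" "(a, b, c, d) \<in> det_mats n" "n \<noteq> 0" "domw Q (a, b, c, d) \<noteq> 0"
  shows "3 * qval Q c d * qval Q a b \<le> n^2 * (- bqf_disc Q)"
    "4 * qval Q c d * qval Q a b = n^2 * (- bqf_disc Q) + (qval Q c d + qval Q a b - qval Q (a + c) (b + d))^2"
proof -
  define A C B where "A = qval Q c d" "C = qval Q a b" "B = qval Q c d + qval Q a b - qval Q (a + c) (b + d)"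
  have pos: "A > 0" "C > 0"
    using det_mats_rows_pos[OF assms(1-3)] by (auto simp: A_C_B_def)
  have "0 \<le> B" "B \<le> A" "B \<le> C"
    using maxw_hstep_eq_0[of A C "qval Q (a + c) (b + d)"] pos assms(4)
    by (auto simp: A_C_B_def domw_def)
  then have le: "B^2 \<le> A * C" by (simp add: power2_eq_square mult_mono)
  have "4 * A * C - B * B = n^2 * qjoint Q Q"
    using qjoint_rows[of a d b c n Q Q] assms(2) by (simp add: A_C_B_def det_mats_def mult.commute)
  moreover have "qjoint Q Q = - bqf_disc Q"
    by (cases Q) (simp add: bqf_disc_def power2_eq_square)
  ultimately show eq: "4 * qval Q c d * qval Q a b = n^2 * (- bqf_disc Q) + (qval Q c d + qval Q a b - qval Q (a + c) (b + d))^2"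
    by (simp add: A_C_B_def power2_eq_square)
  show "3 * qval Q c d * qval Q a b \<le> n^2 * (- bqf_disc Q)"
    using eq le by (simp add: A_C_B_def)
qed

lemma finite_domw:
  assumes "posdef Q" "n \<noteq> 0"
  shows "finite {M \<in> det_mats n. domw Q M \<noteq> 0}"
proof -
  have "{M \<in> det_mats n. domw Q M \<noteq> 0}
      \<subseteq> {(a, b, c, d). qval Q a b \<le> n^2 * (- bqf_disc Q) \<and> qval Q c d \<le> n^2 * (- bqf_disc Q)}"
  proof clarify
    fix a b c d assume M: "(a, b, c, d) \<in> det_mats n" and ne: "domw Q (a, b, c, d) \<noteq> 0"
    note pos = det_mats_rows_pos[OF assms(1) M assms(2)]
    have "qval Q a b \<le> qval Q c d * qval Q a b" "qval Q c d \<le> qval Q c d * qval Q a b"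
      using pos by auto
    then show "qval Q a b \<le> n^2 * (- bqf_disc Q) \<and> qval Q c d \<le> n^2 * (- bqf_disc Q)"
      using domw_neq_0(1)[OF assms(1) M assms(2) ne] mult_pos_pos[OF pos(2,1)] by linarith
  qed
  then show ?thesis using finite_rows_le[OF assms(1)] finite_subset by blast
qed

section \<open>Sums of the weights over all matrices of a given determinant\<close>

lemma sum_side_diff:
  assumes "posdef Q" "posdef Q'" "n \<noteq> 0"
  shows "sum' (\<lambda>M. side Q M - side Q' M) (det_mats n) = 0"
  by (rule sum'_antisym[OF bij_Sl finite_side_diff[OF assms]]) (simp add: side_Sl)

lemma sum_sector_diff:
  assumes "posdef Q" "posdef Q'" "n \<noteq> 0"
  shows "sum' (\<lambda>M. sector Q M - sector Q' M) (det_mats n) = 0"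
proof (rule sum'_antirot[OF bij_Ul finite_sector_diff[OF assms]])
  fix M
  show "sector Q M - sector Q' M + (sector Q (Ul M) - sector Q' (Ul M))
      + (sector Q (Ul (Ul M)) - sector Q' (Ul (Ul M))) = 0"
    using sector_Ul[of Q M] sector_Ul[of Q' M] by simp
qed

text \<open>The two forms are |x i + y|^2 and |x rho + y|^2, so this is c(M).\<close>

definition coefw :: "imat \<Rightarrow> real" where
  "coefw M = side (1, 0, 1) M + sector (1, -1, 1) M - 1"

lemma posdef_units: "posdef (1, 0, 1)" "posdef (1, -1, 1)"
  by (simp_all add: posdef_def bqf_disc_def)

lemma finite_coefw:
  assumes "n \<noteq> 0"
  shows "finite {M \<in> det_mats n. coefw M \<noteq> 0}"
  by (rule finite_subset[OF _ finite_UnI[OF finite_domw[OF posdef_units(1) assms]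
        finite_sector_diff[OF posdef_units(2,1) assms]]])
     (auto simp: coefw_def domw_def)

text \<open>By independence of Q, the total weight of an orbit can be read off from the form x^2 + y^2; this
  replaces reduction theory.\<close>

lemma sum_domw_indep:
  assumes "posdef Q" "posdef Q'" "n \<noteq> 0"
  shows "sum' (domw Q) (det_mats n) = sum' (domw Q') (det_mats n)"
proof -
  have "sum' (domw Q) (det_mats n) - sum' (domw Q') (det_mats n)
      = sum' (\<lambda>M. domw Q M - domw Q' M) (det_mats n)"
    by (intro sum'_diff[symmetric] finite_domw assms)
  also have "\<dots> = sum' (\<lambda>M. (side Q M - side Q' M) + (sector Q M - sector Q' M)) (det_mats n)"
    by (simp add: domw_def algebra_simps)
  also have "\<dots> = 0"
    by (subst sum.distrib'[OF finite_side_diff finite_sector_diff])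
       (simp_all add: assms sum_side_diff sum_sector_diff)
  finally show ?thesis by simp
qed

lemma sum_coefw_eq_sum_domw:
  assumes "n \<noteq> 0"
  shows "sum' coefw (det_mats n) = sum' (domw (1, 0, 1)) (det_mats n)"
proof -
  have "sum' coefw (det_mats n)
      = sum' (\<lambda>M. domw (1, 0, 1) M + (sector (1, -1, 1) M - sector (1, 0, 1) M)) (det_mats n)"
    by (rule sum.cong') (auto simp: coefw_def domw_def)
  also have "\<dots> = sum' (domw (1, 0, 1)) (det_mats n)"
    by (subst sum.distrib'[OF finite_domw finite_sector_diff])
       (simp_all add: assms posdef_units sum_sector_diff)
  finally show ?thesis .
qed

lemma sum_squares_eq_1: "a^2 + b^2 = (1::int) \<Longrightarrow> (\<bar>a\<bar> = 1 \<and> b = 0) \<or> (a = 0 \<and> \<bar>b\<bar> = 1)"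
proof -
  assume h: "a^2 + b^2 = 1"
  have "a^2 \<le> 1" "b^2 \<le> 1" using h zero_le_power2[of a] zero_le_power2[of b] by linarith+
  then have "\<bar>a\<bar> \<le> 1" "\<bar>b\<bar> \<le> 1" by (simp_all add: abs_square_le_1)
  then have "a \<in> {-1, 0, 1}" "b \<in> {-1, 0, 1}" by auto
  then show ?thesis using h by auto
qed

lemma sum_domw_SL2_unit: "sum' (domw (1, 0, 1)) (det_mats 1) = 2"
proof -
  \<comment> \<open>The stabilizer of i. Each of its four elements has weight 1/2, since i lies on
    the boundary of the half plane of f and inside the region of g.\<close>
  define B :: "imat set" where "B = {(1, 0, 0, 1), (-1, 0, 0, -1), (0, 1, -1, 0), (0, -1, 1, 0)}"
  have "sum' (domw (1, 0, 1)) (det_mats 1) = sum (domw (1, 0, 1)) B"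
  proof (rule sum'_eq_sum)
    fix M assume M: "M \<in> det_mats 1" "M \<notin> B"
    obtain a b c d where Meq: "M = (a, b, c, d)" by (cases M)
    show "domw (1, 0, 1) M = 0"
    proof (rule ccontr)
      assume ne: "domw (1, 0, 1) M \<noteq> 0"
      define A C where "A = c^2 + d^2" "C = a^2 + b^2"
      note h = domw_neq_0[OF posdef_units(1) M(1)[unfolded Meq] _ ne[unfolded Meq]]
      have pos: "A > 0" "C > 0"
        using det_mats_rows_pos[OF posdef_units(1) M(1)[unfolded Meq]] by (auto simp: A_C_def)
      have "3 * A * C \<le> 4" using h(1) by (simp add: A_C_def bqf_disc_def)
      then have "A * C \<le> 1" by simp
      moreover have "A \<le> A * C" "C \<le> A * C" using pos by auto
      ultimately have AC: "A = 1" "C = 1" using pos by linarith+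
      then have "(\<bar>c\<bar> = 1 \<and> d = 0) \<or> (c = 0 \<and> \<bar>d\<bar> = 1)" "(\<bar>a\<bar> = 1 \<and> b = 0) \<or> (a = 0 \<and> \<bar>b\<bar> = 1)"
        using sum_squares_eq_1 by (auto simp: A_C_def)
      moreover have "a * d - b * c = 1" using M(1) by (simp add: Meq det_mats_def)
      ultimately have "M \<in> B" by (auto simp: Meq B_def abs_if split: if_splits)
      then show False using M(2) by simp
    qed
  qed (auto simp: B_def det_mats_def)
  also have "\<dots> = 2" by (simp add: B_def domw_def hstep_def maxw_def)
  finally show ?thesis .
qed

lemma sum_domw_SL2:
  assumes "posdef Q"
  shows "sum' (domw Q) (det_mats 1) = 2"
  using sum_domw_indep[OF assms posdef_units(1), of 1] sum_domw_SL2_unit by simp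

section \<open>Prime determinant: cosets of the Hecke correspondence\<close>

fun mmul :: "imat \<Rightarrow> imat \<Rightarrow> imat" where
  "mmul (a, b, c, d) (a', b', c', d') = (a * a' + b * c', a * b' + b * d', c * a' + d * c', c * b' + d * d')"

text \<open>Substitution of the row vector (x, y) N into Q. If Q is proportional to |x z + y|^2, the
  result is proportional to |x w + y|^2 with w = N z.\<close>

fun qpull :: "bqf \<Rightarrow> imat \<Rightarrow> bqf" where
  "qpull Q (a, b, c, d) = (qval Q a b, qval Q (a + c) (b + d) - qval Q a b - qval Q c d, qval Q c d)"

lemma qval_qpull: "qval (qpull Q (a, b, c, d)) x y = qval Q (x * a + y * c) (x * b + y * d)"
  by (cases Q) (simp add: ring_eqs)

lemma domw_mmul: "domw Q (mmul G N) = domw (qpull Q N) G"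
proof -
  obtain a b c d where N: "N = (a, b, c, d)" by (cases N)
  obtain x y z w where G: "G = (x, y, z, w)" by (cases G)
  have "side Q (mmul G N) = side (qpull Q N) G" "sector Q (mmul G N) = sector (qpull Q N) G"
    by (simp_all add: N G qval_qpull distrib_right add_ac del: qpull.simps)
  then show ?thesis by (simp add: domw_def)
qed

lemma posdef_qpull:
  assumes "posdef Q" "N \<in> det_mats n" "n \<noteq> 0"
  shows "posdef (qpull Q N)"
proof -
  obtain a b c d where N: "N = (a, b, c, d)" by (cases N)
  have "qval Q a b > 0" using det_mats_rows_pos(1) assms by (simp add: N)
  moreover have "bqf_disc (qpull Q N) = n^2 * bqf_disc Q"
  proof -
    have "bqf_disc (qpull Q N) = (a * d - b * c)^2 * bqf_disc Q"
      by (cases Q) (simp add: N bqf_disc_def ring_eqs)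
    then show ?thesis using assms(2) by (simp add: N det_mats_def)
  qed
  moreover have "n^2 * bqf_disc Q < 0" using assms(1,3) by (simp add: posdef_def mult_pos_neg)
  ultimately show ?thesis by (simp add: posdef_def N)
qed

definition hecke_reps :: "int \<Rightarrow> imat set" where
  "hecke_reps p = insert (p, 0, 0, 1) ((\<lambda>b. (1, b, 0, p)) ` {0..<p})"

lemma card_hecke_reps: "p > 1 \<Longrightarrow> card (hecke_reps p) = nat (p + 1)"
  unfolding hecke_reps_def
  by (subst card_insert_disjoint) (auto simp: card_image inj_on_def nat_add_distrib)

text \<open>The coset of M is read off from its columns modulo p: the representative is (p, 0, 0, 1)
  if the first column vanishes, and otherwise (1, b, 0, p), where the second column is b times the
  first.\<close>

lemma det_mats_decomp:
  assumes p: "prime p"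
  shows "bij_betw (\<lambda>(G, N). mmul G N) (det_mats 1 \<times> hecke_reps p) (det_mats p)"
  unfolding bij_betw_def
proof
  have p0: "p > 1" using p prime_gt_1_int by blast
  have mem: "N \<in> hecke_reps p \<longleftrightarrow> N = (p, 0, 0, 1) \<or> (\<exists>b. 0 \<le> b \<and> b < p \<and> N = (1, b, 0, p))" for N
    by (auto simp: hecke_reps_def)
  have nocol: False if "x * w - y * z = 1" "p dvd x" "p dvd z" for x y z w :: int
  proof -
    have "p dvd x * w - y * z" using that by (intro dvd_diff) auto
    then show False using that p not_prime_unit by auto
  qed
  have uniq: "b = b'" if "x * w - y * z = 1" "x * b + y * p = x * b' + y' * p"
    "z * b + w * p = z * b' + w' * p" "0 \<le> b" "b < p" "0 \<le> b'" "b' < p" for x y z w y' w' b b' :: int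
  proof -
    have "x * (b - b') = (y' - y) * p" "z * (b - b') = (w' - w) * p"
      using that by (auto simp: algebra_simps)
    then have "p dvd x * (b - b')" "p dvd z * (b - b')" by simp_all
    then have "p dvd b - b'" using nocol[OF that(1)] p prime_dvd_mult_iff by blast
    then show ?thesis using that zdvd_imp_le[of p "b - b'"] zdvd_imp_le[of p "b' - b"]
      by (cases b b' rule: linorder_cases) (auto simp: dvd_diff_commute)
  qed
  show "inj_on (\<lambda>(G, N). mmul G N) (det_mats 1 \<times> hecke_reps p)"
  proof (rule inj_onI, clarify)
    fix x y z w N1 N2 N3 N4 x' y' z' w' N1' N2' N3' N4'
    assume G: "(x, y, z, w) \<in> det_mats 1" and N: "(N1, N2, N3, N4) \<in> hecke_reps p"
      and G': "(x', y', z', w') \<in> det_mats 1" and N': "(N1', N2', N3', N4') \<in> hecke_reps p"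
      and eq: "mmul (x, y, z, w) (N1, N2, N3, N4) = mmul (x', y', z', w') (N1', N2', N3', N4')"
    note d = G[unfolded det_mats_def, simplified] G'[unfolded det_mats_def, simplified]
    consider "(N1, N2, N3, N4) = (p, 0, 0, 1)" "(N1', N2', N3', N4') = (p, 0, 0, 1)"
      | b where "(N1, N2, N3, N4) = (p, 0, 0, 1)" "(N1', N2', N3', N4') = (1, b, 0, p)"
      | b where "(N1, N2, N3, N4) = (1, b, 0, p)" "(N1', N2', N3', N4') = (p, 0, 0, 1)"
      | b b' where "(N1, N2, N3, N4) = (1, b, 0, p)" "(N1', N2', N3', N4') = (1, b', 0, p)"
         "0 \<le> b" "b < p" "0 \<le> b'" "b' < p"
      using N N' unfolding mem by blast
    then show "(x, y, z, w) = (x', y', z', w') \<and> (N1, N2, N3, N4) = (N1', N2', N3', N4')"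
    proof cases
      case 1 then show ?thesis using eq p0 by simp
    next
      case 2
      then have "x' = x * p" "z' = z * p" using eq by auto
      then show ?thesis using nocol[OF d(2)] by simp
    next
      case 3
      then have "x = x' * p" "z = z' * p" using eq by auto
      then show ?thesis using nocol[OF d(1)] by simp
    next
      case 4
      then have e: "x = x'" "z = z'" "x * b + y * p = x' * b' + y' * p" "z * b + w * p = z' * b' + w' * p"
        using eq by auto
      then have "b = b'" using uniq[OF d(1)] 4 by blast
      then show ?thesis using e 4 p0 by auto
    qed
  qed
  show "(\<lambda>(G, N). mmul G N) ` (det_mats 1 \<times> hecke_reps p) = det_mats p"
  proof (intro equalityI subsetI)
    fix M assume "M \<in> (\<lambda>(G, N). mmul G N) ` (det_mats 1 \<times> hecke_reps p)"
    then obtain x y z w N where G: "x * w - y * z = 1" and N: "N \<in> hecke_reps p"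
      and M: "M = mmul (x, y, z, w) N" by (auto simp: det_mats_def)
    have "x * p * w - y * (z * p) = p" "x * (z * b + w * p) - (x * b + y * p) * z = p" for b
      using arg_cong[OF G, of "\<lambda>t. t * p"] by (simp_all add: algebra_simps)
    then show "M \<in> det_mats p" using N unfolding M mem by (auto simp: det_mats_def)
  next
    fix M assume Mp: "M \<in> det_mats p"
    obtain a b c d where M: "M = (a, b, c, d)" by (cases M)
    have det: "a * d - b * c = p" using Mp by (simp add: M det_mats_def)
    show "M \<in> (\<lambda>(G, N). mmul G N) ` (det_mats 1 \<times> hecke_reps p)"
    proof (cases "p dvd a \<and> p dvd c")
      case True
      then obtain x z where xz: "a = p * x" "c = p * z" by (auto simp: dvd_def)
      have "p * (x * d - b * z) = p * 1" using det by (simp add: xz algebra_simps)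
      then have "x * d - b * z = 1" using p0 by simp
      then have "(x, b, z, d) \<in> det_mats 1" by (simp add: det_mats_def)
      then show ?thesis
        by (intro image_eqI[of _ _ "((x, b, z, d), (p, 0, 0, 1))"]) (auto simp: M xz mem algebra_simps)
    next
      case False
      have ex: "\<exists>t. 0 \<le> t \<and> t < p \<and> p dvd v - u * t" if "\<not> p dvd u" for u v :: int
      proof -
        have "coprime u p" using that p prime_imp_coprime coprime_commute by blast
        then obtain s where s: "[u * s = v] (mod p)" using cong_solve_coprime_int
          by (metis cong_scalar_left mult.assoc mult.commute mult_1)
        have "[u * (s mod p) = v] (mod p)"
          using s by (simp add: cong_def mod_mult_right_eq)
        then have "p dvd v - u * (s mod p)" by (simp add: cong_iff_dvd_diff dvd_diff_commute cong_sym_eq)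
        then show ?thesis using p0 by (intro exI[of _ "s mod p"]) simp
      qed
      \<comment> \<open>The determinant vanishes modulo p, so the columns are proportional there; a
        factor t found from a row whose first entry is nonzero modulo p also works for the other
        row.\<close>
      obtain t where t: "0 \<le> t" "t < p" "p dvd b - a * t" "p dvd d - c * t"
      proof (cases "p dvd a")
        case na: False
        obtain t where t: "0 \<le> t" "t < p" "p dvd b - a * t" using ex[OF na] by blast
        have "a * (d - c * t) = p + c * (b - a * t)" using det by (simp add: algebra_simps)
        then have "p dvd a * (d - c * t)" using t(3) by simp
        then show ?thesis using that t na p prime_dvd_mult_iff by blast
      next
        case True
        then have nc: "\<not> p dvd c" using False by simp
        obtain t where t: "0 \<le> t" "t < p" "p dvd d - c * t" using ex[OF nc] by blast
        have "c * (b - a * t) = a * (d - c * t) - p" using det by (simp add: algebra_simps)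
        then have "p dvd c * (b - a * t)" using t(3) by simp
        then show ?thesis using that t nc p prime_dvd_mult_iff by blast
      qed
      then obtain y w where yw: "b - a * t = p * y" "d - c * t = p * w" by (auto simp: dvd_def)
      have "p * (a * w - y * c) = a * (d - c * t) - (b - a * t) * c"
        unfolding yw by (simp add: algebra_simps)
      also have "\<dots> = p * 1" using det by (simp add: algebra_simps)
      finally have "a * w - y * c = 1" using p0 by simp
      then have "(a, y, c, w) \<in> det_mats 1" by (simp add: det_mats_def)
      then show ?thesis using yw t
        by (intro image_eqI[of _ _ "((a, y, c, w), (1, t, 0, p))"]) (auto simp: M mem algebra_simps)
    qed
  qed
qed

text \<open>Each of the p + 1 cosets of SL_2(Z) contributes the total weight 2 of an SL_2(Z)-orbit,
  by independence of the form.\<close>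

lemma sum_coefw_prime:
  assumes "prime p"
  shows "sum' coefw (det_mats p) = 2 * (p + 1)"
proof -
  let ?Q = "(1, 0, 1)"
  have p0: "p > 1" using assms prime_gt_1_int by blast
  define X where "X = det_mats 1 \<times> hecke_reps p"
  define F where "F = (\<lambda>(G, N). domw (qpull ?Q N) G)"
  have reps: "N \<in> hecke_reps p \<Longrightarrow> N \<in> det_mats p" for N
    by (auto simp: hecke_reps_def det_mats_def)
  have fin_reps: "finite (hecke_reps p)" by (simp add: hecke_reps_def)
  have pd: "posdef (qpull ?Q N)" if "N \<in> hecke_reps p" for N
    using posdef_qpull[OF posdef_units(1) reps[OF that]] p0 by simp
  have "{x \<in> X. F x \<noteq> 0} \<subseteq> (\<Union>N\<in>hecke_reps p. {G \<in> det_mats 1. domw (qpull ?Q N) G \<noteq> 0} \<times> {N})"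
    by (auto simp: X_def F_def)
  then have finF: "finite {x \<in> X. F x \<noteq> 0}"
    using fin_reps finite_domw[OF pd, of _ 1] by (elim finite_subset) auto
  have "sum' coefw (det_mats p) = sum' (domw ?Q) (det_mats p)"
    using sum_coefw_eq_sum_domw p0 by simp
  also have "\<dots> = sum' (\<lambda>x. domw ?Q ((\<lambda>(G, N). mmul G N) x)) X"
    unfolding X_def by (rule sum'_reindex[OF det_mats_decomp[OF assms], symmetric])
  also have "\<dots> = sum' F X"
    by (rule sum.cong') (auto simp: F_def domw_mmul simp del: qpull.simps mmul.simps)
  also have "\<dots> = (\<Sum>N\<in>hecke_reps p. sum' F {x \<in> X. snd x = N})"
    by (rule sum'_group[OF finF fin_reps]) (auto simp: X_def)
  also have "\<dots> = (\<Sum>N\<in>hecke_reps p. 2)"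
  proof (rule sum.cong[OF refl])
    fix N assume N: "N \<in> hecke_reps p"
    have "bij_betw (\<lambda>G. (G, N)) (det_mats 1) {x \<in> X. snd x = N}"
      using N by (auto simp: bij_betw_def inj_on_def X_def)
    from sum'_reindex[OF this, of F] have "sum' F {x \<in> X. snd x = N} = sum' (domw (qpull ?Q N)) (det_mats 1)"
      by (simp add: F_def)
    then show "sum' F {x \<in> X. snd x = N} = 2" using sum_domw_SL2[OF pd[OF N]] by simp
  qed
  finally show ?thesis using card_hecke_reps[OF p0] p0 by simp
qed

subsection \<open>Class numbers as weighted counts of forms\<close>

text \<open>f + g - 1 in terms of the coefficients of a form. At (k, 0, k) and (k, k, k) with k > 0
  its values are 1/2 and 1/3, the weights in the definition of H.\<close>

fun formw :: "bqf \<Rightarrow> real" where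
  "formw (A, B, C) = hstep B + maxw (A - B + C) A C - 1"

fun qact :: "bqf \<Rightarrow> imat \<Rightarrow> bqf" where
  "qact f (\<alpha>, \<beta>, \<gamma>, \<delta>) = bqf_act f \<alpha> \<beta> \<gamma> \<delta>"

lemma qval_qact: "qval (qact f (\<alpha>, \<beta>, \<gamma>, \<delta>)) x y = qval f (\<alpha> * x + \<beta> * y) (\<gamma> * x + \<delta> * y)"
  by (cases f) (simp add: bqf_act_def ring_eqs)

lemma bqf_eqI: "f = g" if "\<And>x y. qval f x y = qval g x y"
  using that[of 1 0] that[of 0 1] that[of 1 1] by (cases f; cases g) simp

lemma qact_mmul: "qact f (mmul G H) = qact (qact f G) H"
proof (rule bqf_eqI)
  fix x y
  obtain a b c d where G: "G = (a, b, c, d)" by (cases G)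
  obtain a' b' c' d' where H: "H = (a', b', c', d')" by (cases H)
  show "qval (qact f (mmul G H)) x y = qval (qact (qact f G) H) x y"
    unfolding G H mmul.simps qval_qact by (simp add: algebra_simps)
qed

text \<open>The substitution sends (1, 0), (0, 1) and (1, -1) to the bottom row of the matrix, minus
  its top row, and the sum of its rows, which are the arguments in \<open>side\<close> and
  \<open>sector\<close>.\<close>

lemma formw_qact:
  "domw f (a, b, c, d) = formw (qact f (c, - a, d, - b))"
proof -
  obtain k l m where f: "f = (k, l, m)" by (cases f)
  define A B C where "A = qval f c d" "B = qval f c d + qval f a b - qval f (a + c) (b + d)" "C = qval f a b"
  have "qact f (c, - a, d, - b) = (A, B, C)"
    by (simp add: f A_B_C_def bqf_act_def ring_eqs)
  then show ?thesis by (simp add: domw_def A_B_C_def)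
qed

lemma disc_qact: "G \<in> det_mats 1 \<Longrightarrow> bqf_disc (qact f G) = bqf_disc f"
proof -
  assume G1: "G \<in> det_mats 1"
  obtain k l m where f: "f = (k, l, m)" by (cases f)
  obtain x y z w where G: "G = (x, y, z, w)" by (cases G)
  have "bqf_disc (qact f G) = (x * w - y * z)^2 * bqf_disc f"
    by (simp add: f G bqf_act_def bqf_disc_def ring_eqs)
  then show ?thesis using G1 by (simp add: G det_mats_def)
qed

lemma pd_forms_posdef: "f \<in> pd_forms N \<Longrightarrow> posdef f"
  by (simp add: pd_forms_def posdef_def)

lemma qact_pd_forms:
  assumes "f \<in> pd_forms N" "G \<in> det_mats 1"
  shows "qact f G \<in> pd_forms N"
proof -
  obtain x y z w where G: "G = (x, y, z, w)" by (cases G)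
  have "fst (qact f G) = qval f x z"
    by (cases f) (simp add: G bqf_act_def)
  moreover have "x \<noteq> 0 \<or> z \<noteq> 0" using assms(2) by (auto simp: G det_mats_def)
  ultimately have "fst (qact f G) > 0" using qval_pos[OF pd_forms_posdef[OF assms(1)]] by simp
  then show ?thesis using assms disc_qact[OF assms(2), of f] by (simp add: pd_forms_def)
qed

lemma bqf_equiv_iff: "(f, g) \<in> bqf_equiv \<longleftrightarrow> (\<exists>G\<in>det_mats 1. g = qact f G)"
proof
  assume "(f, g) \<in> bqf_equiv"
  then obtain \<alpha> \<beta> \<gamma> \<delta> where "\<alpha> * \<delta> - \<beta> * \<gamma> = 1" "g = bqf_act f \<alpha> \<beta> \<gamma> \<delta>"
    unfolding bqf_equiv_def by blast
  then show "\<exists>G\<in>det_mats 1. g = qact f G"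
    by (intro bexI[of _ "(\<alpha>, \<beta>, \<gamma>, \<delta>)"]) (simp_all add: det_mats_def)
next
  assume "\<exists>G\<in>det_mats 1. g = qact f G"
  then obtain \<alpha> \<beta> \<gamma> \<delta> where "(\<alpha>, \<beta>, \<gamma>, \<delta>) \<in> det_mats 1" "g = qact f (\<alpha>, \<beta>, \<gamma>, \<delta>)"
    by (metis prod_cases4)
  then show "(f, g) \<in> bqf_equiv"
    unfolding bqf_equiv_def det_mats_def by auto
qed

definition minv :: "imat \<Rightarrow> imat" where "minv = (\<lambda>(a, b, c, d). (d, - b, - c, a))"

lemma minv: "G \<in> det_mats 1 \<Longrightarrow> minv G \<in> det_mats 1"
    "G \<in> det_mats 1 \<Longrightarrow> mmul G (minv G) = (1, 0, 0, 1)"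
    "G \<in> det_mats 1 \<Longrightarrow> mmul (minv G) G = (1, 0, 0, 1)"
  by (auto simp: det_mats_def minv_def algebra_simps)

lemma mmul_det: "G \<in> det_mats 1 \<Longrightarrow> H \<in> det_mats 1 \<Longrightarrow> mmul G H \<in> det_mats 1"
proof -
  assume h: "G \<in> det_mats 1" "H \<in> det_mats 1"
  obtain x y z w where G: "G = (x, y, z, w)" by (cases G)
  obtain x' y' z' w' where H: "H = (x', y', z', w')" by (cases H)
  have "(x * x' + y * z') * (z * y' + w * w') - (x * y' + y * w') * (z * x' + w * z')
      = (x * w - y * z) * (x' * w' - y' * z')" by (simp add: algebra_simps)
  then show ?thesis using h by (simp add: G H det_mats_def)
qed

lemma mmul_assoc: "mmul (mmul G H) K = mmul G (mmul H K)"
  by (cases G; cases H; cases K) (simp add: algebra_simps)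

lemma mmul_1: "mmul (1, 0, 0, 1) G = G" "mmul G (1, 0, 0, 1) = G"
  by (cases G; simp)+

lemma qact_1: "qact f (1, 0, 0, 1) = f"
  by (cases f) (simp add: bqf_act_def)

lemma equiv_pd: "equiv (pd_forms N) (bqf_equiv \<inter> (pd_forms N \<times> pd_forms N))"
proof (rule equivI)
  show "bqf_equiv \<inter> pd_forms N \<times> pd_forms N \<subseteq> pd_forms N \<times> pd_forms N" by blast
  have "(f, f) \<in> bqf_equiv" for f
    using bqf_equiv_iff[of f f] qact_1[of f] bexI[of "\<lambda>G. f = qact f G" "(1, 0, 0, 1)" "det_mats 1"]
    by (simp add: det_mats_def del: qact.simps)
  then show "refl_on (pd_forms N) (bqf_equiv \<inter> (pd_forms N \<times> pd_forms N))"
    by (simp add: refl_on_def)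
  have "(g, f) \<in> bqf_equiv" if fg: "(f, g) \<in> bqf_equiv" for f g
  proof -
    obtain G where G: "G \<in> det_mats 1" "g = qact f G" using fg unfolding bqf_equiv_iff by blast
    then have "f = qact g (minv G)" by (simp only: qact_mmul[symmetric] minv[OF G(1)] qact_1)
    then show ?thesis unfolding bqf_equiv_iff using minv(1)[OF G(1)] by blast
  qed
  then show "sym (bqf_equiv \<inter> (pd_forms N \<times> pd_forms N))"
    by (simp add: sym_def)
  have "(f, h) \<in> bqf_equiv" if fgh: "(f, g) \<in> bqf_equiv" "(g, h) \<in> bqf_equiv" for f g h
  proof -
    obtain G H where "G \<in> det_mats 1" "g = qact f G" "H \<in> det_mats 1" "h = qact g H"
      using fgh unfolding bqf_equiv_iff by blast
    then show ?thesis unfolding bqf_equiv_iff using mmul_det[of G H] qact_mmul[of f G H] by metis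
  qed
  then show "trans (bqf_equiv \<inter> (pd_forms N \<times> pd_forms N))"
    unfolding trans_def by blast
qed

section \<open>Stabilizers and the total weight of a class\<close>

definition stab :: "bqf \<Rightarrow> imat set" where
  "stab f = {G \<in> det_mats 1. qact f G = f}"

lemma card_qact_fiber:
  assumes "G0 \<in> det_mats 1"
  shows "bij_betw (\<lambda>H. mmul H G0) (stab f) {G \<in> det_mats 1. qact f G = qact f G0}"
proof (rule bij_betw_byWitness[where f' = "\<lambda>G. mmul G (minv G0)"])
  show "\<forall>H\<in>stab f. mmul (mmul H G0) (minv G0) = H"
    by (simp add: mmul_assoc minv assms mmul_1)
  show "\<forall>G\<in>{G \<in> det_mats 1. qact f G = qact f G0}. mmul (mmul G (minv G0)) G0 = G"
    by (simp add: mmul_assoc minv assms mmul_1)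
  show "(\<lambda>H. mmul H G0) ` stab f \<subseteq> {G \<in> det_mats 1. qact f G = qact f G0}"
    using mmul_det[OF _ assms] qact_mmul[of f _ G0] unfolding stab_def by fastforce
  have "mmul G (minv G0) \<in> stab f" if "G \<in> det_mats 1" "qact f G = qact f G0" for G
  proof -
    have "qact f (mmul G (minv G0)) = qact f (mmul G0 (minv G0))"
      by (simp only: qact_mmul that)
    also have "\<dots> = f" by (simp only: minv assms qact_1)
    finally show ?thesis using mmul_det[OF that(1) minv(1)[OF assms]] by (simp add: stab_def)
  qed
  then show "(\<lambda>G. mmul G (minv G0)) ` {G \<in> det_mats 1. qact f G = qact f G0} \<subseteq> stab f"
    by blast
qed

lemma bij_SL2_columns: "bij_betw (\<lambda>(a, b, c, d). (c, - a, d, - b)) (det_mats 1) (det_mats 1)"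
  by (rule bij_betw_byWitness[where f' = "\<lambda>(\<alpha>, \<beta>, \<gamma>, \<delta>). (- \<beta>, - \<delta>, \<alpha>, \<gamma>)"])
     (auto simp: det_mats_def algebra_simps)

lemma formw_neq_0:
  assumes "posdef (A, B, C)" "formw (A, B, C) \<noteq> 0"
  shows "A > 0" "C > 0" "0 \<le> B" "B \<le> A" "B \<le> C"
proof -
  have "A > 0" "B^2 < 4 * A * C" using assms(1) by (auto simp: posdef_def bqf_disc_def)
  moreover have "0 < A * C" using calculation zero_le_power2[of B] by (simp only: mult.assoc)
  ultimately have "A > 0 \<and> C > 0" by (simp add: zero_less_mult_iff)
  then show pos: "A > 0" "C > 0" by auto
  show "0 \<le> B" "B \<le> A" "B \<le> C"
    using maxw_hstep_eq_0[of A C "A - B + C"] pos assms(2) by auto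
qed

lemma finite_formw: "finite {f \<in> pd_forms N. formw f \<noteq> 0}"
proof -
  have "{f \<in> pd_forms N. formw f \<noteq> 0} \<subseteq> {0..N} \<times> {0..N} \<times> {0..N}"
  proof
    fix f assume "f \<in> {f \<in> pd_forms N. formw f \<noteq> 0}"
    moreover obtain A B C where "f = (A, B, C)" by (cases f)
    ultimately have f: "(A, B, C) \<in> pd_forms N" and ne: "formw (A, B, C) \<noteq> 0" and feq: "f = (A, B, C)" by auto
    note h = formw_neq_0[OF pd_forms_posdef[OF f] ne]
    have "B^2 \<le> A * C" using h by (simp add: power2_eq_square mult_mono)
    moreover have "4 * (A * C) = N + B^2" using f by (simp add: pd_forms_def bqf_disc_def)
    moreover have "A \<le> A * C" "C \<le> A * C" using h by auto
    moreover have "0 < A * C" using h by simp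
    ultimately have "A \<le> N" "C \<le> N" by linarith+
    then show "f \<in> {0..N} \<times> {0..N} \<times> {0..N}" using h feq by auto
  qed
  then show ?thesis by (rule finite_subset) simp
qed

lemma pd_class_eq:
  assumes "C \<in> pd_classes N" "f \<in> C"
  shows "f \<in> pd_forms N" "C = qact f ` det_mats 1"
proof -
  have sub: "C \<subseteq> pd_forms N"
    using assms(1) equiv_pd in_quotient_imp_subset unfolding pd_classes_def by blast
  then show f: "f \<in> pd_forms N" using assms(2) by blast
  let ?r = "bqf_equiv \<inter> (pd_forms N \<times> pd_forms N)"
  obtain g where g: "C = ?r `` {g}" using assms(1) unfolding pd_classes_def by (rule quotientE)
  then have "(g, f) \<in> ?r" using assms(2) by blast
  then have "C = ?r `` {f}" using equiv_class_eq[OF equiv_pd] g by simp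
  then have "x \<in> C \<longleftrightarrow> x \<in> pd_forms N \<and> (\<exists>G\<in>det_mats 1. x = qact f G)" for x
    using f by (simp add: bqf_equiv_iff conj_commute del: qact.simps)
  then show "C = qact f ` det_mats 1"
    using qact_pd_forms[OF f] by blast
qed

text \<open>Orbit and stabilizer: the SL_2(Z)-sum of \<open>domw f\<close>, which is 2, meets every
  form of the class \<open>card (stab f)\<close> times.\<close>

lemma class_sum:
  assumes "C \<in> pd_classes N" "f \<in> C"
  shows "card (stab f) * sum' formw C = 2"
proof -
  note f = pd_class_eq[OF assms]
  define F where "F = (\<lambda>G. formw (qact f G))"
  define R where "R = {g \<in> C. formw g \<noteq> 0}"
  have sub: "C \<subseteq> pd_forms N" using f(2) qact_pd_forms[OF f(1)] by blast
  have finR: "finite R" unfolding R_def using sub by (intro finite_subset[OF _ finite_formw[of N]]) blast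
  have eqF: "domw f M = F ((\<lambda>(a, b, c, d). (c, - a, d, - b)) M)" for M
    using formw_qact by (cases M) (simp add: F_def)
  have s: "sum' F (det_mats 1) = 2"
    using sum'_reindex[OF bij_SL2_columns, of F] sum_domw_SL2[OF pd_forms_posdef[OF f(1)]]
    by (simp add: eqF[symmetric])
  have "finite {M \<in> det_mats 1. domw f M \<noteq> 0}"
    by (intro finite_domw pd_forms_posdef[OF f(1)]) simp
  then have finF: "finite {G \<in> det_mats 1. F G \<noteq> 0}"
    using finite_supp_bij[OF bij_SL2_columns, of F] by (simp only: eqF)
  have "sum' F (det_mats 1) = (\<Sum>g\<in>R. sum' F {G \<in> det_mats 1. qact f G = g})"
    by (rule sum'_group[OF finF finR]) (auto simp: R_def F_def f(2))
  also have "\<dots> = (\<Sum>g\<in>R. card (stab f) * formw g)"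
  proof (rule sum.cong[OF refl])
    fix g assume g: "g \<in> R"
    then obtain G0 where G0: "G0 \<in> det_mats 1" "g = qact f G0" by (auto simp: R_def f(2))
    let ?X = "{G \<in> det_mats 1. qact f G = g}"
    have "finite ?X" using g by (intro finite_subset[OF _ finF]) (auto simp: F_def R_def)
    then have "sum' F ?X = sum F ?X" by simp
    also have "\<dots> = card ?X * formw g" by (simp add: F_def)
    also have "card ?X = card (stab f)"
      using bij_betw_same_card[OF card_qact_fiber[OF G0(1), of f]] G0(2) by simp
    finally show "sum' F ?X = card (stab f) * formw g" .
  qed
  also have "\<dots> = card (stab f) * sum' formw C"
    using finR by (subst sum'_eq_sum[of R C formw]) (auto simp: R_def sum_distrib_left)
  finally show ?thesis using s by simp
qed

text \<open>If Q is the Gram matrix, invariance says Q G = (transpose of the inverse of G) Q. Since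
  G has determinant 1, its inverse has the same entries up to order and sign, and the conditions
  become linear in G.\<close>

lemma stab_linear:
  assumes "(a, b, c, d) \<in> stab (A, B, C)"
  shows "A * (d - a) = B * c" "A * b = - C * c" "C * (d - a) = - B * b"
proof -
  have det: "a * d - b * c = 1"
    and e: "A * a^2 + B * a * c + C * c^2 = A"
      "2 * A * a * b + B * (a * d + b * c) + 2 * C * c * d = B"
      "A * b^2 + B * b * d + C * d^2 = C"
    using assms by (auto simp: stab_def det_mats_def bqf_act_def)
  have "(2 * A * a + B * c) * (a * d - b * c)
      = 2 * d * (A * a^2 + B * a * c + C * c^2)
        - c * (2 * A * a * b + B * (a * d + b * c) + 2 * C * c * d)"
    by (simp add: ring_eqs)
  then show "A * (d - a) = B * c" unfolding e det by (simp add: algebra_simps)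
  have "(B * a + 2 * C * c) * (a * d - b * c)
      = a * (2 * A * a * b + B * (a * d + b * c) + 2 * C * c * d)
        - 2 * b * (A * a^2 + B * a * c + C * c^2)"
    by (simp add: ring_eqs)
  then show "A * b = - C * c" unfolding e det by (simp add: algebra_simps)
  have "(B * b + 2 * C * d) * (a * d - b * c)
      = 2 * a * (A * b^2 + B * b * d + C * d^2)
        - b * (2 * A * a * b + B * (a * d + b * c) + 2 * C * c * d)"
    by (simp add: ring_eqs)
  then show "C * (d - a) = - B * b" unfolding e det by (simp add: algebra_simps)
qed

text \<open>For an automorph with d - a = n, the reduction inequalities give |n| <= |c| and - b c >=
  c^2, so 3 c^2 <= - 4 b c - n^2 = 4 - t^2 <= 4. This forces c^2 = 1 and - b c = 1, hence A = C, and
  n = 0 or |n| = 1 decides between B = 0 and B = A.\<close>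

lemma reduced_automorph_aux:
  fixes A B C b c n t :: int
  assumes "A > 0" "0 \<le> B" "B \<le> A" "A \<le> C" "c \<noteq> 0"
    and "A * n = B * c" "A * b = - C * c" "n^2 + 4 * b * c = t^2 - 4"
  shows "A = C \<and> (B = 0 \<or> B = A)"
proof -
  have g1: "c^2 \<ge> 1" using assms(5) by (simp add: int_one_le_iff_zero_less)
  have AC: "A * (- (b * c)) = C * c^2"
    using arg_cong[OF assms(7), of "\<lambda>t. - t * c"] by (simp add: power2_eq_square mult.assoc)
  moreover have "A * c^2 \<le> C * c^2" using assms(4) by (intro mult_right_mono) auto
  ultimately have "A * c^2 \<le> A * (- (b * c))" by simp
  then have bg: "c^2 \<le> - (b * c)" using assms(1) by (simp only: mult_le_cancel_left_pos)
  have "A * \<bar>n\<bar> = B * \<bar>c\<bar>" using assms(1,2,6) by (metis abs_mult abs_of_nonneg less_imp_le)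
  also have "\<dots> \<le> A * \<bar>c\<bar>" using assms(3) by (intro mult_right_mono) auto
  finally have n: "\<bar>n\<bar> \<le> \<bar>c\<bar>" using assms(1) by (simp only: mult_le_cancel_left_pos)
  then have n2: "n^2 \<le> c^2" by (simp add: abs_le_square_iff)
  have "4 - t^2 = 4 * (- (b * c)) - n^2" using assms(8) by simp
  then have le: "4 * (- (b * c)) - n^2 \<le> 4" using zero_le_power2[of t] by linarith
  then have "c^2 = 1" using g1 bg n2 by linarith
  moreover have "- (b * c) = 1" using le bg n2 calculation by linarith
  ultimately have "A = C" using AC by simp
  have "\<bar>c\<bar> = 1" using \<open>c^2 = 1\<close> by (auto simp: power2_eq_1_iff)
  then have "n = 0 \<or> \<bar>n\<bar> = 1" using n by auto
  moreover have "n = 0 \<Longrightarrow> B = 0" using assms(5,6) by simp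
  moreover have "\<bar>n\<bar> = 1 \<Longrightarrow> B = A" using \<open>A * \<bar>n\<bar> = B * \<bar>c\<bar>\<close> \<open>\<bar>c\<bar> = 1\<close> by simp
  ultimately show ?thesis using \<open>A = C\<close> by blast
qed

lemma stab_trivial:
  assumes "A > 0" "C > 0" "0 \<le> B" "B \<le> A" "B \<le> C" "\<not> (A = C \<and> (B = 0 \<or> B = A))"
  shows "stab (A, B, C) = {(1, 0, 0, 1), (-1, 0, 0, -1)}"
proof
  show "{(1, 0, 0, 1), (-1, 0, 0, -1)} \<subseteq> stab (A, B, C)"
    by (auto simp: stab_def det_mats_def bqf_act_def)
  show "stab (A, B, C) \<subseteq> {(1, 0, 0, 1), (-1, 0, 0, -1)}"
  proof
    fix G assume G: "G \<in> stab (A, B, C)"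
    obtain a b c d where Geq: "G = (a, b, c, d)" by (cases G)
    note lin = stab_linear[OF G[unfolded Geq]]
    have det: "a * d - b * c = 1" using G by (simp add: Geq stab_def det_mats_def)
    have t: "(d - a)^2 + 4 * b * c = (a + d)^2 - 4"
      using det by (simp add: ring_eqs)
    have "c = 0"
    proof (rule ccontr)
      assume g: "c \<noteq> 0"
      then have b: "b \<noteq> 0" using lin(2) assms(1,2) by auto
      show False
      proof (cases "A \<le> C")
        case True
        then show ?thesis
          using reduced_automorph_aux[OF assms(1,3,4) True g lin(1,2) t] assms(6) by simp
      next
        case False
        \<comment> \<open>The inequalities are symmetric in A and C, so the case C < A is the
          previous one with A, c, d - a replaced by C, b, a - d.\<close>
        have "C * (a - d) = B * b" "C * c = - A * b" "(a - d)^2 + 4 * c * b = (a + d)^2 - 4"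
          using lin t by (auto simp: power2_commute algebra_simps)
        then show ?thesis
          using reduced_automorph_aux[OF assms(2,3,5) _ b, of A "a - d" c "a + d"] False assms(6) by simp
      qed
    qed
    moreover from this have "b = 0" "d = a" using lin(1,2) assms(1) by auto
    ultimately have "a * a = 1" using det by simp
    then have "a = 1 \<or> a = -1" using zmult_eq_1_iff by auto
    then show "G \<in> {(1, 0, 0, 1), (-1, 0, 0, -1)}"
      using \<open>c = 0\<close> \<open>b = 0\<close> \<open>d = a\<close> by (auto simp: Geq)
  qed
qed

lemma stab_k0k:
  assumes "k > 0"
  shows "stab (k, 0, k) = {(1, 0, 0, 1), (-1, 0, 0, -1), (0, 1, -1, 0), (0, -1, 1, 0)}" (is "_ = ?X")
proof
  show "?X \<subseteq> stab (k, 0, k)" by (auto simp: stab_def det_mats_def bqf_act_def)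
  show "stab (k, 0, k) \<subseteq> ?X"
  proof
    fix G assume G: "G \<in> stab (k, 0, k)"
    obtain a b c d where Geq: "G = (a, b, c, d)" by (cases G)
    have "k * (d - a) = 0" "k * (b + c) = 0"
      using stab_linear[OF G[unfolded Geq]] by (auto simp: algebra_simps)
    then have lin: "d = a" "b = - c" using assms by auto
    have "a^2 + c^2 = 1"
      using G by (simp add: Geq stab_def det_mats_def lin power2_eq_square)
    then show "G \<in> ?X" using sum_squares_eq_1[of a c] by (auto simp: Geq lin abs_if split: if_splits)
  qed
qed

lemma stab_kkk:
  assumes "k > 0"
  shows "stab (k, k, k) = {(1, 0, 0, 1), (-1, 0, 0, -1), (0, -1, 1, 1), (0, 1, -1, -1),
    (1, 1, -1, 0), (-1, -1, 1, 0)}" (is "_ = ?X")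
proof
  show "?X \<subseteq> stab (k, k, k)" by (auto simp: stab_def det_mats_def bqf_act_def)
  show "stab (k, k, k) \<subseteq> ?X"
  proof
    fix G assume G: "G \<in> stab (k, k, k)"
    obtain a b c d where Geq: "G = (a, b, c, d)" by (cases G)
    have "k * (d - a - c) = 0" "k * (b + c) = 0"
      using stab_linear[OF G[unfolded Geq]] by (auto simp: algebra_simps)
    then have lin: "d = a + c" "b = - c" using assms by auto
    have e: "a^2 + a * c + c^2 = 1"
      using G by (simp add: Geq stab_def det_mats_def lin ring_eqs)
    then have "(2 * a + c)^2 + 3 * c^2 = 4" "(2 * c + a)^2 + 3 * a^2 = 4"
      by (simp_all add: ring_eqs)
    then have "3 * c^2 \<le> 4" "3 * a^2 \<le> 4"
      using zero_le_power2[of "2 * a + c"] zero_le_power2[of "2 * c + a"] by linarith+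
    then have "c^2 \<le> 1" "a^2 \<le> 1" by simp_all
    then have "\<bar>c\<bar> \<le> 1" "\<bar>a\<bar> \<le> 1" by (simp_all add: abs_square_le_1)
    then have "c = -1 \<or> c = 0 \<or> c = 1" "a = -1 \<or> a = 0 \<or> a = 1" by linarith+
    then show "G \<in> ?X" unfolding Geq lin using e by (elim disjE) simp_all
  qed
qed

text \<open>By \<open>class_sum\<close> the total weight is 2 divided by the order of the
  stabilizer, which is 4, 6 or 2 in the three cases of the definition.\<close>

lemma class_sum_weight:
  assumes "C \<in> pd_classes N"
  shows "sum' formw C = class_weight C"
proof -
  obtain f0 where f0: "f0 \<in> C"
    using assms equiv_pd in_quotient_imp_non_empty unfolding pd_classes_def by blast
  have pos: "k > 0" if "(k, l, m) \<in> C" for k l m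
    using pd_class_eq(1)[OF assms that] by (simp add: pd_forms_def)
  consider k where "(k, 0, k) \<in> C"
    | k where "\<not> (\<exists>k. (k, 0, k) \<in> C)" "(k, k, k) \<in> C"
    | "\<not> (\<exists>k. (k, 0, k) \<in> C)" "\<not> (\<exists>k. (k, k, k) \<in> C)" by blast
  then show ?thesis
  proof cases
    case (1 k)
    then have "sum' formw C = 1/2"
      using class_sum[OF assms 1] stab_k0k[OF pos[OF 1]] by simp
    then show ?thesis using 1 by (auto simp: class_weight_def)
  next
    case (2 k)
    then have "sum' formw C = 1/3"
      using class_sum[OF assms 2(2)] stab_kkk[OF pos[OF 2(2)]] by simp
    then show ?thesis using 2 by (auto simp: class_weight_def)
  next
    case 3
    have "sum' formw C \<noteq> 0" using class_sum[OF assms f0] by auto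
    \<comment> \<open>The nonzero total weight itself supplies a reduced representative; no
      reduction algorithm is run.\<close>
    then obtain f where f: "f \<in> C" "formw f \<noteq> 0" using sum.cong'[of C C formw "\<lambda>_. 0"]
      by (auto simp: sum.G_def)
    obtain A B D where feq: "f = (A, B, D)" by (cases f)
    note red = formw_neq_0[OF pd_forms_posdef[OF pd_class_eq(1)[OF assms f(1)], unfolded feq] f(2)[unfolded feq]]
    have "\<not> (A = D \<and> (B = 0 \<or> B = A))" using 3 f(1) by (auto simp: feq)
    then have "sum' formw C = 1"
      using class_sum[OF assms f(1)] stab_trivial[OF red] by (simp add: feq)
    then show ?thesis using 3 by (simp add: class_weight_def)
  qed
qed

lemma hurwitz_H_eq_sum_formw:
  assumes "N > 0" "N mod 4 \<noteq> 1" "N mod 4 \<noteq> 2"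
  shows "hurwitz_H N = sum' formw (pd_forms N)"
proof -
  define r where "r = bqf_equiv \<inter> (pd_forms N \<times> pd_forms N)"
  have eq: "equiv (pd_forms N) r" unfolding r_def by (rule equiv_pd)
  have cl: "pd_classes N = pd_forms N // r" by (simp add: pd_classes_def r_def)
  have fib: "{f \<in> pd_forms N. r `` {f} = C} = C" if C: "C \<in> pd_classes N" for C
  proof -
    have "C \<subseteq> pd_forms N" using C eq in_quotient_imp_subset cl by blast
    moreover have "r `` {f} = C" if "f \<in> C" for f
      using C that eq unfolding cl by (metis quotientE Image_singleton_iff equiv_class_eq)
    moreover have "f \<in> C" if "f \<in> pd_forms N" "r `` {f} = C" for f
      using equiv_class_self[OF eq that(1)] that(2) by simp
    ultimately show ?thesis by blast
  qed
  have "\<exists>f\<in>C. formw f \<noteq> 0" if C: "C \<in> pd_classes N" for C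
  proof (rule ccontr)
    assume "\<not> ?thesis"
    then have "sum' formw C = 0" by (simp add: sum.G_def)
    moreover have "class_weight C \<noteq> 0" by (auto simp: class_weight_def)
    ultimately show False using class_sum_weight[OF C] by simp
  qed
  \<comment> \<open>The sum defining \<open>hurwitz_H\<close> would be 0 over an infinite set of
    classes, so finiteness of the class set has to be derived: every class meets the finite support
    of \<open>formw\<close>.\<close>
  then have "pd_classes N \<subseteq> (\<lambda>f. r `` {f}) ` {f \<in> pd_forms N. formw f \<noteq> 0}"
    using fib by fastforce
  then have fin: "finite (pd_classes N)"
    using finite_formw finite_subset by blast
  have "sum' formw (pd_forms N) = (\<Sum>C\<in>pd_classes N. sum' formw {f \<in> pd_forms N. r `` {f} = C})"
    by (rule sum'_group[OF finite_formw fin]) (auto simp: cl quotientI)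
  also have "\<dots> = (\<Sum>C\<in>pd_classes N. class_weight C)"
    by (intro sum.cong refl) (simp add: fib class_sum_weight)
  finally show ?thesis using assms by (simp add: hurwitz_H_def)
qed

subsection \<open>Matrices of given trace\<close>

type_synonym triple = "int \<times> int \<times> int"

text \<open>A form of discriminant D is recorded by three values instead of its coefficients because
  conjugation by U then permutes A, C, E cyclically; the left side is symmetric in the three
  entries.\<close>

definition triples :: "int \<Rightarrow> triple set" where
  "triples D = {(A, C, E). (A + C - E)^2 - 4 * A * C = D}"

text \<open>\<open>sideT\<close> and \<open>sectorT\<close> are f(M i) and g(M rho) expressed
  through the trace r and the triple of M. In \<open>sectorT\<close> the three arguments are twice
  the values occurring in \<open>sector\<close>, up to a common summand.\<close>

fun sideT :: "int \<Rightarrow> triple \<Rightarrow> real" where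
  "sideT r (A, C, E) = hstep ((A + C - E) * (A + C) - r * (A - C))"

fun sectorT :: "int \<Rightarrow> triple \<Rightarrow> real" where
  "sectorT r (A, C, E) = maxw (E * (A + C + E) + r * (A - C)) (A * (A + C + E) + r * (C - E))
     (C * (A + C + E) + r * (E - A))"

definition coefT :: "int \<Rightarrow> triple \<Rightarrow> real" where
  "coefT r t = sideT r t + sectorT r t - 1"

text \<open>The values at (1, 0), (0, 1), (1, -1) of the form (c, d - a, -b), whose roots are the fixed points
  of M. Conjugation by S and U acts on these triples as \<open>St\<close> and \<open>Rt\<close> below.\<close>

fun triple_of :: "imat \<Rightarrow> triple" where
  "triple_of (a, b, c, d) = (c, - b, c + a - d - b)"

definition trace_mats :: "int \<Rightarrow> int \<Rightarrow> imat set" where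
  "trace_mats p r = {(a, b, c, d). a * d - b * c = p \<and> a + d = r}"

lemma maxw_scale:
  assumes "k > 0" "e' - a' = k * (e - a)" "e' - c' = k * (e - c)"
  shows "maxw e' a' c' = maxw e a c"
proof -
  have *: "(x < y) = (x' < y') \<and> (x = y) = (x' = y')" if "x' - y' = k * (x - y)" for x y x' y' :: int
  proof -
    have "(x - y < 0) = (x' - y' < 0)" "(x - y = 0) = (x' - y' = 0)"
      unfolding that using assms(1) by (auto simp: mult_less_0_iff)
    then show ?thesis by simp
  qed
  show ?thesis using *[OF assms(2)] *[OF assms(3)] by (simp add: maxw_def)
qed

lemma coefw_triple:
  assumes "M \<in> trace_mats p r"
  shows "coefw M = coefT r (triple_of M)"
proof -
  obtain a b c d where M: "M = (a, b, c, d)" by (cases M)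
  have r: "r = a + d" using assms by (simp add: M trace_mats_def)
  have 1: "side (1, 0, 1) M = sideT r (triple_of M)"
    by (simp add: M r ring_eqs)
  have 2: "sector (1, -1, 1) M = sectorT r (triple_of M)"
    unfolding M r sector.simps triple_of.simps sectorT.simps
    by (rule maxw_scale[symmetric, of 2]) (simp_all add: ring_eqs)
  show ?thesis by (simp add: coefw_def coefT_def 1 2)
qed

lemma bij_triple_of: "bij_betw triple_of (trace_mats p r) (triples (r^2 - 4 * p))"
proof (rule bij_betw_byWitness[where f' = "\<lambda>(A, C, E). ((r - (A + C - E)) div 2, - C, A, (r + (A + C - E)) div 2)"])
  show "\<forall>M\<in>trace_mats p r. (\<lambda>(A, C, E). ((r - (A + C - E)) div 2, - C, A, (r + (A + C - E)) div 2)) (triple_of M) = M"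
    by (auto simp: trace_mats_def)
  have even: "even (r - (A + C - E))" "even (r + (A + C - E))" if "(A, C, E) \<in> triples (r^2 - 4 * p)" for A C E
  proof -
    have "(A + C - E)^2 = r^2 + 2 * (2 * A * C - 2 * p)" using that by (simp add: triples_def)
    then have "even ((A + C - E)^2) = even (r^2)" by (metis dvd_triv_left even_add)
    then show "even (r - (A + C - E))" "even (r + (A + C - E))" by simp_all
  qed
  show "\<forall>t\<in>triples (r^2 - 4 * p). triple_of ((\<lambda>(A, C, E). ((r - (A + C - E)) div 2, - C, A, (r + (A + C - E)) div 2)) t) = t"
  proof clarify
    fix A C E assume t: "(A, C, E) \<in> triples (r^2 - 4 * p)"
    obtain x y where "r - (A + C - E) = 2 * x" "r + (A + C - E) = 2 * y"
      using evenE[OF even(1)[OF t]] evenE[OF even(2)[OF t]] by metis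
    then show "triple_of ((r - (A + C - E)) div 2, - C, A, (r + (A + C - E)) div 2) = (A, C, E)" by simp
  qed
  show "triple_of ` trace_mats p r \<subseteq> triples (r^2 - 4 * p)"
  proof
    fix t assume "t \<in> triple_of ` trace_mats p r"
    then obtain a b c d where t: "t = triple_of (a, b, c, d)"
      and pr: "p = a * d - b * c" "r = a + d" by (auto simp: trace_mats_def)
    show "t \<in> triples (r^2 - 4 * p)"
      unfolding t pr by (simp add: triples_def ring_eqs)
  qed
  show "(\<lambda>(A, C, E). ((r - (A + C - E)) div 2, - C, A, (r + (A + C - E)) div 2)) ` triples (r^2 - 4 * p) \<subseteq> trace_mats p r"
  proof clarify
    fix A C E assume t: "(A, C, E) \<in> triples (r^2 - 4 * p)"
    obtain x y where xy: "r - (A + C - E) = 2 * x" "r + (A + C - E) = 2 * y"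
      using evenE[OF even(1)[OF t]] evenE[OF even(2)[OF t]] by metis
    then have "r = x + y" "A + C - E = y - x" by auto
    then have "(y - x)^2 - 4 * A * C = (x + y)^2 - 4 * p"
      using t by (simp add: triples_def)
    then have "4 * (x * y + C * A) = 4 * p"
      by (simp add: ring_eqs)
    then show "((r - (A + C - E)) div 2, - C, A, (r + (A + C - E)) div 2) \<in> trace_mats p r"
      using xy by (simp add: trace_mats_def)
  qed
qed

lemma sum_coefw_trace:
  "sum' coefw (trace_mats p r) = sum' (coefT r) (triples (r^2 - 4 * p))"
proof -
  have "sum' coefw (trace_mats p r) = sum' (\<lambda>M. coefT r (triple_of M)) (trace_mats p r)"
    by (rule sum.cong') (auto simp: coefw_triple simp del: triple_of.simps)
  then show ?thesis using sum'_reindex[OF bij_triple_of] by simp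
qed

lemma finite_coefT:
  assumes "p \<noteq> 0"
  shows "finite {t \<in> triples (r^2 - 4 * p). coefT r t \<noteq> 0}"
proof -
  have "{M \<in> trace_mats p r. coefT r (triple_of M) \<noteq> 0} \<subseteq> {M \<in> det_mats p. coefw M \<noteq> 0}"
    using coefw_triple by (auto simp: trace_mats_def det_mats_def simp del: triple_of.simps)
  then have "finite {M \<in> trace_mats p r. coefT r (triple_of M) \<noteq> 0}"
    using finite_coefw[OF assms] finite_subset by blast
  then show ?thesis using finite_supp_bij[OF bij_triple_of] by blast
qed

text \<open>The values of f and g at the fixed point in the upper half plane if M is elliptic, and the means
  over the two real fixed points if M is hyperbolic. When a fixed point is 0, -1 or infinity, that is when
  A, C or E vanishes, the values are chosen such that they agree with those at M i and M rho for almost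
  all M.\<close>

fun sideS :: "int \<Rightarrow> triple \<Rightarrow> real" where
  "sideS r (A, C, E) = (if A * C > 0 then hstep (sgn A * (A + C - E))
     else if A * C < 0 then 1/2 else sideT r (A, C, E))"

fun sectorS :: "triple \<Rightarrow> real" where
  "sectorS (A, C, E) =
     (if A \<noteq> 0 \<and> C \<noteq> 0 \<and> E \<noteq> 0 then
        (if A * C > 0 then if A * E > 0 then maxw \<bar>E\<bar> \<bar>A\<bar> \<bar>C\<bar> else 0 else 1/2)
      else if E = 0 then 0
      else if A = 0 \<and> C = 0 then 1
      else if A = 0 then hstep (- (C + E)) else hstep (A + E))"

definition coefS :: "int \<Rightarrow> triple \<Rightarrow> real" where
  "coefS r t = sideS r t + sectorS t - 1"

fun St :: "triple \<Rightarrow> triple" where "St (A, C, E) = (C, A, 2 * A + 2 * C - E)"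
fun Rt :: "triple \<Rightarrow> triple" where "Rt (A, C, E) = (C, E, A)"
fun Nt :: "triple \<Rightarrow> triple" where "Nt (A, C, E) = (- A, - C, - E)"

section \<open>From M i and M rho to the fixed points of M\<close>

lemma bij_St: "bij_betw St (triples D) (triples D)"
proof (rule bij_betw_byWitness[where f' = St])
  have "St t \<in> triples D" if "t \<in> triples D" for t
  proof (cases t)
    case (fields A C E)
    have "(C + A - (2 * A + 2 * C - E))^2 - 4 * C * A = (A + C - E)^2 - 4 * A * C"
      by (simp add: ring_eqs)
    then show ?thesis
      using that unfolding fields triples_def St.simps mem_Collect_eq prod.case by (simp only:)
  qed
  then have "St ` triples D \<subseteq> triples D" by blast
  then show "St ` triples D \<subseteq> triples D" "St ` triples D \<subseteq> triples D" by blast+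
qed auto

lemma bij_Rt: "bij_betw Rt (triples D) (triples D)"
  by (rule bij_betw_byWitness[where f' = "\<lambda>t. Rt (Rt t)"])
     (auto simp: triples_def ring_eqs)

lemma bij_Nt: "bij_betw Nt (triples D) (triples D)"
  by (rule bij_betw_byWitness[where f' = Nt]) (auto simp: triples_def ring_eqs)

lemma finite_box: "finite {(A, C, E). \<bar>A\<bar> \<le> (L::int) \<and> \<bar>C\<bar> \<le> L \<and> \<bar>E\<bar> \<le> L}"
proof -
  have "{(A, C, E). \<bar>A\<bar> \<le> L \<and> \<bar>C\<bar> \<le> L \<and> \<bar>E\<bar> \<le> L} \<subseteq> {-L..L} \<times> {-L..L} \<times> {-L..L}" by auto
  then show ?thesis by (rule finite_subset) simp
qed

lemma sideT_St: "sideT r (St t) = 1 - sideT r t"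
proof (cases t)
  case (fields A C E)
  have "(C + A - (2 * A + 2 * C - E)) * (C + A) - r * (C - A) = - ((A + C - E) * (A + C) - r * (A - C))"
    by (simp add: algebra_simps)
  then show ?thesis using hstep_uminus by (simp only: fields St.simps sideT.simps)
qed

lemma sideS_St: "sideS r (St t) = 1 - sideS r t"
proof (cases t)
  case (fields A C E)
  have 1: "hstep (sgn C * (C + A - (2 * A + 2 * C - E))) = 1 - hstep (sgn A * (A + C - E))" if "A * C > 0"
  proof -
    have "sgn C * (C + A - (2 * A + 2 * C - E)) = - (sgn A * (A + C - E))"
      using that by (auto simp: sgn_if zero_less_mult_iff)
    then show ?thesis using hstep_uminus by metis
  qed
  show ?thesis using sideT_St[of r t] 1 by (simp add: fields mult.commute del: sideT.simps)
qed

lemma abs_le_mult: "x \<noteq> 0 \<Longrightarrow> \<bar>y\<bar> \<le> \<bar>x * y\<bar>" for x y :: int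
  using mult_right_mono[of 1 "\<bar>x\<bar>" "\<bar>y\<bar>"] by (simp add: abs_mult)

lemma abs_le_square: "\<bar>x\<bar> \<le> x^2" for x :: int
  using abs_le_mult[of x x] by (cases "x = 0") (simp_all add: power2_eq_square)

lemma box_of_neg:
  assumes "(B::int)^2 - 4 * A * C = D" "A * C < 0"
  shows "\<bar>A\<bar> \<le> \<bar>D\<bar> \<and> \<bar>C\<bar> \<le> \<bar>D\<bar> \<and> \<bar>B\<bar> \<le> \<bar>D\<bar>"
proof -
  have "A \<noteq> 0" "C \<noteq> 0" using assms(2) by auto
  then have "\<bar>C\<bar> \<le> \<bar>A * C\<bar>" "\<bar>A\<bar> \<le> \<bar>C * A\<bar>" by (blast intro: abs_le_mult)+
  moreover have "\<bar>A * C\<bar> = - (A * C)" "\<bar>C * A\<bar> = - (A * C)" using assms(2) by (simp_all add: mult.commute)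
  moreover have "B^2 + 4 * (- (A * C)) = D" using assms(1) by simp
  ultimately show ?thesis using abs_le_square[of B] assms(2) zero_le_power2[of B] by linarith
qed

text \<open>Let B = A + C - E. If A C > 0, then |A - C| < |A + C|, so for |B| > |r| the term r (A -
  C) cannot change the sign of B (A + C). A discrepancy therefore forces |B| <= |r|, and 4 A C = B^2
  - D is bounded. If A C < 0, then D = B^2 + 4 |A C| bounds everything.\<close>

lemma finite_side_T_S: "finite {t \<in> triples D. sideT r t - sideS r t \<noteq> 0}"
proof -
  define L where "L = 3 * (\<bar>r\<bar> + r^2 + \<bar>D\<bar>)"
  have "{t \<in> triples D. sideT r t - sideS r t \<noteq> 0} \<subseteq> {(A, C, E). \<bar>A\<bar> \<le> L \<and> \<bar>C\<bar> \<le> L \<and> \<bar>E\<bar> \<le> L}"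
  proof clarify
    fix A C E assume t: "(A, C, E) \<in> triples D" and ne: "sideT r (A, C, E) - sideS r (A, C, E) \<noteq> 0"
    define B where "B = A + C - E"
    have D: "B^2 - 4 * A * C = D" using t by (simp add: triples_def B_def)
    have "\<bar>A\<bar> \<le> r^2 + \<bar>D\<bar> \<and> \<bar>C\<bar> \<le> r^2 + \<bar>D\<bar> \<and> \<bar>B\<bar> \<le> \<bar>r\<bar> + \<bar>D\<bar>"
    proof (cases "A * C > 0")
      case False
      then have "A * C < 0" using ne by (auto simp: not_less split: if_splits)
      then show ?thesis using box_of_neg[OF D] zero_le_power2[of r] by linarith
    next
      case True
      then have ne': "hstep (B * (A + C) - r * (A - C)) \<noteq> hstep (sgn A * B)"
        using ne by (simp add: B_def)
      define s where "s = sgn A"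
      have s: "s = 1 \<or> s = -1" "\<bar>A + C\<bar> = s * (A + C)" "\<bar>A - C\<bar> < \<bar>A + C\<bar>"
        using True by (auto simp: s_def sgn_if zero_less_mult_iff)
      have "\<bar>B\<bar> \<le> \<bar>r\<bar>"
      proof (rule ccontr)
        assume "\<not> ?thesis"
        then have B: "\<bar>r\<bar> < \<bar>B\<bar>" by simp
        have "\<bar>r * (A - C)\<bar> \<le> \<bar>r\<bar> * \<bar>A + C\<bar>" using s(3) by (simp add: abs_mult mult_left_mono)
        also have "\<dots> < \<bar>B\<bar> * \<bar>A + C\<bar>" using B s(3) by (intro mult_strict_right_mono) auto
        finally have lt: "\<bar>r * (A - C)\<bar> < \<bar>B * (A + C)\<bar>" by (simp add: abs_mult)
        define m where "m = \<bar>A + C\<bar>"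
        have m: "m > 0" using s(3) by (simp add: m_def)
        have "B * (A + C) = (s * B) * m" using s(1,2) by (auto simp: m_def)
        then have "(B * (A + C) > 0) = (s * B > 0)" "(B * (A + C) < 0) = (s * B < 0)"
          using m by (metis zero_less_mult_pos2 mult_pos_pos, metis linorder_not_less mult_neg_pos mult_nonneg_nonneg less_imp_le)
        then have "hstep (B * (A + C) - r * (A - C)) = hstep (s * B)"
          using lt B s(1) by (auto simp: hstep_def abs_if split: if_splits)
        then show False using ne' by (simp add: s_def)
      qed
      then have "B^2 \<le> r^2" by (simp add: abs_le_square_iff)
      then have "4 * (A * C) \<le> r^2 + \<bar>D\<bar>" using D by linarith
      moreover have "A \<noteq> 0" "C \<noteq> 0" using True by auto
      then have "\<bar>C\<bar> \<le> \<bar>A * C\<bar>" "\<bar>A\<bar> \<le> \<bar>C * A\<bar>" by (blast intro: abs_le_mult)+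
      moreover have "\<bar>A * C\<bar> = A * C" "\<bar>C * A\<bar> = A * C" using True by (simp_all add: mult.commute)
      ultimately show ?thesis using True \<open>\<bar>B\<bar> \<le> \<bar>r\<bar>\<close> by linarith
    qed
    moreover have "\<bar>E\<bar> \<le> \<bar>A\<bar> + \<bar>C\<bar> + \<bar>B\<bar>" by (simp add: B_def)
    moreover have "a \<le> 3 * (k + x + d)" "c \<le> 3 * (k + x + d)" "e \<le> 3 * (k + x + d)"
      if "a \<le> x + d" "c \<le> x + d" "b \<le> k + d" "e \<le> a + c + b" "0 \<le> x" "0 \<le> d" "0 \<le> k"
      for a b c d e k x :: int using that by simp_all
    ultimately show "\<bar>A\<bar> \<le> L \<and> \<bar>C\<bar> \<le> L \<and> \<bar>E\<bar> \<le> L"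
      unfolding L_def by (meson abs_ge_zero zero_le_power2)
  qed
  then show ?thesis using finite_box finite_subset by blast
qed

lemma sum_side_T_S: "sum' (\<lambda>t. sideT r t - sideS r t) (triples D) = 0"
  by (rule sum'_antisym[OF bij_St finite_side_T_S]) (simp add: sideT_St sideS_St del: sideT.simps sideS.simps)

lemma sectorT_Rt: "sectorT r t + sectorT r (Rt t) + sectorT r (Rt (Rt t)) = 1"
proof (cases t)
  case (fields A C E)
  show ?thesis
    using maxw_rot[of "E * (A + C + E) + r * (A - C)" "A * (A + C + E) + r * (C - E)" "C * (A + C + E) + r * (E - A)"]
    by (simp add: fields add_ac)
qed

lemma sectorS_Rt:
  assumes "t \<in> triples D" "D \<noteq> 0"
  shows "sectorS t + sectorS (Rt t) + sectorS (Rt (Rt t)) = 1"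
proof (cases t)
  case (fields A C E)
  have nz: "A \<noteq> 0 \<or> C \<noteq> 0 \<or> E \<noteq> 0" using assms by (auto simp: fields triples_def)
  show ?thesis
  proof (cases "A \<noteq> 0 \<and> C \<noteq> 0 \<and> E \<noteq> 0")
    case True
    then have "A < 0 \<or> A > 0" "C < 0 \<or> C > 0" "E < 0 \<or> E > 0" by auto
    then show ?thesis
      using maxw_rot[of "\<bar>E\<bar>" "\<bar>A\<bar>" "\<bar>C\<bar>"]
      by (elim disjE) (simp_all add: fields zero_less_mult_iff)
  next
    case False
    have "hstep (- x - y) = 1 - hstep (x + y)" for x y
      using hstep_uminus[of "x + y"] by simp
    then show ?thesis using False nz
      by (cases "A = 0"; cases "C = 0"; cases "E = 0") (simp_all add: fields add.commute)
  qed
qed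

text \<open>X is maximal among the entries although the perturbed comparison does not put it above
  Y. As the perturbation s is at most 2 |r| (X + Y + Z), this gives X - Y <= 2 |r|. Then X <= (2 (X
  + Y) - Z) Z = (X - Y)^2 - D is bounded.\<close>

lemma sector_pos_bound:
  fixes X Y Z r s D :: int
  assumes pos: "X > 0" "Y > 0" "Z > 0" and "Y \<le> X" "Z \<le> X"
    and le: "(X - Y) * (X + Y + Z) + s \<le> 0" and s: "\<bar>s\<bar> \<le> 2 * \<bar>r\<bar> * (X + Y + Z)"
    and D: "X^2 + Y^2 + Z^2 - 2 * X * Y - 2 * X * Z - 2 * Y * Z = D"
  shows "X \<le> 4 * r^2 + \<bar>D\<bar>"
proof -
  have "(X - Y) * (X + Y + Z) \<le> 2 * \<bar>r\<bar> * (X + Y + Z)" using le s by linarith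
  then have "X - Y \<le> 2 * \<bar>r\<bar>" using pos by (simp add: mult_le_cancel_right)
  then have "(X - Y)^2 \<le> (2 * \<bar>r\<bar>)^2" using assms(4) by (intro power_mono) auto
  then have sq: "(X - Y)^2 \<le> 4 * r^2" by (simp add: power_mult_distrib)
  have "X * 1 \<le> (2 * (X + Y) - Z) * Z" using pos assms(5) by (intro mult_mono) auto
  also have "\<dots> = (X - Y)^2 - D" unfolding D[symmetric] by (simp add: ring_eqs)
  finally show ?thesis using sq by linarith
qed

lemma sector_pos_box:
  assumes pos: "A > 0" "C > 0" "E > 0" and t: "(A, C, E) \<in> triples D"
    and ne: "sectorT r (A, C, E) \<noteq> maxw E A C"
  shows "A \<le> 4 * r^2 + \<bar>D\<bar> \<and> C \<le> 4 * r^2 + \<bar>D\<bar> \<and> E \<le> 4 * r^2 + \<bar>D\<bar>"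
proof -
  define N1 N2 N3 where "N1 = E * (A + C + E) + r * (A - C)" "N2 = A * (A + C + E) + r * (C - E)"
    "N3 = C * (A + C + E) + r * (E - A)"
  have D: "A^2 + C^2 + E^2 - 2 * A * C - 2 * A * E - 2 * C * E = D"
    using t by (simp add: triples_def ring_eqs)
  have s: "\<bar>r * (2 * Z - X - Y)\<bar> \<le> 2 * \<bar>r\<bar> * (X + Y + Z)" "\<bar>- (r * (2 * Z - X - Y))\<bar> \<le> 2 * \<bar>r\<bar> * (X + Y + Z)"
    if "X > 0" "Y > 0" "Z > 0" for X Y Z :: int
  proof -
    have "\<bar>2 * Z - X - Y\<bar> \<le> 2 * (X + Y + Z)" using that by auto
    then have "\<bar>r\<bar> * \<bar>2 * Z - X - Y\<bar> \<le> \<bar>r\<bar> * (2 * (X + Y + Z))" by (rule mult_left_mono) simp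
    then show "\<bar>r * (2 * Z - X - Y)\<bar> \<le> 2 * \<bar>r\<bar> * (X + Y + Z)" "\<bar>- (r * (2 * Z - X - Y))\<bar> \<le> 2 * \<bar>r\<bar> * (X + Y + Z)"
      by (simp_all add: abs_mult mult_ac)
  qed
  have "maxw E A C \<noteq> maxw N1 N2 N3" using ne by (simp add: N1_N2_N3_def)
  note c = maxw_neq_cases[OF this]
  let ?L = "4 * r^2 + \<bar>D\<bar>"
  have AC: "C \<le> A \<Longrightarrow> E \<le> A \<Longrightarrow> N2 \<le> N3 \<Longrightarrow> A \<le> ?L"
    by (rule sector_pos_bound[OF pos(1,2,3) _ _ _ s(2)[OF pos(1,2,3)]])
       (use D in \<open>auto simp: N1_N2_N3_def algebra_simps\<close>)
  have CA: "A \<le> C \<Longrightarrow> E \<le> C \<Longrightarrow> N3 \<le> N2 \<Longrightarrow> C \<le> ?L"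
    by (rule sector_pos_bound[OF pos(2,1,3) _ _ _ s(1)[OF pos(2,1,3)]])
       (use D in \<open>auto simp: N1_N2_N3_def algebra_simps\<close>)
  have AE: "E \<le> A \<Longrightarrow> C \<le> A \<Longrightarrow> N2 \<le> N1 \<Longrightarrow> A \<le> ?L"
    by (rule sector_pos_bound[OF pos(1,3,2) _ _ _ s(1)[OF pos(1,3,2)]])
       (use D in \<open>auto simp: N1_N2_N3_def algebra_simps\<close>)
  have EA: "A \<le> E \<Longrightarrow> C \<le> E \<Longrightarrow> N1 \<le> N2 \<Longrightarrow> E \<le> ?L"
    by (rule sector_pos_bound[OF pos(3,1,2) _ _ _ s(2)[OF pos(3,1,2)]])
       (use D in \<open>auto simp: N1_N2_N3_def algebra_simps\<close>)
  have EC: "C \<le> E \<Longrightarrow> A \<le> E \<Longrightarrow> N1 \<le> N3 \<Longrightarrow> E \<le> ?L"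
    by (rule sector_pos_bound[OF pos(3,2,1) _ _ _ s(1)[OF pos(3,2,1)]])
       (use D in \<open>auto simp: N1_N2_N3_def algebra_simps\<close>)
  have CE: "E \<le> C \<Longrightarrow> A \<le> C \<Longrightarrow> N3 \<le> N1 \<Longrightarrow> C \<le> ?L"
    by (rule sector_pos_bound[OF pos(2,3,1) _ _ _ s(2)[OF pos(2,3,1)]])
       (use D in \<open>auto simp: N1_N2_N3_def algebra_simps\<close>)
  show ?thesis using c AC CA AE EA EC CE by (elim disjE) (auto intro: order_trans)
qed

lemma sectorT_Nt: "sectorT r (Nt t) = sectorT (- r) t"
proof (cases t)
  case (fields A C E)
  have "- E * (- A + - C + - E) + r * (- A - - C) = E * (A + C + E) + - r * (A - C)"
    "- A * (- A + - C + - E) + r * (- C - - E) = A * (A + C + E) + - r * (C - E)"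
    "- C * (- A + - C + - E) + r * (- E - - A) = C * (A + C + E) + - r * (E - A)"
    by (simp_all add: algebra_simps)
  then show ?thesis by (simp only: fields Nt.simps sectorT.simps)
qed

text \<open>The discriminant is symmetric in A, C, E, so the bound for two entries of opposite sign
  applies to every pair.\<close>

lemma box_of_neg_triple:
  assumes "(A, C, E) \<in> triples D" "A * C < 0 \<or> A * E < 0 \<or> C * E < 0"
  shows "\<bar>A\<bar> \<le> 3 * \<bar>D\<bar> \<and> \<bar>C\<bar> \<le> 3 * \<bar>D\<bar> \<and> \<bar>E\<bar> \<le> 3 * \<bar>D\<bar>"
proof -
  have *: "\<bar>x\<bar> \<le> 3 * \<bar>D\<bar> \<and> \<bar>y\<bar> \<le> 3 * \<bar>D\<bar> \<and> \<bar>z\<bar> \<le> 3 * \<bar>D\<bar>"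
    if "(x + y - z)^2 - 4 * x * y = D" "x * y < 0" for x y z
  proof -
    have "\<bar>z\<bar> \<le> \<bar>x\<bar> + \<bar>y\<bar> + \<bar>x + y - z\<bar>" by simp
    then show ?thesis using box_of_neg[OF that] by (intro conjI; linarith)
  qed
  have D: "(A + C - E)^2 - 4 * A * C = D" "(A + E - C)^2 - 4 * A * E = D" "(C + E - A)^2 - 4 * C * E = D"
    using assms(1) by (auto simp: triples_def ring_eqs)
  then show ?thesis using assms(2) *[OF D(1)] *[OF D(2)] *[OF D(3)] by blast
qed

lemma abs_diff_less:
  fixes x y r :: int
  assumes "(x - y)^2 < r^2" "r > 0"
  shows "\<bar>x - y\<bar> < r"
  using assms by (metis abs_of_pos power2_less_imp_less abs_ge_zero power2_abs less_imp_le)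

text \<open>If one entry vanishes, D is the square of the difference of the other two, which can go
  to infinity together. The bound 5 r makes C and E equal in sign with |E| > 4 r; the comparison is
  then decided by the sign of (E - C - r) (C + E), where r > 0 enters through E - C < r.\<close>

lemma sector_zero:
  assumes "(C - E)^2 < r^2" "r > 0" "\<bar>C\<bar> > 5 * r"
  shows "sectorT r (0, C, E) = hstep (- (C + E))" "sectorT r (C, E, 0) = 0"
    "sectorT r (E, 0, C) = hstep (C + E)"
proof -
  define N1 N2 N3 where "N1 = E * (C + E) - r * C" "N2 = r * (C - E)" "N3 = C * (C + E) + r * E"
  note N = N1_N2_N3_def
  have lt: "\<bar>C - E\<bar> < r" using abs_diff_less[OF assms(1,2)] .
  have "maxw N1 N2 N3 = hstep (- (C + E)) \<and> maxw N2 N3 N1 = 0"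
  proof (cases "C > 0")
    case True
    then have E: "E > 4 * r" "C > 5 * r" "E - C - r < 0" using lt assms by auto
    then have pos: "C > 0" "E > 0" using assms(2) by auto
    have "(E - C - r) * (C + E) < 0" using E pos by (intro mult_neg_pos) auto
    then have "N1 < N3" by (simp add: N algebra_simps)
    moreover have "0 < (C - r) * C" "0 < C * E" "0 < r * E" using E pos assms(2) by auto
    then have "N2 < N3" by (simp add: N algebra_simps)
    ultimately show ?thesis using pos by (simp add: maxw_def hstep_def)
  next
    case False
    define x y where "x = - C" "y = - E"
    have E: "y > 4 * r" "x > 5 * r" "- (E - C - r) > 0" using lt assms False by (auto simp: x_y_def)
    then have pos: "x > 0" "y > 0" using assms(2) by auto
    have "0 < - (E - C - r) * (x + y)" using E pos by (intro mult_pos_pos) auto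
    then have "N3 < N1" by (simp add: N x_y_def algebra_simps)
    moreover have "0 < (y - r) * y" "0 < y * x" "0 < r * x" using E pos assms(2) by auto
    then have "N2 < N1" by (simp add: N x_y_def algebra_simps)
    ultimately show ?thesis using pos by (simp add: maxw_def hstep_def x_y_def)
  qed
  then show "sectorT r (0, C, E) = hstep (- (C + E))" "sectorT r (C, E, 0) = 0"
    by (simp_all add: N algebra_simps)
  then show "sectorT r (E, 0, C) = hstep (C + E)"
    using sectorT_Rt[of r "(0, C, E)"] hstep_uminus[of "C + E"] by (simp del: sectorT.simps)
qed

text \<open>Triples with a zero entry come in infinite families, on which \<open>sectorS\<close>
  holds the limit values for positive trace; negative traces are later reduced to positive ones by M
  -> - M. For D = r^2 - 4 p the condition D < r^2 says p > 0.\<close>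

lemma finite_sector_T_S:
  assumes "\<And>A C E. (A, C, E) \<in> triples D \<Longrightarrow> A = 0 \<or> C = 0 \<or> E = 0 \<Longrightarrow> r > 0 \<and> D < r^2"
    and "D \<noteq> 0"
  shows "finite {t \<in> triples D. sectorT r t - sectorS t \<noteq> 0}"
proof -
  define L where "L = 4 * r^2 + 3 * \<bar>D\<bar> + 6 * \<bar>r\<bar>"
  have L: "4 * r^2 + \<bar>D\<bar> \<le> L" "3 * \<bar>D\<bar> \<le> L" "5 * \<bar>r\<bar> \<le> L" "6 * \<bar>r\<bar> \<le> L" by (auto simp: L_def)
  have "\<bar>A\<bar> \<le> L \<and> \<bar>C\<bar> \<le> L \<and> \<bar>E\<bar> \<le> L"
    if t: "(A, C, E) \<in> triples D" and ne: "sectorT r (A, C, E) \<noteq> sectorS (A, C, E)" for A C E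
  proof (cases "A \<noteq> 0 \<and> C \<noteq> 0 \<and> E \<noteq> 0")
    case True
    then consider "A * C < 0 \<or> A * E < 0 \<or> C * E < 0" | "A > 0" "C > 0" "E > 0" | "A < 0" "C < 0" "E < 0"
      by (metis linorder_neqE_linordered_idom mult_neg_pos mult_pos_neg)
    then show ?thesis
    proof cases
      case 1
      then show ?thesis using box_of_neg_triple[OF t 1] L(2) by (meson order_trans)
    next
      case 2
      then have "sectorT r (A, C, E) \<noteq> maxw E A C" using ne by (simp add: zero_less_mult_iff del: sectorT.simps)
      from sector_pos_box[OF 2 t this] show ?thesis using 2 L(1) by auto
    next
      case 3
      have t': "(- A, - C, - E) \<in> triples D" using t bij_betwE[OF bij_Nt] by fastforce
      have "sectorT (- r) (- A, - C, - E) \<noteq> maxw (- E) (- A) (- C)"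
        using ne 3 sectorT_Nt[of "- r" "(A, C, E)"] by (simp add: zero_less_mult_iff del: sectorT.simps)
      from sector_pos_box[OF _ _ _ t' this] show ?thesis using 3 L(1) by auto
    qed
  next
    case False
    then have r: "r > 0" "D < r^2" using assms(1)[OF t] by auto
    consider "E = 0" | "E \<noteq> 0" "A = 0" | "E \<noteq> 0" "A \<noteq> 0" "C = 0" using False by blast
    then show ?thesis
    proof cases
      case 1
      then have lt: "(A - C)^2 < r^2" using t r(2) by (simp add: triples_def ring_eqs)
      have "\<not> \<bar>A\<bar> > 5 * r" using sector_zero(2)[OF lt r(1)] ne 1 by (auto simp del: sectorT.simps)
      then show ?thesis using abs_diff_less[OF lt r(1)] r(1) L 1 by auto
    next
      case 2
      then have lt: "(C - E)^2 < r^2" using t r(2) by (simp add: triples_def ring_eqs)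
      have "\<not> \<bar>C\<bar> > 5 * r" using sector_zero(1)[OF lt r(1)] ne 2 r(1)
        by (cases "C = 0") (auto simp del: sectorT.simps)
      then show ?thesis using abs_diff_less[OF lt r(1)] r(1) L 2 by auto
    next
      case 3
      then have lt: "(E - A)^2 < r^2" using t r(2) by (simp add: triples_def ring_eqs)
      have "\<not> \<bar>E\<bar> > 5 * r" using sector_zero(3)[OF lt r(1)] ne 3 add.commute[of E A]
        by (auto simp del: sectorT.simps)
      then show ?thesis using abs_diff_less[OF lt r(1)] r(1) L 3 by auto
    qed
  qed
  then have "{t \<in> triples D. sectorT r t - sectorS t \<noteq> 0} \<subseteq> {(A, C, E). \<bar>A\<bar> \<le> L \<and> \<bar>C\<bar> \<le> L \<and> \<bar>E\<bar> \<le> L}"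
    by (auto simp del: sectorT.simps sectorS.simps)
  then show ?thesis using finite_box finite_subset by blast
qed

lemma sum_coefT_eq:
  assumes "\<And>A C E. (A, C, E) \<in> triples D \<Longrightarrow> A = 0 \<or> C = 0 \<or> E = 0 \<Longrightarrow> r > 0 \<and> D < r^2"
    and "D \<noteq> 0" "D = r^2 - 4 * p" "p \<noteq> 0"
  shows "sum' (coefT r) (triples D) = sum' (coefS r) (triples D)"
    and "finite {t \<in> triples D. coefS r t \<noteq> 0}"
proof -
  note finA = finite_side_T_S[of D r] and finB = finite_sector_T_S[OF assms(1,2)]
  have finC: "finite {t \<in> triples D. coefT r t \<noteq> 0}" using finite_coefT[OF assms(4)] assms(3) by simp
  have B0: "sum' (\<lambda>t. sectorT r t - sectorS t) (triples D) = 0"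
  proof (rule sum'_antirot[OF bij_Rt finB])
    fix t assume "t \<in> triples D"
    then show "sectorT r t - sectorS t + (sectorT r (Rt t) - sectorS (Rt t))
        + (sectorT r (Rt (Rt t)) - sectorS (Rt (Rt t))) = 0"
      using sectorT_Rt[of r t] sectorS_Rt[OF _ assms(2), of t] by linarith
  qed
  have "{t \<in> triples D. coefS r t \<noteq> 0} \<subseteq> {t \<in> triples D. coefT r t \<noteq> 0}
    \<union> ({t \<in> triples D. sideT r t - sideS r t \<noteq> 0} \<union> {t \<in> triples D. sectorT r t - sectorS t \<noteq> 0})"
    by (auto simp: coefT_def coefS_def)
  then show finD: "finite {t \<in> triples D. coefS r t \<noteq> 0}"
    by (rule finite_subset) (intro finite_UnI finA finB finC)
  have finAB: "finite {t \<in> triples D. (sideT r t - sideS r t) + (sectorT r t - sectorS t) \<noteq> 0}"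
    by (rule finite_subset[OF _ finite_UnI[OF finA finB]]) auto
  have "sum' (coefT r) (triples D)
      = sum' (\<lambda>t. coefS r t + ((sideT r t - sideS r t) + (sectorT r t - sectorS t))) (triples D)"
    by (rule sum.cong') (auto simp: coefT_def coefS_def)
  also have "\<dots> = sum' (coefS r) (triples D)
      + sum' (\<lambda>t. (sideT r t - sideS r t) + (sectorT r t - sectorS t)) (triples D)"
    by (rule sum.distrib'[OF finD finAB])
  also have "sum' (\<lambda>t. (sideT r t - sideS r t) + (sectorT r t - sectorS t)) (triples D) = 0"
    using sum.distrib'[OF finA finB] sum_side_T_S[of r D] B0 by simp
  finally show "sum' (coefT r) (triples D) = sum' (coefS r) (triples D)" by simp
qed

section \<open>Elliptic traces\<close>

lemma coefS_Nt:
  assumes "A \<noteq> 0" "C \<noteq> 0" "E \<noteq> 0"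
  shows "coefS r (- A, - C, - E) = coefS r (A, C, E)"
proof -
  have "sgn (- A) * (- A + - C - - E) = sgn A * (A + C - E)" by (simp add: sgn_if)
  then show ?thesis using assms by (simp add: coefS_def)
qed

lemma coefS_pos:
  assumes "A > 0" "C > 0" "E > 0"
  shows "coefS r (A, C, E) = formw (A, A + C - E, C)"
  using assms by (simp add: coefS_def zero_less_mult_iff)

lemma triple_nonzero_elliptic:
  assumes "(A, C, E) \<in> triples D" "D < 0"
  shows "A * C > 0" "A * E > 0"
proof -
  have "(A + C - E)^2 - 4 * (A * C) = D" "(A + E - C)^2 - 4 * (A * E) = D"
    using assms(1) by (auto simp: triples_def ring_eqs)
  then show "A * C > 0" "A * E > 0"
    using assms(2) zero_le_power2[of "A + C - E"] zero_le_power2[of "A + E - C"] by linarith+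
qed

text \<open>Triples with A > 0 are the positive definite forms of discriminant r^2 - 4 p, weighted
  by \<open>formw\<close>. Negating a triple replaces M by its adjugate, which has the same trace
  and fixed points; this accounts for the factor 2.\<close>

lemma sum_coefw_elliptic:
  assumes p: "p \<noteq> 0" and r: "r^2 < 4 * p"
  shows "sum' coefw (trace_mats p r) = 2 * hurwitz_H (4 * p - r^2)"
proof -
  define D where "D = r^2 - 4 * p"
  have D: "D < 0" using r by (simp add: D_def)
  have nz: "A \<noteq> 0 \<and> C \<noteq> 0 \<and> E \<noteq> 0" if "(A, C, E) \<in> triples D" for A C E
    using triple_nonzero_elliptic[OF that D] by auto
  have nz': "r > 0 \<and> D < r^2" if "(A, C, E) \<in> triples D" "A = 0 \<or> C = 0 \<or> E = 0" for A C E
    using nz[OF that(1)] that(2) by blast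
  have D0: "D \<noteq> 0" using D by simp
  note S = sum_coefT_eq[OF nz' D0 D_def p]
  define P where "P = {t \<in> triples D. fst t > 0}"
  have "sum' (coefS r) (triples D) = (\<Sum>b\<in>{True, False}. sum' (coefS r) {t \<in> triples D. (fst t > 0) = b})"
    by (rule sum'_group[OF S(2)]) auto
  also have "\<dots> = sum' (coefS r) P + sum' (coefS r) {t \<in> triples D. \<not> fst t > 0}"
    by (simp add: P_def)
  also have "sum' (coefS r) {t \<in> triples D. \<not> fst t > 0} = sum' (coefS r) P"
  proof -
    have inv: "Nt t \<in> triples D" if "t \<in> triples D" for t using that bij_betwE[OF bij_Nt] by blast
    have "bij_betw Nt P {t \<in> triples D. \<not> fst t > 0}"
    proof (rule bij_betw_byWitness[where f' = Nt])
      show "Nt ` P \<subseteq> {t \<in> triples D. \<not> fst t > 0}"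
        using inv by (fastforce simp: P_def)
      show "Nt ` {t \<in> triples D. \<not> fst t > 0} \<subseteq> P"
        using inv nz by (fastforce simp: P_def)
    qed auto
    from sum'_reindex[OF this, of "coefS r"]
    have "sum' (coefS r) {t \<in> triples D. \<not> fst t > 0} = sum' (\<lambda>t. coefS r (Nt t)) P" by simp
    also have "\<dots> = sum' (coefS r) P"
      by (rule sum.cong') (use nz coefS_Nt in \<open>auto simp: P_def\<close>)
    finally show ?thesis .
  qed
  also have "sum' (coefS r) P = sum' formw (pd_forms (- D))"
  proof -
    let ?h = "\<lambda>(A, C, E). (A, A + C - E, C)"
    have bij: "bij_betw ?h P (pd_forms (- D))"
      by (rule bij_betw_byWitness[where f' = "\<lambda>(A, B, C). (A, C, A - B + C)"])
         (use D in \<open>auto simp: P_def triples_def pd_forms_def bqf_disc_def\<close>)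
    have "sum' formw (pd_forms (- D)) = sum' (\<lambda>t. formw (?h t)) P"
      using sum'_reindex[OF bij, of formw] by simp
    also have "\<dots> = sum' (coefS r) P"
    proof (rule sum.cong')
      fix t assume t: "t \<in> P"
      obtain A C E where teq: "t = (A, C, E)" by (cases t)
      have "A > 0" "A * C > 0" "A * E > 0"
        using t triple_nonzero_elliptic[OF _ D] by (auto simp: P_def teq)
      then have "A > 0" "C > 0" "E > 0" by (auto simp: zero_less_mult_iff)
      then show "formw (?h t) = coefS r t" using coefS_pos by (simp add: teq)
    qed simp
    finally show ?thesis by simp
  qed
  also have "sum' formw (pd_forms (- D)) = hurwitz_H (- D)"
  proof (rule hurwitz_H_eq_sum_formw[symmetric])
    have "- D = - (r^2) + p * 4" by (simp add: D_def)
    then have m: "(- D) mod 4 = (- (r^2)) mod 4" by (simp only: mod_mult_self1)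
    have "r^2 mod 4 = 0 \<or> r^2 mod 4 = 1"
    proof (cases "even r")
      case True then show ?thesis by (auto elim!: evenE simp: power2_eq_square)
    next
      case False
      then obtain k where "r = 2 * k + 1" by (auto elim: oddE)
      then have "r^2 = 4 * (k * k + k) + 1" by (simp add: ring_eqs)
      moreover have "(4 * m + 1) mod 4 = 1" for m :: int by presburger
      ultimately show ?thesis by metis
    qed
    moreover have "(- x) mod 4 = 0 \<or> (- x) mod 4 = 3" if "x mod 4 = 0 \<or> x mod 4 = 1" for x :: int
      using that by presburger
    ultimately have "(- (r^2)) mod 4 = 0 \<or> (- (r^2)) mod 4 = 3" by metis
    then show "(- D) mod 4 \<noteq> 1" "(- D) mod 4 \<noteq> 2" using m by auto
  qed (use D in simp)
  finally show ?thesis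
    using S(1) sum_coefw_trace[of p r] by (simp add: D_def)
qed

section \<open>Hyperbolic traces\<close>

lemma prime_square_diff:
  fixes p r x :: int
  assumes p: "prime p" and eq: "r^2 - x^2 = 4 * p"
  shows "\<bar>r\<bar> = p + 1" "\<bar>x\<bar> = p - 1"
proof -
  have p0: "p > 1" using p prime_gt_1_int by blast
  define u v where "u = \<bar>r\<bar> - \<bar>x\<bar>" "v = \<bar>r\<bar> + \<bar>x\<bar>"
  have uv: "u * v = 4 * p" using eq by (simp add: u_v_def algebra_simps flip: power2_eq_square)
  have par: "even u \<longleftrightarrow> even v" by (simp add: u_v_def)
  have "even (u * v)" using uv by simp
  then have "even u" "even v" using par by auto
  then obtain s t where st: "u = 2 * s" "v = 2 * t" by (auto elim!: evenE)
  have stp: "s * t = p" using uv by (simp add: st)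
  have "0 \<le> t" "s \<le> t" using u_v_def st by linarith+
  moreover have "t \<noteq> 0" using stp p0 by auto
  ultimately have "t > 0" by simp
  then have "s > 0" using stp p0 by (metis zero_less_mult_pos2 order.strict_trans zero_less_one)
  have "s dvd p" using stp by auto
  then have "s = 1 \<or> s = p" using p \<open>s > 0\<close> prime_int_iff by (metis prime_nat_iff abs_of_pos int_nat_eq less_imp_le)
  moreover have "s \<noteq> p"
  proof
    assume "s = p"
    then have "t = 1" using stp p0 by simp
    then show False using \<open>s = p\<close> \<open>s \<le> t\<close> p0 by simp
  qed
  ultimately have "s = 1" "t = p" using stp by auto
  then show "\<bar>r\<bar> = p + 1" "\<bar>x\<bar> = p - 1" using u_v_def st by auto
qed

lemma triple_zero_square:
  assumes "(A, C, E) \<in> triples D" "A = 0 \<or> C = 0 \<or> E = 0"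
  shows "\<exists>x. D = x^2"
proof -
  have "D = (C - E)^2 \<or> D = (A - E)^2 \<or> D = (A - C)^2"
    using assms by (auto simp: triples_def ring_eqs)
  then show ?thesis by blast
qed

text \<open>If A C < 0, both terms are the mean 1/2. If A C > 0 and A E < 0, they are 1 and 0. If
  all entries have the same sign, a nonzero value would need 0 <= B <= A and B <= C after a change
  of sign, hence B^2 <= A C, against B^2 > 4 A C.\<close>

lemma coefS_hyperbolic:
  assumes "(A, C, E) \<in> triples D" "D > 0" "A \<noteq> 0" "C \<noteq> 0" "E \<noteq> 0"
  shows "coefS r (A, C, E) = 0"
proof -
  have pos: "coefS r (A, C, E) = 0" if "A > 0" "C > 0" "E > 0" "(A, C, E) \<in> triples D" for A C E
  proof -
    define B where "B = A + C - E"
    have B: "B^2 > 4 * (A * C)" using that(4) assms(2) by (simp add: triples_def B_def)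
    have AC: "A * C > 0" using that by simp
    have E: "E = A + C - B" by (simp add: B_def)
    have "B \<noteq> 0" using B AC by auto
    moreover have "\<not> (B > 0 \<and> B \<le> A \<and> B \<le> C)"
    proof
      assume "B > 0 \<and> B \<le> A \<and> B \<le> C"
      then have "B^2 \<le> A * C" by (simp add: power2_eq_square mult_mono)
      then show False using B AC by linarith
    qed
    ultimately consider "B < 0" | "B > 0" "B > A" | "B > 0" "B > C" by linarith
    then show ?thesis
      unfolding coefS_pos[OF that(1-3)] formw.simps B_def[symmetric]
      using that by cases (auto simp: hstep_def maxw_def E)
  qed
  consider "A * C < 0" | "A * C > 0" "A * E < 0" | "A > 0" "C > 0" "E > 0" | "A < 0" "C < 0" "E < 0"
    using assms(3-5) by (metis linorder_neqE_linordered_idom mult_neg_pos mult_pos_neg mult_neg_neg mult_pos_pos)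
  then show ?thesis
  proof cases
    case 1 then show ?thesis using assms by (simp add: coefS_def)
  next
    case 2
    then have "sgn A * (A + C - E) > 0" by (auto simp: zero_less_mult_iff mult_less_0_iff)
    then show ?thesis using assms 2 by (simp add: coefS_def hstep_def)
  next
    case 3 then show ?thesis using pos assms(1) by simp
  next
    case 4
    have "(- A, - C, - E) \<in> triples D" using assms(1) bij_betwE[OF bij_Nt] by fastforce
    then show ?thesis using pos[of "- A" "- C" "- E"] 4 coefS_Nt[OF assms(3-5)] by simp
  qed
qed

lemma sum_coefw_hyperbolic:
  assumes p: "prime p" and r: "r^2 > 4 * p" "\<bar>r\<bar> \<noteq> p + 1"
  shows "sum' coefw (trace_mats p r) = 0"
proof -
  define D where "D = r^2 - 4 * p"
  have D: "D > 0" "D \<noteq> 0" using r by (auto simp: D_def)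
  have p0: "p \<noteq> 0" using p by auto
  have nz: "\<not> (A = 0 \<or> C = 0 \<or> E = 0)" if t: "(A, C, E) \<in> triples D" for A C E
  proof
    assume "A = 0 \<or> C = 0 \<or> E = 0"
    then obtain x where "D = x^2" using triple_zero_square[OF t] by blast
    then have "r^2 - x^2 = 4 * p" by (simp add: D_def)
    then show False using prime_square_diff[OF p] r(2) by blast
  qed
  have nz': "r > 0 \<and> D < r^2" if "(A, C, E) \<in> triples D" "A = 0 \<or> C = 0 \<or> E = 0" for A C E
    using nz[OF that(1)] that(2) by blast
  have "coefS r t = 0" if "t \<in> triples D" for t
    using that nz coefS_hyperbolic[OF _ D(1)] by (cases t) fastforce
  then have "sum' (coefS r) (triples D) = 0"
    using sum.cong'[of "triples D" "triples D" "coefS r" "\<lambda>_. 0"] by (simp add: sum.G_def)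
  then show ?thesis
    using sum_coefT_eq(1)[OF nz' D(2) D_def p0] sum_coefw_trace[of p r] by (simp add: D_def)
qed

text \<open>These matrices have eigenvalues 1 and p, so D = (p - 1)^2 is a square and triples with a
  zero entry occur. Only those contribute.\<close>

lemma sum_coefw_split_pos:
  assumes p: "prime p"
  shows "sum' coefw (trace_mats p (p + 1)) = 1 - p"
proof -
  define r D where "r = p + 1" "D = (p - 1)^2"
  have p1: "p > 1" using p prime_gt_1_int by blast
  have DD: "D = r^2 - 4 * p" by (simp add: r_D_def ring_eqs)
  have D: "D > 0" "D \<noteq> 0" using p1 by (auto simp: r_D_def)
  have p0: "p \<noteq> 0" using p1 by auto
  have nz': "r > 0 \<and> D < r^2" if "(A, C, E) \<in> triples D" "A = 0 \<or> C = 0 \<or> E = 0" for A C E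
    using p1 DD by (simp add: r_D_def(1))
  note S = sum_coefT_eq[OF nz' D(2) DD p0]
  have root: "\<bar>x\<bar> = p - 1" if "x^2 = D" for x
    using that p1 by (simp add: r_D_def power2_eq_iff) linarith
  \<comment> \<open>The triples with E nonzero and exactly one of A, C zero are split off: on them
    the weight changes sign under negation of the triple, so they cancel.\<close>
  define h where "h = (\<lambda>(A, C, E). if E \<noteq> 0 \<and> (A = 0) \<noteq> (C = 0) then coefS r (A, C, E) else 0)"
  define g where "g = (\<lambda>t. coefS r t - h t)"
  have finh: "finite {t \<in> triples D. h t \<noteq> 0}"
    by (rule finite_subset[OF _ S(2)]) (auto simp: h_def split: if_splits)
  have fing: "finite {t \<in> triples D. g t \<noteq> 0}"
    by (rule finite_subset[OF _ S(2)]) (auto simp: g_def h_def split: if_splits)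
  have hA: "coefS r (0, C, E) = hstep C + hstep (- (C + E)) - 1"
    if "(0, C, E) \<in> triples D" "C \<noteq> 0" "E \<noteq> 0" for C E
  proof -
    have "\<bar>C - E\<bar> = p - 1" using root[of "C - E"] that by (simp add: triples_def)
    then have "C - E + r > 0" using p1 by (auto simp: r_D_def)
    moreover have "(0 + C - E) * (0 + C) - r * (0 - C) = C * (C - E + r)" by (simp add: algebra_simps)
    ultimately have "sideT r (0, C, E) = hstep C"
      by (simp add: hstep_def zero_less_mult_iff del: sideT.simps add: sideT.simps)
    then show ?thesis using that by (simp add: coefS_def del: sideT.simps)
  qed
  have hC: "coefS r (A, 0, E) = hstep (- A) + hstep (A + E) - 1"
    if "(A, 0, E) \<in> triples D" "A \<noteq> 0" "E \<noteq> 0" for A E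
  proof -
    have "\<bar>A - E\<bar> = p - 1" using root[of "A - E"] that by (simp add: triples_def)
    then have "r + E - A > 0" using p1 by (auto simp: r_D_def)
    moreover have "(A + 0 - E) * (A + 0) - r * (A - 0) = (- A) * (r + E - A)" by (simp add: algebra_simps)
    ultimately have "sideT r (A, 0, E) = hstep (- A)"
      by (simp only: sideT.simps) (auto simp: hstep_def zero_less_mult_iff mult_less_0_iff)
    then show ?thesis using that by (simp add: coefS_def del: sideT.simps)
  qed
  have "sum' h (triples D) = 0"
  proof (rule sum'_antisym[OF bij_Nt finh])
    fix t assume t: "t \<in> triples D"
    obtain A C E where teq: "t = (A, C, E)" by (cases t)
    have t': "(- A, - C, - E) \<in> triples D" using t bij_betwE[OF bij_Nt] by (fastforce simp: teq)
    have u: "hstep (- x) = 1 - hstep x" "hstep (- x - y) = 1 - hstep (x + y)" for x y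
      using hstep_uminus[of x] hstep_uminus[of "x + y"] by auto
    show "h t + h (Nt t) = 0"
      using hA[of C E] hA[of "- C" "- E"] hC[of A E] hC[of "- A" "- E"] t t' u
      by (auto simp: h_def teq add.commute)
  qed
  moreover have "sum' g (triples D) = 1 - p"
  proof -
    let ?f1 = "\<lambda>A::int. (A, A - (p - 1), 0::int)" and ?f2 = "\<lambda>A::int. (A, A + (p - 1), 0::int)"
    \<comment> \<open>\<open>X1\<close> and \<open>X2\<close> consist of the triples with E = 0 and
      A C < 0, each of weight 1/2 + 0 - 1; \<open>X3\<close> collects the boundary triples, with
      weights -1, -1, 1/2, 1/2. The total is - (p - 2) - 1.\<close>
    define X1 where "X1 = ?f1 ` {1..p-2}"
    define X2 where "X2 = ?f2 ` {2-p..-1}"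
    define X3 :: "triple set" where "X3 = {(0, 1 - p, 0), (p - 1, 0, 0), (0, 0, p - 1), (0, 0, 1 - p)}"
    have g0: "g (A, C, E) = coefS r (A, C, E)" if "E = 0 \<or> (A = 0 \<and> C = 0)" for A C E
      using that by (auto simp: g_def h_def)
    have gE: "g (A, C, 0) = - 1 / 2" if "A * C < 0" for A C
      using that by (simp add: g0 coefS_def)
    have v3: "g (0, 1 - p, 0) = -1" "g (p - 1, 0, 0) = -1" "g (0, 0, p - 1) = 1/2" "g (0, 0, 1 - p) = 1/2"
    proof -
      have "(1 - p) * (1 - p) - r * - (1 - p) < 0" "(p - 1) * (p - 1) - r * (p - 1) < 0"
        using p1 by (auto simp: r_D_def algebra_simps)
      moreover have "p - 1 \<noteq> r" "p \<noteq> 1" using p1 by (auto simp: r_D_def)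
      ultimately show "g (0, 1 - p, 0) = -1" "g (p - 1, 0, 0) = -1"
        by (simp_all add: g0 coefS_def hstep_def)
      show "g (0, 0, p - 1) = 1/2" "g (0, 0, 1 - p) = 1/2"
        using p1 by (simp_all add: g0 coefS_def hstep_def)
    qed
    have fin: "finite X1" "finite X2" "finite X3" by (simp_all add: X1_def X2_def X3_def)
    have sub: "X1 \<union> X2 \<union> X3 \<subseteq> triples D"
      by (auto simp: X1_def X2_def X3_def triples_def r_D_def ring_eqs)
    have out: "g t = 0" if t: "t \<in> triples D" "t \<notin> X1 \<union> X2 \<union> X3" for t
    proof -
      obtain A C E where teq: "t = (A, C, E)" by (cases t)
      show ?thesis
      proof (cases "E = 0")
        case E: True
        have "(A - C)^2 = D" using t(1) by (simp add: teq E triples_def ring_eqs)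
        then have AC: "A - C = p - 1 \<or> A - C = 1 - p" using root[of "A - C"] by auto
        have "\<not> A * C < 0"
        proof
          assume "A * C < 0"
          then have s: "A > 0 \<and> C < 0 \<or> A < 0 \<and> C > 0" by (auto simp: mult_less_0_iff)
          from AC show False
          proof
            assume "A - C = p - 1"
            then have "C = A - (p - 1)" "A \<in> {1..p-2}" using s p1 by auto
            then have "t \<in> X1" by (simp add: X1_def teq E)
            then show False using t(2) by simp
          next
            assume "A - C = 1 - p"
            then have "C = A + (p - 1)" "A \<in> {2-p..-1}" using s p1 by auto
            then have "t \<in> X2" by (simp add: X2_def teq E)
            then show False using t(2) by simp
          qed
        qed
        then consider "A * C > 0" | "A = 0" | "C = 0" by fastforce
        then show ?thesis
        proof cases
          case 1
          then have "sgn A * (A + C) > 0" by (auto simp: zero_less_mult_iff)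
          then show ?thesis using 1 E by (simp add: teq g0 coefS_def hstep_def)
        next
          case 2
          then have "C = p - 1" using AC t(2) by (auto simp: teq E X3_def)
          moreover have "r * (1 - p) < (p - 1) * (p - 1)"
            using p1 by (intro order.strict_trans[OF mult_pos_neg mult_pos_pos]) (auto simp: r_D_def)
          ultimately show ?thesis using 2 E by (simp add: teq g0 coefS_def hstep_def)
        next
          case 3
          then have "A = 1 - p" using AC t(2) by (auto simp: teq E X3_def)
          moreover have "r * (1 - p) < (1 - p) * (1 - p)"
            using p1 by (intro order.strict_trans[OF mult_pos_neg mult_neg_neg]) (auto simp: r_D_def)
          ultimately show ?thesis using 3 E by (simp add: teq g0 coefS_def hstep_def)
        qed
      next
        case E: False
        consider "A \<noteq> 0" "C \<noteq> 0" | "A = 0" "C = 0" | "(A = 0) \<noteq> (C = 0)" by blast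
        then show ?thesis
        proof cases
          case 1
          then show ?thesis using coefS_hyperbolic[OF t(1)[unfolded teq] D(1) 1 E] by (simp add: g_def h_def teq)
        next
          case 2
          then have "E^2 = D" using t(1) by (simp add: teq triples_def)
          then have "t \<in> X3" using root[of E] 2 by (auto simp: X3_def teq)
          then show ?thesis using t(2) by simp
        next
          case 3
          then show ?thesis using E by (simp add: g_def h_def teq)
        qed
      qed
    qed
    have "sum' g (triples D) = sum g (X1 \<union> X2 \<union> X3)"
      using fin sub out by (intro sum'_eq_sum) auto
    also have "\<dots> = sum g X1 + sum g X2 + sum g X3"
      using p1 by (subst sum.union_disjoint sum.union_disjoint, auto simp: fin X1_def X2_def X3_def)+
    also have "sum g X1 = (\<Sum>x\<in>X1. - 1 / 2)"
      by (rule sum.cong[OF refl]) (auto simp: X1_def gE mult_pos_neg)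
    also have "\<dots> = - (p - 2) / 2"
    proof -
      have "card X1 = nat (p - 2)" unfolding X1_def by (subst card_image) (auto simp: inj_on_def)
      then show ?thesis using p1 by (simp add: field_simps)
    qed
    also have "sum g X2 = (\<Sum>x\<in>X2. - 1 / 2)"
      by (rule sum.cong[OF refl]) (auto simp: X2_def gE mult_neg_pos)
    also have "\<dots> = - (p - 2) / 2"
    proof -
      have "card X2 = nat (p - 2)" unfolding X2_def by (subst card_image) (auto simp: inj_on_def)
      then show ?thesis using p1 by (simp add: field_simps)
    qed
    also have "sum g X3 = -1"
      using p1 v3 by (simp add: X3_def)
    finally show ?thesis by (simp add: field_simps)
  qed
  moreover have "sum' (coefS r) (triples D) = sum' h (triples D) + sum' g (triples D)"
    using sum.distrib'[OF finh fing] by (simp add: g_def)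
  ultimately show ?thesis
    using S(1) sum_coefw_trace[of p r] DD by (simp add: r_D_def(1))
qed

lemma sum_coefw_uminus: "sum' coefw (trace_mats p (- r)) = sum' coefw (trace_mats p r)"
proof -
  have bij: "bij_betw (\<lambda>(a, b, c, d). (- a, - b, - c, - d)) (trace_mats p r) (trace_mats p (- r))"
    by (rule bij_betw_byWitness[where f' = "\<lambda>(a, b, c, d). (- a, - b, - c, - d)"])
       (auto simp: trace_mats_def)
  have "coefw (- a, - b, - c, - d) = coefw (a, b, c, d)" for a b c d
  proof -
    have "- a + - c = - (a + c)" "- b + - d = - (b + d)" by auto
    then show ?thesis by (simp only: coefw_def side.simps sector.simps qval_uminus)
  qed
  then show ?thesis
    using sum'_reindex[OF bij, of coefw] by (simp add: case_prod_unfold)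
qed

lemma sum_coefw_split:
  assumes "prime p" "\<bar>r\<bar> = p + 1"
  shows "sum' coefw (trace_mats p r) = 1 - p"
proof -
  have "r = p + 1 \<or> r = - (p + 1)" using assms(2) by auto
  then show ?thesis using sum_coefw_split_pos[OF assms(1)] sum_coefw_uminus[of p "p + 1"] by auto
qed

subsection \<open>The Hecke kernel modulo 7\<close>

definition veq :: "int \<times> int \<Rightarrow> int \<times> int \<Rightarrow> bool" where
  "veq v w \<longleftrightarrow> (\<exists>e\<in>{1, -1}. [fst v = e * fst w] (mod 7) \<and> [snd v = e * snd w] (mod 7))"

text \<open>The factor l is a diamond operator; it selects which eigenvalue modulo 7 the fixed vectors detect.\<close>

fun app :: "int \<Rightarrow> imat \<Rightarrow> int \<times> int \<Rightarrow> int \<times> int" where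
  "app l (a, b, c, d) (x, y) = (l * (a * x + b * y), l * (c * x + d * y))"

fun Sv :: "int \<times> int \<Rightarrow> int \<times> int" where "Sv (x, y) = (- y, x)"
fun Uv :: "int \<times> int \<Rightarrow> int \<times> int" where "Uv (x, y) = (- y, x + y)"
fun Tv :: "int \<times> int \<Rightarrow> int \<times> int" where "Tv (x, y) = (x + y, y)"

fun Sr :: "imat \<Rightarrow> imat" where "Sr (a, b, c, d) = (b, - a, d, - c)"
fun Ur :: "imat \<Rightarrow> imat" where "Ur (a, b, c, d) = (b, b - a, d, d - c)"
fun Tr :: "imat \<Rightarrow> imat" where "Tr (a, b, c, d) = (a, a + b, c, c + d)"
fun Mneg :: "imat \<Rightarrow> imat" where "Mneg (a, b, c, d) = (- a, - b, - c, - d)"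

lemma veq_refl: "veq v v"
  by (auto simp: veq_def)

lemma veq_linear:
  assumes "veq v w"
  shows "veq (k * fst v + m * snd v, k' * fst v + m' * snd v) (k * fst w + m * snd w, k' * fst w + m' * snd w)"
proof -
  obtain e where e: "e \<in> {1, -1}" "[fst v = e * fst w] (mod 7)" "[snd v = e * snd w] (mod 7)"
    using assms unfolding veq_def by blast
  have "[k * fst v + m * snd v = k * (e * fst w) + m * (e * snd w)] (mod 7)" for k m
    using e by (intro cong_add cong_mult cong_refl) auto
  moreover have "k * (e * fst w) + m * (e * snd w) = e * (k * fst w + m * snd w)" for k m
    by (simp add: algebra_simps)
  ultimately have "[k * fst v + m * snd v = e * (k * fst w + m * snd w)] (mod 7)" for k m by metis
  then show ?thesis using e(1) unfolding veq_def by auto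
qed

lemma veq_sym: "veq v w \<longleftrightarrow> veq w v"
proof -
  have "veq w v" if vw: "veq v w" for v w
  proof -
    obtain e where e: "e \<in> {1, -1}" "[fst v = e * fst w] (mod 7)" "[snd v = e * snd w] (mod 7)"
      using vw unfolding veq_def by blast
    have ee: "e * e = 1" using e(1) by auto
    have "[e * fst v = e * (e * fst w)] (mod 7)" "[e * snd v = e * (e * snd w)] (mod 7)"
      using e by (auto intro: cong_scalar_left)
    then have "[fst w = e * fst v] (mod 7)" "[snd w = e * snd v] (mod 7)"
      by (simp_all add: mult.assoc[symmetric] ee cong_sym_eq)
    then show ?thesis using e(1) unfolding veq_def by blast
  qed
  then show ?thesis by blast
qed

lemma veq_trans: "veq u v \<Longrightarrow> veq v w \<Longrightarrow> veq u w"
proof -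
  assume uv: "veq u v" and vw: "veq v w"
  obtain e where e: "e \<in> {1, -1}" "[fst u = e * fst v] (mod 7)" "[snd u = e * snd v] (mod 7)"
    using uv unfolding veq_def by blast
  obtain f where f: "f \<in> {1, -1}" "[fst v = f * fst w] (mod 7)" "[snd v = f * snd w] (mod 7)"
    using vw unfolding veq_def by blast
  have "[fst u = (e * f) * fst w] (mod 7)" "[snd u = (e * f) * snd w] (mod 7)"
    using e(2,3) f(2,3) cong_scalar_left[of _ _ 7 e] by (metis cong_trans mult.assoc)+
  moreover have "e * f \<in> {1, -1}" using e(1) f(1) by auto
  ultimately show ?thesis unfolding veq_def by blast
qed

lemma veq_cong_left: "veq v v' \<Longrightarrow> veq v w \<longleftrightarrow> veq v' w"
  and veq_cong_right: "veq w w' \<Longrightarrow> veq v w \<longleftrightarrow> veq v w'"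
  using veq_trans veq_sym by blast+

lemma veq_app: "veq x x' \<Longrightarrow> veq (app l M x) (app l M x')"
  using veq_linear[of x x' "l * fst M" "l * fst (snd M)" "l * fst (snd (snd M))" "l * snd (snd (snd M))"]
  by (cases M; cases x; cases x') (simp add: algebra_simps)

lemma veq_Sv: "veq (Sv v) (Sv w) \<longleftrightarrow> veq v w"
  using veq_linear[of v w 0 "-1" 1 0] veq_linear[of "Sv v" "Sv w" 0 1 "-1" 0]
  by (cases v; cases w) auto

lemma veq_Uv: "veq (Uv v) (Uv w) \<longleftrightarrow> veq v w"
  using veq_linear[of v w 0 "-1" 1 1] veq_linear[of "Uv v" "Uv w" 1 1 "-1" 0]
  by (cases v; cases w) auto

lemma veq_Sv_Sv: "veq (Sv (Sv v)) v"
  by (cases v) (auto simp: veq_def)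

lemma app_Sl: "app l (Sl M) x = Sv (app l M x)"
  and app_Ul: "app l (Ul M) x = Uv (app l M x)"
  and app_Sr: "app l M (Sv x) = app l (Sr M) x"
  and app_Ur: "app l M (Uv x) = app l (Ur M) x"
  and app_Tr: "app l M (Tv x) = app l (Tr M) x"
  by (cases M; cases x; simp add: algebra_simps)+

lemma bij_Sr: "bij_betw Sr (det_mats n) (det_mats n)"
  by (rule bij_betw_byWitness[where f' = "\<lambda>(a, b, c, d). (- b, a, - d, c)"])
     (auto simp: det_mats_def algebra_simps)

lemma bij_Ur: "bij_betw Ur (det_mats n) (det_mats n)"
  by (rule bij_betw_byWitness[where f' = "\<lambda>(a, b, c, d). (a - b, a, c - d, c)"])
     (auto simp: det_mats_def algebra_simps)

lemma bij_Tr: "bij_betw Tr (det_mats n) (det_mats n)"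
  by (rule bij_betw_byWitness[where f' = "\<lambda>(a, b, c, d). (a, b - a, c, d - c)"])
     (auto simp: det_mats_def algebra_simps)

lemma side_Sr: "side (1, 0, 1) (Sr M) = side (1, 0, 1) M"
  by (cases M) (simp add: ring_eqs)

lemma sector_Ur: "sector (1, -1, 1) (Ur M) = sector (1, -1, 1) M"
  by (cases M) (simp add: ring_eqs)

lemma sector_Mneg: "sector Q (Mneg M) = sector Q M"
proof (cases M)
  case (fields a b c d)
  have "- a + - c = - (a + c)" "- b + - d = - (b + d)" by auto
  then show ?thesis by (simp only: fields Mneg.simps sector.simps qval_uminus)
qed

text \<open>S U = - T, and U fixes rho.\<close>

lemma sector_Sr: "sector (1, -1, 1) (Sr M) = sector (1, -1, 1) (Tr M)"
proof -
  have "Ur (Sr M) = Mneg (Tr M)" by (cases M) simp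
  then show ?thesis using sector_Ur[of "Sr M"] sector_Mneg[of _ "Tr M"] by simp
qed

lemma coefw_Sr_Sr: "coefw (Sr (Sr M)) = coefw M"
proof -
  have "Sr (Sr M) = Mneg M" by (cases M) simp
  moreover have "side (1, 0, 1) (Sr (Sr M)) = side (1, 0, 1) M" by (simp only: side_Sr)
  ultimately show ?thesis using sector_Mneg[of "(1, -1, 1)" M] by (simp add: coefw_def)
qed

section \<open>The kernel and its relations under S and U\<close>

definition kern :: "int \<Rightarrow> int \<Rightarrow> int \<times> int \<Rightarrow> int \<times> int \<Rightarrow> real" where
  "kern p l x y = sum' (\<lambda>M. coefw M * of_bool (veq (app l M x) y)) (det_mats p)"

lemma finite_mult_supp:
  fixes f g :: "'a \<Rightarrow> real"
  assumes "finite {M \<in> A. f M \<noteq> 0}" shows "finite {M \<in> A. f M * g M \<noteq> 0}"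
  by (rule finite_subset[OF _ assms]) auto

lemma kern_cong:
  assumes "veq x x'" "veq y y'"
  shows "kern p l x y = kern p l x' y'"
proof -
  have "veq (app l M x) y = veq (app l M x') y'" for M
    using veq_cong_left[OF veq_app[OF assms(1)]] veq_cong_right[OF assms(2)] by blast
  then show ?thesis by (simp add: kern_def)
qed

lemma kern_Sv_right: "kern p l x (Sv y) = sum' (\<lambda>M. coefw (Sl M) * of_bool (veq (app l M x) y)) (det_mats p)"
  using sum'_reindex[OF bij_Sl, of "\<lambda>M. coefw M * of_bool (veq (app l M x) (Sv y))" p]
  by (simp only: kern_def app_Sl veq_Sv)

lemma kern_Uv_right: "kern p l x (Uv y) = sum' (\<lambda>M. coefw (Ul M) * of_bool (veq (app l M x) y)) (det_mats p)"
  using sum'_reindex[OF bij_Ul, of "\<lambda>M. coefw M * of_bool (veq (app l M x) (Uv y))" p]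
  by (simp only: kern_def app_Ul veq_Uv)

lemma kern_Uv_Uv_right:
  "kern p l x (Uv (Uv y)) = sum' (\<lambda>M. coefw (Ul (Ul M)) * of_bool (veq (app l M x) y)) (det_mats p)"
  using sum'_reindex[OF bij_Ul, of "\<lambda>M. coefw (Ul M) * of_bool (veq (app l M x) (Uv y))" p]
  by (simp only: kern_Uv_right app_Ul veq_Uv)

lemma kern_Sv_left: "kern p l (Sv x) y = sum' (\<lambda>M. coefw (Sr M) * of_bool (veq (app l M x) y)) (det_mats p)"
  using sum'_reindex[OF bij_Sr, of "\<lambda>M. coefw (Sr M) * of_bool (veq (app l M x) y)" p]
  by (simp only: kern_def app_Sr coefw_Sr_Sr)

context
  fixes p :: int
  assumes p: "p > 0"
begin

lemma finite_coefw_p: "finite {M \<in> det_mats p. coefw M \<noteq> 0}"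
  using finite_coefw p by simp

lemma finite_coefw_Sl: "finite {M \<in> det_mats p. coefw (Sl M) \<noteq> 0}"
  and finite_coefw_Ul: "finite {M \<in> det_mats p. coefw (Ul M) \<noteq> 0}"
  and finite_coefw_Ul_Ul: "finite {M \<in> det_mats p. coefw (Ul (Ul M)) \<noteq> 0}"
  and finite_coefw_Sr: "finite {M \<in> det_mats p. coefw (Sr M) \<noteq> 0}"
proof -
  show U: "finite {M \<in> det_mats p. coefw (Ul M) \<noteq> 0}"
    using finite_supp_reindex[OF bij_Ul finite_coefw_p] .
  show "finite {M \<in> det_mats p. coefw (Ul (Ul M)) \<noteq> 0}"
    using finite_supp_reindex[OF bij_Ul U] .
  show "finite {M \<in> det_mats p. coefw (Sl M) \<noteq> 0}" "finite {M \<in> det_mats p. coefw (Sr M) \<noteq> 0}"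
    using finite_supp_reindex[OF bij_Sl finite_coefw_p] finite_supp_reindex[OF bij_Sr finite_coefw_p] .
qed

text \<open>Left multiplication by S replaces \<open>side\<close> by 1 - \<open>side\<close>, so
  only the \<open>sector\<close> terms survive; these are invariant under right multiplication by U,
  which gives the next relation.\<close>

lemma kern_S_sum:
  "kern p l x y + kern p l x (Sv y)
    = sum' (\<lambda>M. (sector (1, -1, 1) M + sector (1, -1, 1) (Sl M) - 1) * of_bool (veq (app l M x) y)) (det_mats p)"
proof -
  have "kern p l x y + kern p l x (Sv y)
    = sum' (\<lambda>M. coefw M * of_bool (veq (app l M x) y) + coefw (Sl M) * of_bool (veq (app l M x) y)) (det_mats p)"
    unfolding kern_Sv_right unfolding kern_def
    by (rule sum.distrib'[symmetric]) (intro finite_mult_supp finite_coefw_p finite_coefw_Sl)+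
  also have "\<dots> = sum' (\<lambda>M. (sector (1, -1, 1) M + sector (1, -1, 1) (Sl M) - 1) * of_bool (veq (app l M x) y)) (det_mats p)"
    by (rule sum.cong'[OF refl]) (simp add: coefw_def side_Sl algebra_simps)
  finally show ?thesis .
qed

lemma kern_S_sum_Uv:
  "kern p l (Uv x) y + kern p l (Uv x) (Sv y) = kern p l x y + kern p l x (Sv y)"
proof -
  have "Sl (Ur M) = Ur (Sl M)" for M by (cases M) simp
  then show ?thesis
    using sum'_reindex[OF bij_Ur, of "\<lambda>M. (sector (1, -1, 1) M + sector (1, -1, 1) (Sl M) - 1) * of_bool (veq (app l M x) y)" p]
    by (simp only: kern_S_sum app_Ur sector_Ur)
qed

text \<open>The \<open>sector\<close> terms of a left U-orbit add up to 1. What remains are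
  \<open>side\<close> terms, which right multiplication by S preserves.\<close>

lemma kern_U_sum:
  "kern p l x y + kern p l x (Uv y) + kern p l x (Uv (Uv y))
    = sum' (\<lambda>M. (side (1, 0, 1) M + side (1, 0, 1) (Ul M) + side (1, 0, 1) (Ul (Ul M)) - 2)
        * of_bool (veq (app l M x) y)) (det_mats p)"
proof -
  have fin: "finite {M \<in> det_mats p. coefw M * of_bool (veq (app l M x) y) + coefw (Ul M) * of_bool (veq (app l M x) y) \<noteq> 0}"
    by (rule finite_subset[OF _ finite_UnI[OF finite_coefw_p finite_coefw_Ul]]) auto
  have "kern p l x y + kern p l x (Uv y) + kern p l x (Uv (Uv y))
    = sum' (\<lambda>M. (coefw M * of_bool (veq (app l M x) y) + coefw (Ul M) * of_bool (veq (app l M x) y))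
        + coefw (Ul (Ul M)) * of_bool (veq (app l M x) y)) (det_mats p)"
    unfolding kern_Uv_Uv_right unfolding kern_Uv_right unfolding kern_def
    by (subst sum.distrib'[OF fin], intro finite_mult_supp finite_coefw_Ul_Ul,
        subst sum.distrib', (intro finite_mult_supp finite_coefw_p finite_coefw_Ul)+) simp
  also have "\<dots> = sum' (\<lambda>M. (side (1, 0, 1) M + side (1, 0, 1) (Ul M) + side (1, 0, 1) (Ul (Ul M)) - 2)
        * of_bool (veq (app l M x) y)) (det_mats p)"
  proof (rule sum.cong'[OF refl])
    fix M
    show "coefw M * of_bool (veq (app l M x) y) + coefw (Ul M) * of_bool (veq (app l M x) y)
        + coefw (Ul (Ul M)) * of_bool (veq (app l M x) y)
      = (side (1, 0, 1) M + side (1, 0, 1) (Ul M) + side (1, 0, 1) (Ul (Ul M)) - 2) * of_bool (veq (app l M x) y)"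
      using sector_Ul[of "(1, -1, 1)" M] by (simp add: coefw_def)
  qed
  finally show ?thesis .
qed

lemma kern_U_sum_Sv:
  "kern p l (Sv x) y + kern p l (Sv x) (Uv y) + kern p l (Sv x) (Uv (Uv y))
    = kern p l x y + kern p l x (Uv y) + kern p l x (Uv (Uv y))"
proof -
  have "Ul (Sr M) = Sr (Ul M)" for M by (cases M) simp
  then show ?thesis
    using sum'_reindex[OF bij_Sr, of "\<lambda>M. (side (1, 0, 1) M + side (1, 0, 1) (Ul M) + side (1, 0, 1) (Ul (Ul M)) - 2)
        * of_bool (veq (app l M x) y)" p]
    by (simp only: kern_U_sum app_Sr side_Sr)
qed

end

section \<open>The relations at the cusps\<close>

lemma telescope_finite:
  fixes Y :: "'a \<Rightarrow> real"
  assumes inv: "\<And>M. M \<in> A \<Longrightarrow> t M \<in> A" "\<And>M. M \<in> A \<Longrightarrow> s (t M) = M"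
    and fin: "finite {M \<in> A. Y M - Y (t M) \<noteq> 0}"
    and up: "\<And>M. M \<in> A \<Longrightarrow> \<exists>K. \<forall>k\<ge>K. Y ((t ^^ k) M) = 0"
    and down: "\<And>M. M \<in> A \<Longrightarrow> \<exists>K. \<forall>k\<ge>K. Y ((s ^^ k) M) = 0"
  shows "finite {M \<in> A. Y M \<noteq> 0}"
proof -
  define Z where "Z = {M \<in> A. Y M - Y (t M) \<noteq> 0}"
  obtain K where K: "\<And>M k. M \<in> A \<Longrightarrow> k \<ge> K M \<Longrightarrow> Y ((s ^^ k) M) = 0" using down by metis
  \<comment> \<open>From M one moves along t until Y vanishes for the first time. The element just
    before lies in the finite set Z, and M is reached from it by fewer than K steps along s.\<close>
  have "{M \<in> A. Y M \<noteq> 0} \<subseteq> (\<Union>M\<in>Z. (\<lambda>k. (s ^^ k) M) ` {..<K M})"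
  proof clarify
    fix M assume M: "M \<in> A" "Y M \<noteq> 0"
    have tA: "(t ^^ k) M \<in> A" for k using M(1) inv(1) by (induction k) auto
    have st: "(s ^^ k) ((t ^^ k) M) = M" for k
    proof (induction k)
      case (Suc k)
      have "(s ^^ Suc k) ((t ^^ Suc k) M) = (s ^^ k) (s (t ((t ^^ k) M)))"
        unfolding funpow_Suc_right[of k s] by simp
      then show ?case using Suc tA inv(2) by simp
    qed simp
    obtain k where "Y ((t ^^ k) M) = 0" using up[OF M(1)] by blast
    then have "\<exists>k. Y ((t ^^ k) M) = 0" by blast
    define k where "k = (LEAST k. Y ((t ^^ k) M) = 0)"
    have k0: "Y ((t ^^ k) M) = 0" unfolding k_def by (rule LeastI_ex) fact
    have "k \<noteq> 0" using k0 M(2) by (metis funpow_0)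
    then obtain j where j: "k = Suc j" by (cases k) auto
    have "Y ((t ^^ j) M) \<noteq> 0" using not_less_Least[of j "\<lambda>k. Y ((t ^^ k) M) = 0"] j by (simp add: k_def)
    then have "(t ^^ j) M \<in> Z" using k0 tA by (simp add: Z_def j)
    moreover have "j < K ((t ^^ j) M)"
    proof (rule ccontr)
      assume "\<not> ?thesis"
      then have "Y ((s ^^ j) ((t ^^ j) M)) = 0" using K[OF tA, of j j] by simp
      then show False using M(2) st by simp
    qed
    ultimately show "M \<in> (\<Union>M\<in>Z. (\<lambda>k. (s ^^ k) M) ` {..<K M})"
      using st[of j] by (metis (no_types, lifting) UN_I imageI lessThan_iff)
  qed
  moreover have "finite (\<Union>M\<in>Z. (\<lambda>k. (s ^^ k) M) ` {..<K M})" using fin by (simp add: Z_def)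
  ultimately show ?thesis using finite_subset by blast
qed

text \<open>The limit of g(M T^k rho) as k tends to either infinity, where T = (1, 1, 0, 1). The two limits differ
  only if M maps the cusp infinity to infinity or 0; then a step function in k is used.\<close>

fun cusplim :: "imat \<Rightarrow> real" where
  "cusplim (a, b, c, d) = (if a * c > 0 then 1 else if a * c < 0 then 0
     else if c = 0 then of_bool (a * b \<ge> 0) else of_bool (c * d < 0))"

lemma quadratic_pos:
  fixes u v w k :: int
  assumes "u > 0" "\<bar>k\<bar> \<ge> \<bar>v\<bar> + \<bar>w\<bar> + 1"
  shows "u * k^2 + v * k + w > 0"
proof -
  have "\<bar>k\<bar> * (\<bar>v\<bar> + \<bar>w\<bar> + 1) \<le> \<bar>k\<bar> * \<bar>k\<bar>" using assms(2) by (intro mult_left_mono) auto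
  also have "\<dots> = 1 * k^2" by (simp add: power2_eq_square)
  also have "\<dots> \<le> u * k^2" using assms(1) by (intro mult_right_mono) auto
  finally have "\<bar>k\<bar> * \<bar>v\<bar> + \<bar>k\<bar> * \<bar>w\<bar> + \<bar>k\<bar> \<le> u * k^2" by (simp add: algebra_simps)
  moreover have "\<bar>v * k\<bar> = \<bar>k\<bar> * \<bar>v\<bar>" by (simp add: abs_mult mult.commute)
  moreover have "1 * \<bar>w\<bar> \<le> \<bar>k\<bar> * \<bar>w\<bar>" using assms(2) by (intro mult_right_mono) auto
  moreover have "\<bar>k\<bar> > 0" using assms(2) by simp
  ultimately show ?thesis by linarith
qed

lemma quadratic_neg:
  fixes u v w k :: int
  assumes "u < 0" "\<bar>k\<bar> \<ge> \<bar>v\<bar> + \<bar>w\<bar> + 1"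
  shows "u * k^2 + v * k + w < 0"
  using quadratic_pos[of "- u" "- v" "- w" k] assms by simp

lemma linear_pos:
  fixes v w k :: int
  assumes "v > 0" "k \<ge> \<bar>w\<bar> + 1"
  shows "v * k + w > 0"
proof -
  have "1 * k \<le> v * k" using assms by (intro mult_right_mono) auto
  then show ?thesis using assms by linarith
qed

lemma sector_eventually:
  assumes "(a, b, c, d) \<in> det_mats p" "p > 0"
  shows "\<exists>K. \<forall>k. \<bar>k\<bar> \<ge> K \<longrightarrow>
    sector (1, -1, 1) (a, b + k * a, c, d + k * c) = cusplim (a, b + k * a, c, d + k * c)"
proof -
  have det: "a * d - b * c = p" using assms by (simp add: det_mats_def)
  \<comment> \<open>The quadratic polynomials in k with coefficients u1, v1, w1 and u2, v2, w2 are
    the value at the sum of the rows of M T^k minus the value at the top row and at the bottom row,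
    respectively.\<close>
  define u1 v1 w1 where "u1 = c * (c + 2 * a)"
    "v1 = 2 * c * d - c^2 + 2 * (a * d + b * c) - 2 * a * c" "w1 = c^2 - c * d + d^2 + 2 * a * c - a * d - b * c + 2 * b * d"
  define u2 v2 w2 where "u2 = a * (a + 2 * c)"
    "v2 = 2 * a * b - a^2 + 2 * (a * d + b * c) - 2 * a * c" "w2 = a^2 - a * b + b^2 + 2 * a * c - a * d - b * c + 2 * b * d"
  have sec: "sector (1, -1, 1) (a, b + k * a, c, d + k * c)
      = maxw 0 (- (u2 * k^2 + v2 * k + w2)) (- (u1 * k^2 + v1 * k + w1))" for k
    unfolding sector.simps
    by (rule maxw_scale[of 1])
       (simp_all add: u1_v1_w1_def u2_v2_w2_def ring_eqs)
  have m1: "maxw 0 (- y) (- x) = 1" if "x > 0" "y > 0" for x y using that by (simp add: maxw_def)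
  have m0: "maxw 0 (- y) (- x) = 0" if "x < 0 \<or> y < 0" for x y using that by (auto simp: maxw_def)
  let ?K = "\<bar>v1\<bar> + \<bar>w1\<bar> + \<bar>v2\<bar> + \<bar>w2\<bar> + 1"
  consider "a * c > 0" | "a * c < 0" | "c = 0" "a \<noteq> 0" | "a = 0" "c \<noteq> 0" using det assms(2)
    by (cases "a = 0"; cases "c = 0") (auto simp: zero_less_mult_iff mult_less_0_iff linorder_neq_iff)
  then show ?thesis
  proof cases
    case 1
    then have "u1 > 0" "u2 > 0" by (auto simp: u1_v1_w1_def u2_v2_w2_def zero_less_mult_iff)
    then have "\<bar>k\<bar> \<ge> ?K \<Longrightarrow> sector (1, -1, 1) (a, b + k * a, c, d + k * c) = 1" for k
      unfolding sec by (intro m1 quadratic_pos) auto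
    then show ?thesis using 1 by (intro exI[of _ ?K]) (simp del: sector.simps)
  next
    case 2
    then have "u1 < 0 \<or> u2 < 0" by (auto simp: u1_v1_w1_def u2_v2_w2_def mult_less_0_iff)
    then have "sector (1, -1, 1) (a, b + k * a, c, d + k * c) = 0" if "\<bar>k\<bar> \<ge> ?K" for k
    proof -
      have "\<bar>v1\<bar> + \<bar>w1\<bar> + 1 \<le> \<bar>k\<bar>" "\<bar>v2\<bar> + \<bar>w2\<bar> + 1 \<le> \<bar>k\<bar>" using that by linarith+
      with \<open>u1 < 0 \<or> u2 < 0\<close> show ?thesis
        unfolding sec using quadratic_neg by (intro m0) blast
    qed
    then show ?thesis using 2 by (intro exI[of _ ?K]) (simp del: sector.simps)
  next
    case 3
    then have u: "u1 = 0" "u2 > 0" "v1 > 0" using det assms(2)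
      by (auto simp: u1_v1_w1_def u2_v2_w2_def zero_less_mult_iff linorder_neq_iff)
    define K where "K = ?K + \<bar>a * b\<bar> + 1"
    have a2: "a * a > 0" using 3 by (auto simp: zero_less_mult_iff)
    have "sector (1, -1, 1) (a, b + k * a, c, d + k * c) = cusplim (a, b + k * a, c, d + k * c)"
      if k: "\<bar>k\<bar> \<ge> K" for k
    proof (cases "k \<ge> 0")
      case True
      then have "a * a * k + a * b > 0" using linear_pos[OF a2, of "a * b" k] k by (simp add: K_def)
      then have "a * (b + k * a) \<ge> 0" by (simp add: algebra_simps)
      then show ?thesis
        using True k quadratic_pos[OF u(2), of v2 w2 k] linear_pos[OF u(3), of w1 k] 3 u(1)
          m1[of "u1 * k^2 + v1 * k + w1" "u2 * k^2 + v2 * k + w2"]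
        unfolding sec by (simp add: K_def)
    next
      case False
      then have "a * a * (- k) + - (a * b) > 0" using linear_pos[OF a2, of "- (a * b)" "- k"] k by (simp add: K_def)
      then have "\<not> a * (b + k * a) \<ge> 0" by (simp add: algebra_simps)
      then show ?thesis
        using False k linear_pos[OF u(3), of "- w1" "- k", unfolded neg_less_iff_less mult_minus_right minus_add_distrib[symmetric] neg_0_less_iff_less] 3 u(1)
          m0[of "u1 * k^2 + v1 * k + w1" "u2 * k^2 + v2 * k + w2"]
        unfolding sec by (simp add: K_def)
    qed
    then show ?thesis by blast
  next
    case 4
    then have u: "u2 = 0" "u1 > 0" "- v2 > 0" using det assms(2)
      by (auto simp: u1_v1_w1_def u2_v2_w2_def zero_less_mult_iff linorder_neq_iff)
    define K where "K = ?K + \<bar>c * d\<bar> + 1"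
    have c2: "c * c > 0" using 4 by (auto simp: zero_less_mult_iff)
    have "sector (1, -1, 1) (a, b + k * a, c, d + k * c) = cusplim (a, b + k * a, c, d + k * c)"
      if k: "\<bar>k\<bar> \<ge> K" for k
    proof (cases "k \<ge> 0")
      case True
      then have "c * c * k + c * d > 0" using linear_pos[OF c2, of "c * d" k] k by (simp add: K_def)
      then have "\<not> c * (d + k * c) < 0" by (simp add: algebra_simps)
      then show ?thesis
        using True k linear_pos[OF u(3), of "- w2" k, unfolded mult_minus_left minus_add_distrib[symmetric] neg_0_less_iff_less] 4 u(1)
          m0[of "u1 * k^2 + v1 * k + w1" "u2 * k^2 + v2 * k + w2"]
        unfolding sec by (simp add: K_def)
    next
      case False
      then have "c * c * (- k) + - (c * d) > 0" using linear_pos[OF c2, of "- (c * d)" "- k"] k by (simp add: K_def)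
      then have "c * (d + k * c) < 0" by (simp add: algebra_simps)
      then show ?thesis
        using False k quadratic_pos[OF u(2), of v1 w1 k] linear_pos[OF u(3), of w2 "- k"] 4 u(1)
          m1[of "u1 * k^2 + v1 * k + w1" "u2 * k^2 + v2 * k + w2"]
        unfolding sec by (simp add: K_def)
    qed
    then show ?thesis by blast
  qed
qed

text \<open>The inequalities say -1 <= b / a < 0. This picks one upper triangular matrix from each
  orbit under right multiplication by powers of T, with both signs of the diagonal, namely the one
  at which the step function in \<open>cusplim\<close> jumps.\<close>

definition upper_reps :: "int \<Rightarrow> imat set" where
  "upper_reps p = {(a, b, c, d). a * d = p \<and> c = 0 \<and> - (a * a) \<le> a * b \<and> a * b < 0}"

lemma finite_upper_reps:
  assumes "p > 0"
  shows "finite (upper_reps p)"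
proof -
  have "upper_reps p \<subseteq> {-p..p} \<times> {-p..p} \<times> {0} \<times> {-p..p}"
  proof
    fix M assume "M \<in> upper_reps p"
    moreover obtain a b c d where M: "M = (a, b, c, d)" by (cases M)
    ultimately have ad: "a * d = p" and ab: "- (a * a) \<le> a * b" "a * b < 0" and c: "c = 0"
      by (auto simp: upper_reps_def)
    have "a \<noteq> 0" "d \<noteq> 0" using ad assms by auto
    then have "\<bar>a\<bar> \<le> \<bar>p\<bar>" "\<bar>d\<bar> \<le> \<bar>p\<bar>"
      using abs_le_mult[of d a] abs_le_mult[of a d] ad by (simp_all add: mult.commute)
    then have "\<bar>a\<bar> \<le> p" "\<bar>d\<bar> \<le> p" using assms by auto
    moreover have "\<bar>a\<bar> * \<bar>b\<bar> \<le> \<bar>a\<bar> * \<bar>a\<bar>" using ab by (simp add: abs_mult[symmetric])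
    then have "\<bar>b\<bar> \<le> \<bar>a\<bar>" using \<open>a \<noteq> 0\<close> by (metis mult_le_cancel_left_pos zero_less_abs_iff)
    ultimately show "M \<in> {-p..p} \<times> {-p..p} \<times> {0} \<times> {-p..p}" using c M by auto
  qed
  then show ?thesis by (rule finite_subset) simp
qed

lemma upper_reps_det: "upper_reps p \<subseteq> det_mats p"
  by (auto simp: upper_reps_def det_mats_def)

lemma cusplim_diff:
  assumes "M \<in> det_mats p" "p > 0"
  shows "cusplim M - cusplim (Tr M) = of_bool (M \<in> Sl ` upper_reps p) - of_bool (M \<in> upper_reps p)"
proof -
  obtain a b c d where M: "M = (a, b, c, d)" by (cases M)
  have det: "a * d - b * c = p" using assms(1) by (simp add: M det_mats_def)
  have Sl_iff: "M \<in> Sl ` upper_reps p \<longleftrightarrow> a = 0 \<and> - (c * c) \<le> c * d \<and> c * d < 0"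
  proof
    assume "a = 0 \<and> - (c * c) \<le> c * d \<and> c * d < 0"
    then have "(c, d, - a, - b) \<in> upper_reps p" "Sl (c, d, - a, - b) = M"
      using det by (auto simp: upper_reps_def M mult.commute)
    then show "M \<in> Sl ` upper_reps p" by (metis imageI)
  qed (auto simp: M upper_reps_def)
  have up_iff: "M \<in> upper_reps p \<longleftrightarrow> c = 0 \<and> - (a * a) \<le> a * b \<and> a * b < 0"
    using det by (auto simp: upper_reps_def M)
  have nz: "\<not> (a = 0 \<and> c = 0)" using det assms(2) by auto
  have "a \<noteq> 0 \<Longrightarrow> 0 < a * a" "c \<noteq> 0 \<Longrightarrow> 0 < c * c" by (auto simp: zero_less_mult_iff)
  then show ?thesis
    unfolding Sl_iff up_iff using nz
    by (cases "a = 0"; cases "c = 0") (auto simp: M distrib_left)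
qed

definition cusp_count :: "int \<Rightarrow> int \<Rightarrow> (int \<times> int) set \<Rightarrow> int \<times> int \<Rightarrow> real" where
  "cusp_count p l X y = (\<Sum>M\<in>upper_reps p. \<Sum>x\<in>X. of_bool (veq (app l M x) y))"

text \<open>Since c(M) - c(M S) = g(M rho) - g(M T rho) and the number of x in X with l M x = y up
  to sign depends only on the orbit of M under T, the sum telescopes. The terms g(M rho) have
  infinite support, so their limits at the cusps are subtracted first; the jumps of these limits
  give the right side.\<close>

lemma kern_cusp_sum:
  assumes p: "p > 0" and fin: "finite X" and bij: "bij_betw f X X" "\<And>x. x \<in> X \<Longrightarrow> veq (Tv x) (f x)"
  shows "(\<Sum>x\<in>X. kern p l x y - kern p l (Sv x) y) = cusp_count p l X (Sv y) - cusp_count p l X y"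
proof -
  define \<theta> where "\<theta> = cusp_count p l X"
  note \<theta>_def = \<theta>_def[unfolded cusp_count_def fun_eq_iff, rule_format]
  define G where "G = sector (1, -1, 1)"
  define n where "n = (\<lambda>y M. \<Sum>x\<in>X. of_bool (veq (app l M x) y) :: real)"
  define Y where "Y = (\<lambda>M. G M - cusplim M)"
  let ?A = "det_mats p"
  have nT: "n y (Tr M) = n y M" for M
  proof -
    have "n y (Tr M) = (\<Sum>x\<in>X. of_bool (veq (app l M (f x)) y))"
      unfolding n_def app_Tr[symmetric]
      by (intro sum.cong refl arg_cong[where f = of_bool] veq_cong_left veq_app bij(2))
    then show ?thesis
      using sum.reindex_bij_betw[OF bij(1), of "\<lambda>x. of_bool (veq (app l M x) y) :: real"] by (simp add: n_def)
  qed
  have d: "coefw M - coefw (Sr M) = G M - G (Tr M)" for M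
    by (simp add: coefw_def side_Sr sector_Sr G_def)
  have find: "finite {M \<in> ?A. coefw M - coefw (Sr M) \<noteq> 0}"
    by (rule finite_subset[OF _ finite_UnI[OF finite_coefw_p[OF p] finite_coefw_Sr[OF p]]]) auto
  have "cusplim M - cusplim (Tr M) = 0" if "M \<in> ?A" "M \<notin> Sl ` upper_reps p \<union> upper_reps p" for M
    using cusplim_diff[OF that(1) p] that(2) by simp
  then have "{M \<in> ?A. cusplim M - cusplim (Tr M) \<noteq> 0} \<subseteq> Sl ` upper_reps p \<union> upper_reps p"
    by blast
  then have finL: "finite {M \<in> ?A. cusplim M - cusplim (Tr M) \<noteq> 0}"
    by (rule finite_subset) (simp add: finite_upper_reps[OF p])
  have "finite {M \<in> ?A. Y M - Y (Tr M) \<noteq> 0}"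
    by (rule finite_subset[OF _ finite_UnI[OF find finL]]) (auto simp: Y_def d)
  define s where "s = (\<lambda>(a, b, c, d). (a, b - a, c, d - c) :: imat)"
  have Tk: "(Tr ^^ k) (a, b, c, d) = (a, b + int k * a, c, d + int k * c)"
    "(s ^^ k) (a, b, c, d) = (a, b + (- int k) * a, c, d + (- int k) * c)" for k a b c d
    by (induction k) (auto simp: s_def algebra_simps)
  have ev: "(\<exists>K. \<forall>k\<ge>K. Y ((Tr ^^ k) M) = 0) \<and> (\<exists>K. \<forall>k\<ge>K. Y ((s ^^ k) M) = 0)" if M: "M \<in> ?A" for M
  proof -
    obtain a b c d where Meq: "M = (a, b, c, d)" by (cases M)
    obtain K where K: "\<And>k. \<bar>k\<bar> \<ge> K \<Longrightarrow> sector (1, -1, 1) (a, b + k * a, c, d + k * c) = cusplim (a, b + k * a, c, d + k * c)"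
      using sector_eventually[OF M[unfolded Meq] p] by blast
    have "Y ((Tr ^^ k) M) = 0" "Y ((s ^^ k) M) = 0" if "k \<ge> nat K" for k
      using K[of "int k"] K[of "- int k"] that unfolding Y_def G_def Meq Tk by auto
    then show ?thesis by blast
  qed
  have finY: "finite {M \<in> ?A. Y M \<noteq> 0}"
  proof (rule telescope_finite[of ?A Tr s])
    show "finite {M \<in> ?A. Y M - Y (Tr M) \<noteq> 0}" by fact
    show "Tr M \<in> ?A" if "M \<in> ?A" for M using that bij_betwE[OF bij_Tr] by blast
    show "s (Tr M) = M" for M by (cases M) (simp add: s_def)
  qed (use ev in auto)
  have "(\<Sum>x\<in>X. kern p l x y - kern p l (Sv x) y)
      = (\<Sum>x\<in>X. sum' (\<lambda>M. (coefw M - coefw (Sr M)) * of_bool (veq (app l M x) y)) ?A)"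
  proof (rule sum.cong[OF refl])
    fix x
    show "kern p l x y - kern p l (Sv x) y = sum' (\<lambda>M. (coefw M - coefw (Sr M)) * of_bool (veq (app l M x) y)) ?A"
      unfolding kern_Sv_left unfolding kern_def left_diff_distrib
      by (rule sum'_diff[symmetric]) (intro finite_mult_supp finite_coefw_p[OF p] finite_coefw_Sr[OF p])+
  qed
  also have "\<dots> = sum' (\<lambda>M. \<Sum>x\<in>X. (coefw M - coefw (Sr M)) * of_bool (veq (app l M x) y)) ?A"
    by (rule sum_sum'_swap(1)[OF fin finite_mult_supp[OF find]])
  \<comment> \<open>The first difference has two finitely supported halves that cancel after
    reindexing by T; the second is supported on \<open>upper_reps p\<close> and its image under
    S.\<close>
  also have "\<dots> = sum' (\<lambda>M. (Y M * n y M - Y (Tr M) * n y (Tr M)) + (cusplim M - cusplim (Tr M)) * n y M) ?A"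
  proof (rule sum.cong'[OF refl])
    fix M
    have "(\<Sum>x\<in>X. (coefw M - coefw (Sr M)) * of_bool (veq (app l M x) y)) = (G M - G (Tr M)) * n y M"
      by (simp only: d n_def sum_distrib_left)
    then show "(\<Sum>x\<in>X. (coefw M - coefw (Sr M)) * of_bool (veq (app l M x) y))
        = (Y M * n y M - Y (Tr M) * n y (Tr M)) + (cusplim M - cusplim (Tr M)) * n y M"
      by (simp add: nT Y_def algebra_simps)
  qed
  also have "\<dots> = sum' (\<lambda>M. Y M * n y M - Y (Tr M) * n y (Tr M)) ?A
      + sum' (\<lambda>M. (cusplim M - cusplim (Tr M)) * n y M) ?A"
  proof (rule sum.distrib')
    show "finite {M \<in> ?A. Y M * n y M - Y (Tr M) * n y (Tr M) \<noteq> 0}"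
      by (rule finite_subset[OF _ finite_UnI[OF finY finite_supp_reindex[OF bij_Tr finY]]]) auto
  qed (rule finite_mult_supp[OF finL])
  also have "sum' (\<lambda>M. Y M * n y M - Y (Tr M) * n y (Tr M)) ?A = 0"
    using sum'_diff[OF finite_mult_supp[OF finY, of "n y"] finite_supp_reindex[OF bij_Tr finite_mult_supp[OF finY, of "n y"]]]
      sum'_reindex[OF bij_Tr, of "\<lambda>M. Y M * n y M" p] by simp
  also have "sum' (\<lambda>M. (cusplim M - cusplim (Tr M)) * n y M) ?A
      = sum' (\<lambda>M. of_bool (M \<in> Sl ` upper_reps p) * n y M - of_bool (M \<in> upper_reps p) * n y M) ?A"
    by (rule sum.cong'[OF refl]) (simp add: cusplim_diff[OF _ p] algebra_simps)
  also have "\<dots> = sum' (\<lambda>M. of_bool (M \<in> Sl ` upper_reps p) * n y M) ?A - sum' (\<lambda>M. of_bool (M \<in> upper_reps p) * n y M) ?A"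
    by (rule sum'_diff; rule finite_subset[of _ "Sl ` upper_reps p \<union> upper_reps p"])
       (auto simp: finite_upper_reps[OF p])
  also have "sum' (\<lambda>M. of_bool (M \<in> upper_reps p) * n y M) ?A = (\<Sum>M\<in>upper_reps p. of_bool (M \<in> upper_reps p) * n y M)"
    by (rule sum'_eq_sum[OF finite_upper_reps[OF p] upper_reps_det]) simp
  also have "\<dots> = \<theta> y" by (simp add: \<theta>_def n_def)
  also have "sum' (\<lambda>M. of_bool (M \<in> Sl ` upper_reps p) * n y M) ?A
      = (\<Sum>M\<in>Sl ` upper_reps p. of_bool (M \<in> Sl ` upper_reps p) * n y M)"
  proof (rule sum'_eq_sum)
    show "Sl ` upper_reps p \<subseteq> ?A" using upper_reps_det[of p] bij_betwE[OF bij_Sl, of p] by blast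
  qed (auto simp: finite_upper_reps[OF p])
  also have "\<dots> = (\<Sum>M\<in>upper_reps p. n y (Sl M))"
    by (subst sum.reindex) (auto simp: inj_on_def)
  also have "\<dots> = \<theta> (Sv y)"
  proof -
    have "veq (app l (Sl M) x) y \<longleftrightarrow> veq (app l M x) (Sv y)" for M x
      using veq_Sv[of "Sv (app l M x)" y] veq_cong_left[OF veq_Sv_Sv[of "app l M x"], of "Sv y"]
      by (simp add: app_Sl)
    then show ?thesis by (simp add: \<theta>_def n_def)
  qed
  finally show ?thesis by (simp add: \<theta>_def cusp_count_def)
qed

subsection \<open>The genus zero certificate\<close>

text \<open>The indices enumerate (F_7^2 - 0)/{1, -1} as in \<open>vec\<close> below; \<open>sP\<close> and \<open>uP\<close> are the actions of S and U, and
  \<open>cuspP\<close> numbers the T-orbits. The tables solve the linear system that expresses the identity matrix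
  through the relations satisfied by the Hecke kernel; a solution exists because X_1(7) has genus 0.\<close>

definition sP :: "nat \<Rightarrow> nat" where
  "sP i = [3, 10, 17, 0, 9, 16, 23, 18, 11, 4, 1, 8, 15, 22, 19, 12, 5, 2, 7, 14, 21, 20, 13, 6] ! i"
definition uP :: "nat \<Rightarrow> nat" where
  "uP i = [3, 10, 17, 9, 16, 23, 18, 11, 4, 0, 15, 22, 19, 12, 5, 1, 8, 21, 20, 13, 6, 2, 7, 14] ! i"
definition cuspP :: "nat \<Rightarrow> nat" where
  "cuspP i = [0, 1, 2, 3, 3, 3, 3, 3, 3, 3, 4, 4, 4, 4, 4, 4, 4, 5, 5, 5, 5, 5, 5, 5] ! i"
definition sClass :: "nat \<Rightarrow> nat" where
  "sClass i = [0, 1, 2, 0, 3, 4, 5, 6, 7, 3, 1, 7, 8, 9, 10, 8, 4, 2, 6, 10, 11, 11, 9, 5] ! i"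
definition uClass :: "nat \<Rightarrow> nat" where
  "uClass i = [0, 1, 2, 0, 3, 4, 5, 6, 3, 0, 1, 6, 7, 7, 4, 1, 3, 2, 5, 7, 5, 2, 6, 4] ! i"
definition tabP :: "nat \<Rightarrow> nat \<Rightarrow> int" where
  "tabP i j = [
    [0,0,0,0,0,0,0,0,0,0,0,0],
    [0,0,0,0,0,0,0,0,0,0,0,0],
    [0,0,0,0,0,0,0,0,0,0,0,0],
    [1,0,0,0,0,0,0,0,0,0,0,0],
    [0,-1,-1,0,-1,-1,-1,-1,-1,-1,-1,-1],
    [-1,-1,-1,-1,-1,-1,-1,-1,-1,-1,-1,-1],
    [0,0,0,0,0,0,0,0,0,0,0,0],
    [0,0,1,0,0,0,1,0,0,0,0,1],
    [-1,0,0,-1,-1,0,0,0,0,0,0,0],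
    [0,1,1,1,1,1,1,1,1,1,1,1],
    [0,1,0,0,0,0,0,0,0,0,0,0],
    [1,0,0,1,1,0,0,1,0,0,0,0],
    [0,1,0,0,0,0,0,0,1,0,0,0],
    [1,0,1,1,1,0,1,1,0,1,0,1],
    [1,1,1,1,1,0,1,1,1,1,1,1],
    [0,-1,0,0,0,0,0,0,0,0,0,0],
    [1,1,1,1,2,1,1,1,1,1,1,1],
    [0,0,1,0,0,0,0,0,0,0,0,0],
    [0,0,-1,0,0,0,0,0,0,0,0,-1],
    [-1,-1,-1,-1,-1,0,-1,-1,-1,-1,0,-1],
    [0,0,1,0,0,0,0,0,0,0,0,1],
    [0,0,-1,0,0,0,0,0,0,0,0,0],
    [-1,0,-1,-1,-1,0,-1,-1,0,0,0,-1],
    [0,0,0,0,0,1,0,0,0,0,0,0]] ! i ! sClass j"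
definition tabQ :: "nat \<Rightarrow> nat \<Rightarrow> int" where
  "tabQ i j = [
    [0,0,0,0,0,0,0,0],
    [0,0,0,0,0,0,0,0],
    [0,0,0,0,0,0,0,0],
    [0,0,0,0,0,0,0,0],
    [0,1,1,1,1,1,1,1],
    [1,1,1,1,1,1,1,1],
    [0,0,0,0,0,0,0,0],
    [0,0,-1,0,0,-1,0,0],
    [1,0,0,1,0,0,0,0],
    [0,-1,-1,-1,-1,-1,-1,-1],
    [0,0,0,0,0,0,0,0],
    [-1,0,0,-1,0,0,0,0],
    [0,-1,0,0,0,0,0,0],
    [-1,0,-1,-1,0,-1,-1,0],
    [-1,-1,-1,-1,0,-1,-1,-1],
    [0,1,0,0,0,0,0,0],
    [-1,-1,-1,-1,-1,-1,-1,-1],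
    [0,0,0,0,0,0,0,0],
    [0,0,1,0,0,1,0,0],
    [1,1,1,1,0,1,1,1],
    [0,0,-1,0,0,0,0,0],
    [0,0,1,0,0,0,0,0],
    [1,0,1,1,0,1,1,0],
    [0,0,0,0,0,0,0,0]] ! i ! uClass j"
text \<open>The vector y is read as an edge from its cusp to the cusp of S y. Row i lists, with
  signs, the edges of a path from cusp i to cusp 5, for instance 1 -> 4 -> 3 -> 5 through the edges
  1, 5 (reversed) and 6.\<close>

definition tabR :: "nat \<Rightarrow> nat \<Rightarrow> int" where
  "tabR i j = (if j = 0 then [1, 0, 0, 0, 0, 0] else if j = 1 then [0, 1, 0, 0, 0, 0]
     else if j = 2 then [0, 0, 1, 0, 0, 0] else if j = 5 then [0, -1, 0, 0, -1, 0]
     else if j = 6 then [1, 1, 0, 1, 1, 0] else [0, 0, 0, 0, 0, 0]) ! i"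

definition all24 :: "(nat \<Rightarrow> bool) \<Rightarrow> bool" where
  "all24 P \<longleftrightarrow> list_all P [0, 1, 2, 3, 4, 5, 6, 7, 8, 9, 10, 11, 12, 13, 14, 15, 16, 17, 18, 19, 20, 21, 22, 23]"

lemma all24: "all24 P \<Longrightarrow> i < 24 \<Longrightarrow> P i"
  by (auto simp: all24_def less_Suc_eq numeral_eq_Suc)

lemma perm_tables:
  "all24 (\<lambda>i. sP i < 24 \<and> uP i < 24 \<and> cuspP i < 6 \<and> sP (sP i) = i \<and> uP (uP (uP i)) = i
     \<and> sClass (sP i) = sClass i \<and> uClass (uP i) = uClass i)"
  by code_simp

text \<open>The right side cannot be 0 throughout: summed over i, the identity in
  \<open>cert_sum\<close> has column sums 1, while the \<open>tabQ\<close> and \<open>tabR\<close>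
  parts sum to 0. One U-orbit carries the missing constants.\<close>

lemma cert_P: "all24 (\<lambda>i. all24 (\<lambda>j. tabP i j + tabP (uP i) j + tabP (uP (uP i)) j = (if uClass i = 0 then 1 else 0)))"
  by code_simp

lemma cert_Q: "all24 (\<lambda>i. all24 (\<lambda>j. tabQ i j + tabQ (sP i) j = 0))"
  by code_simp

lemma cert_sum: "all24 (\<lambda>i. all24 (\<lambda>j. tabP i j + tabQ i j + tabR (cuspP i) j - tabR (cuspP (sP i)) j = (if i = j then 1 else 0)))"
  by code_simp

lemma sum_perm3:
  fixes f :: "nat \<Rightarrow> real"
  assumes "\<And>i. i < n \<Longrightarrow> \<pi> i < n" "\<And>i. i < n \<Longrightarrow> \<pi> (\<pi> (\<pi> i)) = i"
  shows "(\<Sum>i<n. f (\<pi> i)) = (\<Sum>i<n. f i)"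
  by (rule sum.reindex_bij_witness[where i = "\<lambda>i. \<pi> (\<pi> i)" and j = \<pi>]) (use assms in auto)

lemma sum_perm2:
  fixes f :: "nat \<Rightarrow> real"
  assumes "\<And>i. i < n \<Longrightarrow> \<pi> i < n" "\<And>i. i < n \<Longrightarrow> \<pi> (\<pi> i) = i"
  shows "(\<Sum>i<n. f (\<pi> i)) = (\<Sum>i<n. f i)"
  by (rule sum.reindex_bij_witness[where i = \<pi> and j = \<pi>]) (use assms in auto)

lemma perm_facts:
  assumes "i < 24"
  shows "sP i < 24" "uP i < 24" "cuspP i < 6" "sP (sP i) = i" "uP (uP (uP i)) = i"
    "sClass (sP i) = sClass i" "uClass (uP i) = uClass i"
  using all24[OF perm_tables assms] by auto

lemma tabP_sP: "j < 24 \<Longrightarrow> tabP i (sP j) = tabP i j"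
  and tabQ_uP: "j < 24 \<Longrightarrow> tabQ i (uP j) = tabQ i j"
  by (simp_all add: tabP_def tabQ_def perm_facts)

lemma sum_sym2:
  fixes f g :: "nat \<Rightarrow> real"
  assumes "\<And>i. i < 24 \<Longrightarrow> g (sP i) = g i"
  shows "2 * (\<Sum>i<24. f i * g i) = (\<Sum>i<24. (f i + f (sP i)) * g i)"
proof -
  have "(\<Sum>i<24. f i * g i) = (\<Sum>i<24. f (sP i) * g (sP i))"
    using sum_perm2[of 24 sP "\<lambda>i. f i * g i"] perm_facts by simp
  also have "\<dots> = (\<Sum>i<24. f (sP i) * g i)" using assms by simp
  finally show ?thesis by (simp add: distrib_right sum.distrib)
qed

lemma sum_sym3:
  fixes f g :: "nat \<Rightarrow> real"
  assumes "\<And>i. i < 24 \<Longrightarrow> g (uP i) = g i"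
  shows "3 * (\<Sum>i<24. f i * g i) = (\<Sum>i<24. (f i + f (uP i) + f (uP (uP i))) * g i)"
proof -
  have 1: "(\<Sum>i<24. h i * g i) = (\<Sum>i<24. h (uP i) * g i)" for h
  proof -
    have "(\<Sum>i<24. h i * g i) = (\<Sum>i<24. h (uP i) * g (uP i))"
      using sum_perm3[of 24 uP "\<lambda>i. h i * g i"] perm_facts by simp
    then show ?thesis using assms by simp
  qed
  show ?thesis using 1[of f] 1[of "\<lambda>i. f (uP i)"] by (simp add: distrib_right sum.distrib)
qed

text \<open>\<open>cert_sum\<close> splits the trace into three parts. In the first,
  \<open>tabP\<close> is S-invariant in y, so K may be averaged over S there; R1 then allows
  averaging over U in x, where \<open>cert_P\<close> applies and only row sums remain. The second
  part vanishes in the same way with S and U exchanged, by R2 and \<open>cert_Q\<close>. The third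
  is evaluated by R3.\<close>

lemma trace_from_relations:
  fixes K :: "nat \<Rightarrow> nat \<Rightarrow> real" and t :: "nat \<Rightarrow> nat \<Rightarrow> real"
  assumes R1: "\<And>x y. x < 24 \<Longrightarrow> y < 24 \<Longrightarrow> K (uP x) y + K (uP x) (sP y) = K x y + K x (sP y)"
    and R2: "\<And>x y. x < 24 \<Longrightarrow> y < 24 \<Longrightarrow> K (sP x) y + K (sP x) (uP y) + K (sP x) (uP (uP y))
        = K x y + K x (uP y) + K x (uP (uP y))"
    and R3: "\<And>j y. j < 6 \<Longrightarrow> y < 24 \<Longrightarrow> (\<Sum>x<24. if cuspP x = j then K x y - K (sP x) y else 0)
        = t j (cuspP (sP y)) - t j (cuspP y)"
    and D: "\<And>x. x < 24 \<Longrightarrow> (\<Sum>y<24. K x y) = D"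
    and col: "(\<Sum>j<6. t j 5) = D"
  shows "(\<Sum>x<24. K x x) = 2 * D - (\<Sum>j<6. t j j)"
proof -
  note pf = perm_facts
  have "K x x = (\<Sum>y<24. K x y * tabP x y + K x y * tabQ x y + K x y * (tabR (cuspP x) y - tabR (cuspP (sP x)) y))"
    if x: "x < 24" for x
  proof -
    have "real_of_int (tabP x y) + tabQ x y + (tabR (cuspP x) y - tabR (cuspP (sP x)) y) = of_bool (x = y)"
      if "y < 24" for y
      using all24[OF all24[OF cert_sum x] that] by (simp flip: of_int_add of_int_diff split: if_splits)
    then have "(\<Sum>y<24. K x y * tabP x y + K x y * tabQ x y + K x y * (tabR (cuspP x) y - tabR (cuspP (sP x)) y))
        = (\<Sum>y<24. K x y * of_bool (x = y))"
      by (intro sum.cong refl) (simp flip: distrib_left)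
    also have "\<dots> = K x x" using x by (simp add: of_bool_def if_distrib cong: if_cong)
    finally show ?thesis by simp
  qed
  then have "(\<Sum>x<24. K x x) = (\<Sum>x<24. \<Sum>y<24. K x y * tabP x y) + (\<Sum>x<24. \<Sum>y<24. K x y * tabQ x y)
      + (\<Sum>x<24. \<Sum>y<24. K x y * (tabR (cuspP x) y - tabR (cuspP (sP x)) y))"
    by (simp add: sum.distrib)
  moreover have "(\<Sum>x<24. \<Sum>y<24. K x y * tabP x y) = D"
  proof -
    let ?G = "\<lambda>x y. K x y + K x (sP y)"
    \<comment> \<open>The factor 6 clears the averages over S in y and over U in x.\<close>
    have "6 * (\<Sum>x<24. \<Sum>y<24. K x y * tabP x y) = 3 * (\<Sum>x<24. 2 * (\<Sum>y<24. K x y * tabP x y))"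
      by (simp flip: sum_distrib_left)
    also have "\<dots> = 3 * (\<Sum>x<24. \<Sum>y<24. ?G x y * tabP x y)"
      by (subst sum_sym2) (simp_all add: tabP_sP)
    also have "\<dots> = 3 * (\<Sum>y<24. \<Sum>x<24. tabP x y * ?G x y)"
      by (subst sum.swap) (simp only: mult.commute)
    also have "\<dots> = (\<Sum>y<24. 3 * (\<Sum>x<24. tabP x y * ?G x y))"
      by (simp only: sum_distrib_left[symmetric])
    also have "\<dots> = (\<Sum>y<24. \<Sum>x<24. (real_of_int (tabP x y) + tabP (uP x) y + tabP (uP (uP x)) y) * ?G x y)"
      by (intro sum.cong refl sum_sym3) (simp add: R1)
    also have "\<dots> = (\<Sum>y<24. \<Sum>x<24. of_bool (uClass x = 0) * (K x y + K x (sP y)))"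
    proof (intro sum.cong refl)
      fix x y :: nat assume "x \<in> {..<24}" "y \<in> {..<24}"
      then have "tabP x y + tabP (uP x) y + tabP (uP (uP x)) y = of_bool (uClass x = 0)"
        using all24[OF all24[OF cert_P, of x], of y] by simp
      then have "real_of_int (tabP x y) + tabP (uP x) y + tabP (uP (uP x)) y = of_bool (uClass x = 0)"
        by (metis of_int_add of_int_of_bool)
      then show "(real_of_int (tabP x y) + tabP (uP x) y + tabP (uP (uP x)) y) * (K x y + K x (sP y))
          = of_bool (uClass x = 0) * (K x y + K x (sP y))" by simp
    qed
    also have "\<dots> = (\<Sum>x<24. of_bool (uClass x = 0) * (\<Sum>y<24. K x y + K x (sP y)))"
      by (subst sum.swap) (simp add: sum_distrib_left)
    also have "\<dots> = (\<Sum>x<24. of_bool (uClass x = 0) * (2 * D))"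
    proof (intro sum.cong refl)
      fix x :: nat assume "x \<in> {..<24}"
      then show "of_bool (uClass x = 0) * (\<Sum>y<24. K x y + K x (sP y)) = of_bool (uClass x = 0) * (2 * D)"
        using D[of x] sum_perm2[of 24 sP "K x"] pf by (simp add: sum.distrib)
    qed
    \<comment> \<open>The distinguished U-orbit has three elements, each contributing 2 D.\<close>
    also have "\<dots> = 6 * D" by (simp add: uClass_def lessThan_nat_numeral lessThan_Suc numeral_eq_Suc)
    finally show ?thesis by simp
  qed
  moreover have "(\<Sum>x<24. \<Sum>y<24. K x y * tabQ x y) = 0"
  proof -
    let ?G = "\<lambda>x y. K x y + K x (uP y) + K x (uP (uP y))"
    have "6 * (\<Sum>x<24. \<Sum>y<24. K x y * tabQ x y) = 2 * (\<Sum>x<24. 3 * (\<Sum>y<24. K x y * tabQ x y))"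
      by (simp flip: sum_distrib_left)
    also have "\<dots> = 2 * (\<Sum>x<24. \<Sum>y<24. ?G x y * tabQ x y)"
      by (subst sum_sym3) (simp_all add: tabQ_uP)
    also have "\<dots> = 2 * (\<Sum>y<24. \<Sum>x<24. tabQ x y * ?G x y)"
      by (subst sum.swap) (simp only: mult.commute)
    also have "\<dots> = (\<Sum>y<24. 2 * (\<Sum>x<24. tabQ x y * ?G x y))"
      by (simp only: sum_distrib_left[symmetric])
    also have "\<dots> = (\<Sum>y<24. \<Sum>x<24. (real_of_int (tabQ x y) + tabQ (sP x) y) * ?G x y)"
      by (intro sum.cong refl sum_sym2) (simp add: R2)
    also have "\<dots> = 0"
    proof (intro sum.neutral ballI)
      fix x y :: nat assume "x \<in> {..<24}" "y \<in> {..<24}"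
      then have "tabQ x y + tabQ (sP x) y = 0"
        using all24[OF all24[OF cert_Q, of x], of y] by simp
      then have "real_of_int (tabQ x y) + tabQ (sP x) y = 0" by (metis of_int_add of_int_0)
      then show "(real_of_int (tabQ x y) + tabQ (sP x) y) * (K x y + K x (uP y) + K x (uP (uP y))) = 0" by simp
    qed
    finally show ?thesis by simp
  qed
  moreover have "(\<Sum>x<24. \<Sum>y<24. K x y * (tabR (cuspP x) y - tabR (cuspP (sP x)) y)) = D - (\<Sum>j<6. t j j)"
  proof -
    define m where "m = (\<lambda>j y. \<Sum>x<24. if cuspP x = j then K x y - K (sP x) y else 0)"
    have "(\<Sum>x<24. \<Sum>y<24. K x y * (tabR (cuspP x) y - tabR (cuspP (sP x)) y))
        = (\<Sum>y<24. \<Sum>x<24. K x y * tabR (cuspP x) y - K x y * tabR (cuspP (sP x)) y)"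
      by (subst sum.swap) (simp add: right_diff_distrib)
    also have "\<dots> = (\<Sum>y<24. \<Sum>x<24. (K x y - K (sP x) y) * tabR (cuspP x) y)"
    proof (rule sum.cong[OF refl])
      fix y
      have "(\<Sum>x<24. K x y * tabR (cuspP (sP x)) y) = (\<Sum>x<24. K (sP x) y * tabR (cuspP (sP (sP x))) y)"
        using sum_perm2[of 24 sP "\<lambda>x. K x y * tabR (cuspP (sP x)) y"] pf by simp
      also have "\<dots> = (\<Sum>x<24. K (sP x) y * tabR (cuspP x) y)" using pf by simp
      finally show "(\<Sum>x<24. K x y * tabR (cuspP x) y - K x y * tabR (cuspP (sP x)) y)
          = (\<Sum>x<24. (K x y - K (sP x) y) * tabR (cuspP x) y)"
        by (simp add: sum_subtractf left_diff_distrib)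
    qed
    also have "\<dots> = (\<Sum>y<24. \<Sum>j<6. m j y * tabR j y)"
    proof (rule sum.cong[OF refl])
      fix y
      have "(\<Sum>x<24. (K x y - K (sP x) y) * tabR (cuspP x) y)
          = (\<Sum>x<24. \<Sum>j<6. if cuspP x = j then (K x y - K (sP x) y) * tabR j y else 0)"
        using pf by (intro sum.cong refl) simp
      also have "\<dots> = (\<Sum>j<6. \<Sum>x<24. if cuspP x = j then (K x y - K (sP x) y) * tabR j y else 0)"
        by (rule sum.swap)
      also have "\<dots> = (\<Sum>j<6. m j y * tabR j y)"
        unfolding m_def sum_distrib_right by (intro sum.cong refl) simp
      finally show "(\<Sum>x<24. (K x y - K (sP x) y) * tabR (cuspP x) y) = (\<Sum>j<6. m j y * tabR j y)" .
    qed
    also have "\<dots> = (\<Sum>y<24. \<Sum>j<6. (t j (cuspP (sP y)) - t j (cuspP y)) * tabR j y)"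
      using R3 by (intro sum.cong refl) (simp add: m_def)
    \<comment> \<open>Along the path of \<open>tabR\<close> from cusp j to cusp 5 the differences of
      t j collapse to t j 5 - t j j; for j = 5 the path is empty.\<close>
    also have "\<dots> = t 0 5 + t 1 5 + t 2 5 + t 3 5 + t 4 5 - t 0 0 - t 1 1 - t 2 2 - t 3 3 - t 4 4"
      by (simp add: lessThan_nat_numeral lessThan_Suc numeral_eq_Suc cuspP_def sP_def tabR_def)
    also have "\<dots> = D - (\<Sum>j<6. t j j)"
      using col by (simp add: lessThan_nat_numeral lessThan_Suc numeral_eq_Suc)
    finally show ?thesis .
  qed
  ultimately show ?thesis by simp
qed

subsection \<open>Fixed points and cusps modulo 7\<close>

definition vec :: "nat \<Rightarrow> int \<times> int" where
  "vec i = [(1, 0), (2, 0), (3, 0),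
    (0, 1), (1, 1), (2, 1), (3, 1), (4, 1), (5, 1), (6, 1),
    (0, 2), (1, 2), (2, 2), (3, 2), (4, 2), (5, 2), (6, 2),
    (0, 3), (1, 3), (2, 3), (3, 3), (4, 3), (5, 3), (6, 3)] ! i"

definition pmcong :: "int \<Rightarrow> int \<Rightarrow> bool" where
  "pmcong s t \<longleftrightarrow> [s = t] (mod 7) \<or> [s = - t] (mod 7)"

lemma veq_code:
  "veq v w \<longleftrightarrow> (fst v mod 7 = fst w mod 7 \<and> snd v mod 7 = snd w mod 7)
    \<or> (fst v mod 7 = (- fst w) mod 7 \<and> snd v mod 7 = (- snd w) mod 7)"
  by (simp add: veq_def cong_def)

lemma vec_tables: "all24 (\<lambda>i. veq (Sv (vec i)) (vec (sP i)) \<and> veq (Uv (vec i)) (vec (uP i))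
    \<and> (if cuspP i < 3 then vec i = (int (cuspP i) + 1, 0) else snd (vec i) = int (cuspP i) - 2))"
  unfolding veq_code by code_simp

lemma vec_facts:
  assumes "i < 24"
  shows "veq (Sv (vec i)) (vec (sP i))" "veq (Uv (vec i)) (vec (uP i))"
    "cuspP i < 3 \<Longrightarrow> vec i = (int (cuspP i) + 1, 0)" "\<not> cuspP i < 3 \<Longrightarrow> snd (vec i) = int (cuspP i) - 2"
  using all24[OF vec_tables assms] by (auto split: if_splits)

abbreviation res7 :: "int list" where
  "res7 \<equiv> [0, 1, 2, 3, 4, 5, 6]"

lemma mod7_cases: "x mod 7 \<in> set res7" for x :: int
proof -
  have "0 \<le> x mod 7" "x mod 7 < 7" by simp_all
  then show ?thesis by auto
qed

lemma vec_unique_table: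
  "\<forall>a\<in>set res7. \<forall>b\<in>set res7. a = 0 \<and> b = 0 \<or>
    length (filter (\<lambda>i. veq (a, b) (vec i)) [0..<24]) = 1"
  unfolding veq_code by code_simp

lemma line_count_table:
  "\<forall>a\<in>set res7. \<forall>b\<in>set res7. a = 0 \<and> b = 0 \<or>
    length (filter (\<lambda>i. (a * fst (vec i) + b * snd (vec i)) mod 7 = 0) [0..<24]) = 3"
  by code_simp

lemma sum_of_bool_filter: "(\<Sum>i<n. of_bool (P i)) = real (length (filter P [0..<n]))"
proof -
  have "(\<Sum>i<n. of_bool (P i)) = real (card {i \<in> {..<n}. P i})"
    by (simp add: of_bool_def sum.If_cases Int_def)
  also have "card {i \<in> {..<n}. P i} = length (filter P [0..<n])"
    by (simp add: distinct_length_filter lessThan_atLeast0 Int_def conj_commute)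
  finally show ?thesis .
qed

lemma sum_veq_vec:
  assumes "\<not> (7 dvd fst v \<and> 7 dvd snd v)"
  shows "(\<Sum>i<24. of_bool (veq v (vec i))) = (1::real)"
proof -
  have "veq v w = veq (fst v mod 7, snd v mod 7) w" for w by (simp add: veq_code)
  moreover have "\<not> (fst v mod 7 = 0 \<and> snd v mod 7 = 0)" using assms by (simp add: dvd_eq_mod_eq_0)
  ultimately have "length (filter (\<lambda>i. veq v (vec i)) [0..<24]) = 1"
    using bspec[OF bspec[OF vec_unique_table mod7_cases[of "fst v"]] mod7_cases[of "snd v"]] by (simp only: simp_thms)
  then show ?thesis by (simp add: sum_of_bool_filter)
qed

lemma line_count:
  assumes "\<not> (7 dvd a \<and> 7 dvd b)"
  shows "(\<Sum>i<24. of_bool (7 dvd a * fst (vec i) + b * snd (vec i))) = (3::real)"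
proof -
  have eq: "(7 dvd a * x + b * y) = (((a mod 7) * x + (b mod 7) * y) mod 7 = 0)" for x y
  proof -
    have "(a * x + b * y) mod 7 = ((a mod 7) * x + (b mod 7) * y) mod 7"
      by (rule mod_add_cong) (simp_all only: mod_mult_left_eq)
    then show ?thesis by (simp only: dvd_eq_mod_eq_0)
  qed
  have nz: "\<not> (a mod 7 = 0 \<and> b mod 7 = 0)" using assms by (simp add: dvd_eq_mod_eq_0)
  note t1 = bspec[OF line_count_table mod7_cases[of a]]
  note t2 = bspec[OF t1 mod7_cases[of b]]
  have "length (filter (\<lambda>i. ((a mod 7) * fst (vec i) + (b mod 7) * snd (vec i)) mod 7 = 0) [0..<24]) = 3"
    using t2
  proof
    assume "a mod 7 = 0 \<and> b mod 7 = 0"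
    with nz show ?thesis by contradiction
  qed
  then have "real (length (filter (\<lambda>i. ((a mod 7) * fst (vec i) + (b mod 7) * snd (vec i)) mod 7 = 0) [0..<24])) = real 3"
    by (rule arg_cong)
  then show ?thesis by (simp only: sum_of_bool_filter eq of_nat_numeral)
qed

lemma prime7: "prime (7::int)"
  by simp

lemma dvd7_mult: "7 dvd a * b \<longleftrightarrow> 7 dvd a \<or> 7 dvd b" for a b :: int
  using prime_dvd_mult_iff[OF prime7] .

lemma vec_nonzero: "i < 24 \<Longrightarrow> \<not> (7 dvd fst (vec i) \<and> 7 dvd snd (vec i))"
proof -
  have "all24 (\<lambda>i. \<not> (7 dvd fst (vec i) \<and> 7 dvd snd (vec i)))" by code_simp
  then show "i < 24 \<Longrightarrow> ?thesis" by (rule all24)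
qed

text \<open>A nonzero singular matrix over F_7 has a line as kernel: six nonzero vectors, three up
  to sign.\<close>

lemma kernel_count:
  assumes "7 dvd a * d - b * c" "\<not> (7 dvd a \<and> 7 dvd b \<and> 7 dvd c \<and> 7 dvd d)"
  shows "(\<Sum>i<24. of_bool (7 dvd a * fst (vec i) + b * snd (vec i) \<and> 7 dvd c * fst (vec i) + d * snd (vec i))) = (3::real)"
proof -
  have imp: "7 dvd c * x + d * y"
    if "7 dvd a * d - b * c" "\<not> (7 dvd a \<and> 7 dvd b)" "7 dvd a * x + b * y" for a b c d x y :: int
  proof -
    have "a * (c * x + d * y) = c * (a * x + b * y) + (a * d - b * c) * y"
      "b * (c * x + d * y) = d * (a * x + b * y) - (a * d - b * c) * x" by (simp_all add: algebra_simps)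
    then have "7 dvd a * (c * x + d * y)" "7 dvd b * (c * x + d * y)"
      using that(1,3) by (auto intro!: dvd_add dvd_diff dvd_mult dvd_mult2)
    then show ?thesis using that(2) dvd7_mult by blast
  qed
  show ?thesis
  proof (cases "7 dvd a \<and> 7 dvd b")
    case False
    then have "(7 dvd a * x + b * y \<and> 7 dvd c * x + d * y) = (7 dvd a * x + b * y)" for x y
      using imp[OF assms(1)] by blast
    then show ?thesis using line_count[OF False] by simp
  next
    case True
    then have F: "\<not> (7 dvd c \<and> 7 dvd d)" using assms(2) by blast
    have "7 dvd c * b - d * a" using assms(1) by (simp add: mult.commute dvd_diff_commute)
    then have "(7 dvd a * x + b * y \<and> 7 dvd c * x + d * y) = (7 dvd c * x + d * y)" for x y
      using imp[OF _ F] by blast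
    then show ?thesis using line_count[OF F] by simp
  qed
qed

lemma kernel_empty:
  assumes "\<not> 7 dvd a * d - b * c" "i < 24"
  shows "\<not> (7 dvd a * fst (vec i) + b * snd (vec i) \<and> 7 dvd c * fst (vec i) + d * snd (vec i))"
proof
  let ?x = "fst (vec i)" and ?y = "snd (vec i)"
  assume h: "7 dvd a * ?x + b * ?y \<and> 7 dvd c * ?x + d * ?y"
  have "(a * d - b * c) * ?x = d * (a * ?x + b * ?y) - b * (c * ?x + d * ?y)"
    "(a * d - b * c) * ?y = a * (c * ?x + d * ?y) - c * (a * ?x + b * ?y)" by (simp_all add: algebra_simps)
  then have "7 dvd (a * d - b * c) * ?x" "7 dvd (a * d - b * c) * ?y"
    using h by (auto intro!: dvd_diff dvd_mult)
  then show False using assms(1) vec_nonzero[OF assms(2)] dvd7_mult by blast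
qed

text \<open>A fixed vector up to sign is a kernel vector of l M - e with e = 1 or e = -1, and det(l
  M - e) = l^2 p - e l r + 1. If l M were congruent to e modulo 7, then l^2 p would be congruent to
  1; this is excluded, so a nonzero kernel is a line.\<close>

lemma fixed_count:
  assumes M: "M \<in> trace_mats p r" and nd: "\<not> 7 dvd l^2 * p - 1"
  shows "(\<Sum>i<24. of_bool (veq (app l M (vec i)) (vec i)))
    = (3 * (of_bool (7 dvd l^2 * p - l * r + 1) + of_bool (7 dvd l^2 * p + l * r + 1)) :: real)"
proof -
  obtain a b c d where Meq: "M = (a, b, c, d)" by (cases M)
  have p: "p = a * d - b * c" and r: "r = a + d" using M by (auto simp: Meq trace_mats_def)
  define fx where "fx = (\<lambda>e i. 7 dvd (l * a - e) * fst (vec i) + l * b * snd (vec i)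
      \<and> 7 dvd l * c * fst (vec i) + (l * d - e) * snd (vec i))"
  have veq_fx: "veq (app l M (vec i)) (vec i) \<longleftrightarrow> fx 1 i \<or> fx (-1) i" for i
    by (cases "vec i") (auto simp: veq_def cong_iff_dvd_diff fx_def Meq algebra_simps)
  have excl: "\<not> (fx 1 i \<and> fx (-1) i)" if "i < 24" for i
  proof
    let ?x = "fst (vec i)" and ?y = "snd (vec i)"
    assume h: "fx 1 i \<and> fx (-1) i"
    have "2 * ?x = ((l * a - (-1)) * ?x + l * b * ?y) - ((l * a - 1) * ?x + l * b * ?y)"
      "2 * ?y = (l * c * ?x + (l * d - (-1)) * ?y) - (l * c * ?x + (l * d - 1) * ?y)"
      by (simp_all add: algebra_simps)
    then have "7 dvd 2 * ?x" "7 dvd 2 * ?y" using h unfolding fx_def by (metis dvd_diff)+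
    then show False using vec_nonzero[OF that] dvd7_mult by auto
  qed
  have cnt: "(\<Sum>i<24. of_bool (fx e i)) = (3 * of_bool (7 dvd l^2 * p - e * l * r + 1) :: real)"
    if e: "e = 1 \<or> e = -1" for e
  proof -
    have det: "(l * a - e) * (l * d - e) - l * b * (l * c) = l^2 * p - e * l * r + 1"
      using e by (auto simp: p r ring_eqs)
    have "\<not> (7 dvd l * a - e \<and> 7 dvd l * b \<and> 7 dvd l * c \<and> 7 dvd l * d - e)"
    proof
      assume h: "7 dvd l * a - e \<and> 7 dvd l * b \<and> 7 dvd l * c \<and> 7 dvd l * d - e"
      have "l^2 * p - 1 = (l * a - e) * (l * d) + e * (l * d - e) - l * b * (l * c)"
        using e by (auto simp: p ring_eqs)
      then have "7 dvd l^2 * p - 1" using h by (auto intro!: dvd_add dvd_diff dvd_mult dvd_mult2)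
      then show False using nd by blast
    qed
    moreover have "(\<Sum>i<24. of_bool (fx e i)) = (0::real)" if "\<not> 7 dvd l^2 * p - e * l * r + 1"
      using kernel_empty[of "l * a - e" "l * d - e" "l * b" "l * c"] that
      unfolding det fx_def by (intro sum.neutral) auto
    ultimately show ?thesis
      using kernel_count[of "l * a - e" "l * d - e" "l * b" "l * c"]
      unfolding det fx_def by (cases "7 dvd l^2 * p - e * l * r + 1") simp_all
  qed
  have "(\<Sum>i<24. of_bool (veq (app l M (vec i)) (vec i))) = (\<Sum>i<24. of_bool (fx 1 i) + of_bool (fx (-1) i) :: real)"
    using excl by (intro sum.cong refl) (auto simp: veq_fx)
  then show ?thesis using cnt[of 1] cnt[of "-1"] by (simp add: sum.distrib)
qed

section \<open>The action of upper triangular matrices on the six cusps\<close>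

definition cuspset :: "nat \<Rightarrow> (int \<times> int) set" where
  "cuspset j = (if j < 3 then {(int j + 1, 0)} else (\<lambda>u. (u, int j - 2)) ` set res7)"

lemma sum_cuspset:
  fixes F :: "int \<times> int \<Rightarrow> real"
  assumes "j < 6"
  shows "(\<Sum>x<24. if cuspP x = j then F (vec x) else 0) = (\<Sum>v\<in>cuspset j. F v)"
proof -
  have "j = 0 \<or> j = 1 \<or> j = 2 \<or> j = 3 \<or> j = 4 \<or> j = 5" using assms by auto
  then show ?thesis
    by (elim disjE)
       (simp_all add: cuspset_def lessThan_nat_numeral lessThan_Suc numeral_eq_Suc cuspP_def vec_def)
qed

definition shiftT :: "int \<times> int \<Rightarrow> int \<times> int" where
  "shiftT v = (if snd v = 0 then v else ((fst v + snd v) mod 7, snd v))"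

lemma bij_shiftT:
  assumes "j < 6"
  shows "bij_betw shiftT (cuspset j) (cuspset j)"
proof -
  have fin: "finite (cuspset j)" by (simp add: cuspset_def)
  have into: "shiftT ` cuspset j \<subseteq> cuspset j"
    using mod7_cases by (auto simp: cuspset_def shiftT_def)
  have "inj_on shiftT (cuspset j)"
  proof (rule inj_onI)
    fix v w assume h: "v \<in> cuspset j" "w \<in> cuspset j" "shiftT v = shiftT w"
    show "v = w"
    proof (cases "j < 3")
      case True then show ?thesis using h by (simp add: cuspset_def)
    next
      case False
      define m where "m = int j - 2"
      obtain u u' where u: "v = (u, m)" "w = (u', m)" "0 \<le> u" "u < 7" "0 \<le> u'" "u' < 7"
        using h False by (auto simp: cuspset_def m_def)
      have "m \<noteq> 0" using False by (simp add: m_def)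
      then have "(u + m) mod 7 = (u' + m) mod 7" using h(3) by (simp add: u shiftT_def)
      then have "u mod 7 = u' mod 7" by (metis add_diff_cancel_right' mod_diff_left_eq)
      then show ?thesis using u by simp
    qed
  qed
  then show ?thesis using into fin by (simp add: bij_betw_def endo_inj_surj)
qed

lemma veq_shiftT: "veq (Tv v) (shiftT v)"
  by (cases v) (auto simp: shiftT_def veq_code)

text \<open>The matrix entry between cusps j and i for an upper triangular matrix with diagonal s, t
  modulo 7. Cusps 0, 1, 2 are the T-fixed vectors (j + 1, 0), on which s acts; cusps 3, 4, 5 are the
  T-orbits of second coordinate j - 2, on which t acts. The two kinds do not mix.\<close>

fun contr :: "int \<Rightarrow> int \<Rightarrow> nat \<Rightarrow> nat \<Rightarrow> real" where
  "contr s t j i = (if j < 3 then of_bool (i < 3 \<and> pmcong (s * (int j + 1)) (int i + 1))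
     else of_bool (\<not> i < 3 \<and> pmcong (t * (int j - 2)) (int i - 2)))"

lemma affine_unique:
  assumes "\<not> 7 dvd A"
  shows "(\<Sum>u\<in>set res7. of_bool ([A * u + B = z] (mod 7))) = (1::real)"
proof -
  have "coprime A 7" using assms prime7 prime_imp_coprime coprime_commute by blast
  then obtain A' where A': "[A * A' = 1] (mod 7)" using cong_solve_coprime_int by blast
  define u0 where "u0 = (A' * (z - B)) mod 7"
  have "[A * u + B = z] (mod 7) \<longleftrightarrow> u = u0" if u: "u \<in> set res7" for u
  proof
    have "[A * u0 = A * (A' * (z - B))] (mod 7)" unfolding u0_def by (intro cong_scalar_left) simp
    also have "[A * (A' * (z - B)) = 1 * (z - B)] (mod 7)"
      unfolding mult.assoc[symmetric] by (rule cong_scalar_right[OF A'])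
    finally have e: "[A * u0 + B = z] (mod 7)" by (metis cong_add_rcancel diff_add_cancel mult_1)
    then show "u = u0 \<Longrightarrow> [A * u + B = z] (mod 7)" by simp
    assume "[A * u + B = z] (mod 7)"
    then have "[A * u + B = A * u0 + B] (mod 7)" using e cong_sym cong_trans by blast
    then have "[A * u = A * u0] (mod 7)" by (simp add: cong_add_rcancel)
    then have "[u = u0] (mod 7)" using cong_mult_lcancel[OF \<open>coprime A 7\<close>] by simp
    then show "u = u0" using u by (auto simp: cong_def u0_def)
  qed
  then have "(\<Sum>u\<in>set res7. of_bool ([A * u + B = z] (mod 7)))
      = (\<Sum>u\<in>set res7. of_bool (u = u0) :: real)" by (intro sum.cong refl) simp
  also have "\<dots> = 1"
  proof -
    have "u0 = 0 \<or> u0 = 1 \<or> u0 = 2 \<or> u0 = 3 \<or> u0 = 4 \<or> u0 = 5 \<or> u0 = 6"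
      using mod7_cases[of "A' * (z - B)"] by (simp add: u0_def)
    then show ?thesis by (elim disjE) simp_all
  qed
  finally show ?thesis .
qed

lemma not_dvd7_small: "0 < m \<Longrightarrow> m < 7 \<Longrightarrow> \<not> 7 dvd m" for m :: int
  by (rule zdvd_not_zless)

text \<open>On a T-orbit of length 7 the first coordinate of the image runs through every residue
  exactly once, so the count depends only on the second coordinate, that is on the cusp of
  y.\<close>

lemma app_cusp_sum:
  assumes l: "\<not> 7 dvd l * a" "\<not> 7 dvd l * d" and j: "j < 6" and y: "y < 24"
  shows "(\<Sum>v\<in>cuspset j. of_bool (veq (app l (a, b, 0, d) v) (vec y))) = contr (l * a) (l * d) j (cuspP y)"
proof (cases "j < 3")
  case True
  have sv: "app l (a, b, 0, d) (int j + 1, 0) = (l * a * (int j + 1), 0)" by simp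
  show ?thesis
  proof (cases "cuspP y < 3")
    case y3: True
    show ?thesis
      using True y3 by (auto simp: cuspset_def sv vec_facts(3)[OF y y3] veq_def pmcong_def simp del: app.simps)
  next
    case False
    have "\<not> 7 dvd snd (vec y)"
      using vec_facts(4)[OF y False] not_dvd7_small[of "snd (vec y)"] perm_facts(3)[OF y] False by auto
    then have "\<not> [0 = snd (vec y)] (mod 7)" "\<not> [0 = - snd (vec y)] (mod 7)"
      by (simp_all add: cong_iff_dvd_diff)
    then show ?thesis
      using True False by (auto simp: cuspset_def sv veq_def simp del: app.simps)
  qed
next
  case False
  define m where "m = int j - 2"
  have m: "0 < m" "m < 7" using False j by (auto simp: m_def)
  have C: "\<not> 7 dvd l * d * m" using l(2) not_dvd7_small[OF m] dvd7_mult by blast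
  obtain y1 y2 where vy: "vec y = (y1, y2)" by (cases "vec y")
  have sv: "app l (a, b, 0, d) (u, m) = (l * a * u + l * b * m, l * d * m)" for u by (simp add: algebra_simps)
  have eq: "(\<Sum>v\<in>cuspset j. of_bool (veq (app l (a, b, 0, d) v) (vec y)))
      = (\<Sum>u\<in>set res7. of_bool (veq (l * a * u + l * b * m, l * d * m) (y1, y2)) :: real)"
  proof -
    have "cuspset j = (\<lambda>u. (u, m)) ` set res7" using False by (simp add: cuspset_def m_def)
    moreover have "inj_on (\<lambda>u::int. (u, m)) X" for X by (simp add: inj_on_def)
    ultimately show ?thesis by (simp only: sum.reindex comp_def sv vy)
  qed
  have neg: "[l * d * m = y2] (mod 7) \<Longrightarrow> \<not> [l * d * m = - y2] (mod 7)"
  proof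
    assume "[l * d * m = y2] (mod 7)" "[l * d * m = - y2] (mod 7)"
    then have "7 dvd (l * d * m - y2) + (l * d * m - - y2)" by (intro dvd_add) (simp_all add: cong_iff_dvd_diff)
    then have "7 dvd 2 * (l * d * m)" by (simp add: algebra_simps)
    then show False using C dvd7_mult[of 2 "l * d * m"] by simp
  qed
  have val: "(\<Sum>u\<in>set res7. of_bool (veq (l * a * u + l * b * m, l * d * m) (y1, y2)) :: real)
      = of_bool (pmcong (l * d * m) y2)"
  proof -
    consider "[l * d * m = y2] (mod 7)" | "[l * d * m = - y2] (mod 7)" | "\<not> pmcong (l * d * m) y2"
      by (auto simp: pmcong_def)
    then show ?thesis
    proof cases
      case 1
      then have "veq (l * a * u + l * b * m, l * d * m) (y1, y2) \<longleftrightarrow> [l * a * u + l * b * m = y1] (mod 7)" for u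
        using neg by (auto simp: veq_def)
      then show ?thesis using affine_unique[OF l(1), of "l * b * m" y1] 1 by (simp only: pmcong_def) simp
    next
      case 2
      then have "veq (l * a * u + l * b * m, l * d * m) (y1, y2) \<longleftrightarrow> [l * a * u + l * b * m = - y1] (mod 7)" for u
        using neg by (auto simp: veq_def)
      then show ?thesis using affine_unique[OF l(1), of "l * b * m" "- y1"] 2 by (simp only: pmcong_def) simp
    next
      case 3
      then show ?thesis by (auto simp: veq_def pmcong_def)
    qed
  qed
  show ?thesis
  proof (cases "cuspP y < 3")
    case y3: True
    then have "y2 = 0" using vec_facts(3)[OF y y3] vy by simp
    then have "\<not> pmcong (l * d * m) y2" using C by (simp add: pmcong_def cong_iff_dvd_diff)
    then show ?thesis unfolding eq val using False y3 by simp
  next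
    case F: False
    then have "y2 = int (cuspP y) - 2" using vec_facts(4)[OF y F] vy by simp
    then show ?thesis unfolding eq val using False F by (simp add: m_def)
  qed
qed

text \<open>For given diagonal there are |a| admissible values of b: p of them for the diagonals (p,
  1) and (-p, -1), and one for (1, p) and (-1, -p).\<close>

lemma sum_upper_reps:
  fixes \<phi> :: "int \<Rightarrow> int \<Rightarrow> real"
  assumes p: "prime p" and even: "\<And>a d. \<phi> (- a) (- d) = \<phi> a d"
  shows "(\<Sum>(a, b, c, d)\<in>upper_reps p. \<phi> a d) = 2 * (p * \<phi> p 1 + \<phi> 1 p)"
proof -
  have p1: "p > 1" using p prime_gt_1_int by blast
  define U1 U2 U3 U4 :: "imat set" where
    "U1 = {(1, -1, 0, p)}" "U2 = {(-1, 1, 0, - p)}"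
    "U3 = (\<lambda>b. (p, b, 0, 1)) ` {- p..-1}" "U4 = (\<lambda>b. (- p, b, 0, -1)) ` {1..p}"
  have "upper_reps p = U1 \<union> U2 \<union> U3 \<union> U4"
  proof (intro equalityI subsetI)
    fix M assume "M \<in> upper_reps p"
    moreover obtain a b c d where M: "M = (a, b, c, d)" by (cases M)
    ultimately have h: "a * d = p" "c = 0" "- (a * a) \<le> a * b" "a * b < 0" by (auto simp: upper_reps_def)
    have "a dvd p" using h(1) by auto
    then have "\<bar>a\<bar> = 1 \<or> \<bar>a\<bar> = p"
      using p p1 prime_int_iff[of p] by (metis abs_dvd_iff abs_ge_zero)
    then consider "a = 1" | "a = -1" | "a = p" | "a = - p" by linarith
    then show "M \<in> U1 \<union> U2 \<union> U3 \<union> U4"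
    proof cases
      case 1 then show ?thesis using h by (auto simp: M U1_U2_U3_U4_def)
    next
      case 2 then show ?thesis using h by (auto simp: M U1_U2_U3_U4_def)
    next
      case 3
      then have "d = 1" using h(1) p1 by simp
      moreover have "- p \<le> b" using h(3) 3 p1 mult_le_cancel_left_pos[of p "- p" b] by simp
      moreover have "b < 0" using h(4) 3 p1 by (simp add: mult_less_0_iff)
      ultimately show ?thesis using h(2) 3 by (auto simp: M U1_U2_U3_U4_def)
    next
      case 4
      then have "p * (d + 1) = 0" using h(1) by (simp add: algebra_simps)
      then have "d = -1" using p1 by simp
      moreover have "b \<le> p" using h(3) 4 p1 mult_le_cancel_left_pos[of p b p] by simp
      moreover have "0 < b" using h(4) 4 p1 by (simp add: zero_less_mult_iff)
      ultimately show ?thesis using h(2) 4 by (auto simp: M U1_U2_U3_U4_def)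
    qed
  next
    fix M assume "M \<in> U1 \<union> U2 \<union> U3 \<union> U4"
    then show "M \<in> upper_reps p"
      using p1 by (auto simp: U1_U2_U3_U4_def upper_reps_def mult_less_0_iff
          intro: mult_left_mono mult_left_mono[of _ p p, simplified] mult_left_mono[of "- p" _ p, simplified])
  qed
  moreover have "finite U1" "finite U2" "finite U3" "finite U4" by (simp_all add: U1_U2_U3_U4_def)
  moreover have "U1 \<inter> U2 = {}" "(U1 \<union> U2) \<inter> U3 = {}" "(U1 \<union> U2 \<union> U3) \<inter> U4 = {}"
    using p1 by (auto simp: U1_U2_U3_U4_def)
  moreover have "(\<Sum>(a, b, c, d)\<in>U1. \<phi> a d) = \<phi> 1 p" by (simp add: U1_U2_U3_U4_def)
  moreover have "(\<Sum>(a, b, c, d)\<in>U2. \<phi> a d) = \<phi> 1 p"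
    using even[of 1 p] by (simp add: U1_U2_U3_U4_def)
  moreover have "(\<Sum>(a, b, c, d)\<in>U3. \<phi> a d) = p * \<phi> p 1"
    unfolding U1_U2_U3_U4_def using p1 by (subst sum.reindex) (auto simp: inj_on_def)
  moreover have "(\<Sum>(a, b, c, d)\<in>U4. \<phi> a d) = p * \<phi> p 1"
    unfolding U1_U2_U3_U4_def using p1 even[of p 1] by (subst sum.reindex) (auto simp: inj_on_def)
  ultimately show ?thesis by (simp add: sum.union_disjoint algebra_simps)
qed

lemma pmcong_mod: "pmcong s t \<longleftrightarrow> pmcong (s mod 7) t"
  by (simp add: pmcong_def cong_def)

lemma pmcong_uminus: "pmcong (- s) t \<longleftrightarrow> pmcong s t"
  unfolding pmcong_def using cong_minus_minus_iff[of s "- t" 7] cong_minus_minus_iff[of s t 7] by auto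

text \<open>Multiplication by s permutes the three classes of units modulo 7 up to sign, represented
  by 1, 2, 3, as translation in a group: it fixes all of them or none, and exactly one is mapped to
  the class of 3.\<close>

lemma pmcong_sums:
  assumes "\<not> 7 dvd s"
  shows "of_bool (pmcong s 1) + of_bool (pmcong (s * 2) 2) + of_bool (pmcong (s * 3) 3) = (3 * of_bool (pmcong s 1) :: real)"
    and "of_bool (pmcong s 3) + of_bool (pmcong (s * 2) 3) + of_bool (pmcong (s * 3) 3) = (1 :: real)"
proof -
  have m: "pmcong (s * k) t \<longleftrightarrow> pmcong ((s mod 7) * k) t" for k t
    by (simp only: pmcong_def cong_def mod_mult_left_eq)
  have "s mod 7 \<noteq> 0" using assms by (simp add: dvd_eq_mod_eq_0)
  then have "s mod 7 = 1 \<or> s mod 7 = 2 \<or> s mod 7 = 3 \<or> s mod 7 = 4 \<or> s mod 7 = 5 \<or> s mod 7 = 6"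
    using mod7_cases[of s] by simp
  then show "of_bool (pmcong s 1) + of_bool (pmcong (s * 2) 2) + of_bool (pmcong (s * 3) 3) = (3 * of_bool (pmcong s 1) :: real)"
    "of_bool (pmcong s 3) + of_bool (pmcong (s * 2) 3) + of_bool (pmcong (s * 3) 3) = (1 :: real)"
    unfolding m[of 2] m[of 3] pmcong_mod[of s] by (elim disjE; simp add: pmcong_def cong_def)+
qed

lemma contr_sums:
  assumes "\<not> 7 dvd s" "\<not> 7 dvd t"
  shows "(\<Sum>j<6. contr s t j j) = 3 * (of_bool (pmcong s 1) + of_bool (pmcong t 1))"
    and "(\<Sum>j<6. contr s t j 5) = 1"
  using pmcong_sums[OF assms(1)] pmcong_sums[OF assms(2)]
  by (simp_all add: lessThan_nat_numeral lessThan_Suc numeral_eq_Suc)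

text \<open>Each row of K sums to the total weight 2 (p + 1), because p and l are units modulo 7 and
  so each matrix sends x to exactly one of the 24 vectors. The column of t at cusp 5 has the same
  sum.\<close>

lemma kern_trace:
  assumes p: "prime p" and p7: "\<not> 7 dvd p" and l7: "\<not> 7 dvd l"
  shows "(\<Sum>x<24. kern p l (vec x) (vec x))
    = 4 * (p + 1) - 6 * (p + 1) * (of_bool (pmcong (l * p) 1) + of_bool (pmcong l 1))"
proof -
  have p1: "p > 1" and p0: "p > 0" using p prime_gt_1_int[of p] by auto
  define t where "t = (\<lambda>j i. 2 * (p * contr (l * p) l j i + contr l (l * p) j i))"
  have lp: "\<not> 7 dvd l * p" using p7 l7 dvd7_mult by blast
  have cc: "cusp_count p l (cuspset j) (vec y) = t j (cuspP y)" if j: "j < 6" and y: "y < 24" for j y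
  proof -
    have "cusp_count p l (cuspset j) (vec y) = (\<Sum>(a, b, c, d)\<in>upper_reps p. contr (l * a) (l * d) j (cuspP y))"
      unfolding cusp_count_def
    proof (rule sum.cong[OF refl])
      fix M assume M: "M \<in> upper_reps p"
      obtain a b c d where Meq: "M = (a, b, c, d)" by (cases M)
      have "a * d = p" "c = 0" using M by (auto simp: Meq upper_reps_def)
      then have "\<not> 7 dvd l * a" "\<not> 7 dvd l * d" using p7 l7 dvd7_mult by metis+
      then show "(\<Sum>x\<in>cuspset j. of_bool (veq (app l M x) (vec y))) = (case M of (a, b, c, d) \<Rightarrow> contr (l * a) (l * d) j (cuspP y))"
        using app_cusp_sum[OF _ _ j y] by (simp add: Meq \<open>c = 0\<close> del: app.simps contr.simps)
    qed
    also have "\<dots> = t j (cuspP y)"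
      using sum_upper_reps[OF p, of "\<lambda>a d. contr (l * a) (l * d) j (cuspP y)"]
      by (simp add: t_def pmcong_uminus)
    finally show ?thesis .
  qed
  define K where "K = (\<lambda>x y. kern p l (vec x) (vec y))"
  have KS: "kern p l x (Sv (vec y)) = kern p l x (vec (sP y))" "kern p l (Sv (vec y)) x = kern p l (vec (sP y)) x"
    "kern p l x (Uv (vec y)) = kern p l x (vec (uP y))" "kern p l (Uv (vec y)) x = kern p l (vec (uP y)) x"
    if "y < 24" for x y
    by (rule kern_cong; simp add: vec_facts[OF that] veq_refl)+
  have KUU: "kern p l x (Uv (Uv (vec y))) = kern p l x (vec (uP (uP y)))" if "y < 24" for x y
  proof (rule kern_cong)
    have "veq (Uv (Uv (vec y))) (Uv (vec (uP y)))" using vec_facts(2)[OF that] by (simp add: veq_Uv)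
    then show "veq (Uv (Uv (vec y))) (vec (uP (uP y)))"
      using vec_facts(2)[OF perm_facts(2)[OF that]] veq_trans by blast
  qed (rule veq_refl)
  have "(\<Sum>x<24. K x x) = 2 * (2 * (real_of_int p + 1)) - (\<Sum>j<6. t j j)"
  proof (rule trace_from_relations[where K = K and t = t])
    fix x y :: nat assume x: "x < 24" and y: "y < 24"
    show "K (uP x) y + K (uP x) (sP y) = K x y + K x (sP y)"
      using kern_S_sum_Uv[OF p0, of l "vec x" "vec y"] KS x y by (simp add: K_def)
    show "K (sP x) y + K (sP x) (uP y) + K (sP x) (uP (uP y)) = K x y + K x (uP y) + K x (uP (uP y))"
      using kern_U_sum_Sv[OF p0, of l "vec x" "vec y"] KS KUU x y by (simp add: K_def)
  next
    fix j y :: nat assume j: "j < 6" and y: "y < 24"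
    have "(\<Sum>x<24. if cuspP x = j then K x y - K (sP x) y else 0)
        = (\<Sum>x<24. if cuspP x = j then (\<lambda>v. kern p l v (vec y) - kern p l (Sv v) (vec y)) (vec x) else 0)"
      using KS by (intro sum.cong refl) (simp add: K_def)
    also have "\<dots> = (\<Sum>v\<in>cuspset j. kern p l v (vec y) - kern p l (Sv v) (vec y))"
      by (rule sum_cuspset[OF j])
    also have "\<dots> = cusp_count p l (cuspset j) (Sv (vec y)) - cusp_count p l (cuspset j) (vec y)"
      by (rule kern_cusp_sum[OF p0 _ bij_shiftT[OF j] veq_shiftT]) (simp add: cuspset_def)
    also have "cusp_count p l (cuspset j) (Sv (vec y)) = cusp_count p l (cuspset j) (vec (sP y))"
      unfolding cusp_count_def
      by (intro sum.cong refl arg_cong[where f = of_bool] veq_cong_right vec_facts(1)[OF y])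
    finally show "(\<Sum>x<24. if cuspP x = j then K x y - K (sP x) y else 0) = t j (cuspP (sP y)) - t j (cuspP y)"
      using cc[OF j y] cc[OF j perm_facts(1)[OF y]] by simp
  next
    fix x :: nat assume x: "x < 24"
    have nz: "(\<Sum>y<24. of_bool (veq (app l M (vec x)) (vec y))) = (1::real)" if M: "M \<in> det_mats p" for M
    proof (rule sum_veq_vec)
      obtain a b c d where Meq: "M = (a, b, c, d)" by (cases M)
      obtain v w where vw: "vec x = (v, w)" by (cases "vec x")
      have det: "p = a * d - b * c" using M by (simp add: Meq det_mats_def)
      show "\<not> (7 dvd fst (app l M (vec x)) \<and> 7 dvd snd (app l M (vec x)))"
      proof
        assume "7 dvd fst (app l M (vec x)) \<and> 7 dvd snd (app l M (vec x))"
        then have h: "7 dvd a * v + b * w" "7 dvd c * v + d * w"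
          using l7 dvd7_mult by (auto simp: Meq vw)
        have "p * v = d * (a * v + b * w) - b * (c * v + d * w)" "p * w = a * (c * v + d * w) - c * (a * v + b * w)"
          by (simp_all add: det algebra_simps)
        then have "7 dvd p * v" "7 dvd p * w" using h by (auto intro!: dvd_diff dvd_mult)
        then show False using vec_nonzero[OF x] p7 dvd7_mult vw by auto
      qed
    qed
    have "(\<Sum>y<24. K x y) = sum' (\<lambda>M. \<Sum>y<24. coefw M * of_bool (veq (app l M (vec x)) (vec y))) (det_mats p)"
      unfolding K_def kern_def
      by (rule sum_sum'_swap(1)[OF finite_lessThan finite_mult_supp[OF finite_coefw_p[OF p0]]])
    also have "\<dots> = sum' coefw (det_mats p)"
      by (rule sum.cong'[OF refl]) (simp only: sum_distrib_left[symmetric] nz mult_1_right)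
    finally show "(\<Sum>y<24. K x y) = 2 * (real_of_int p + 1)" using sum_coefw_prime[OF p] by simp
  next
    show "(\<Sum>j<6. t j 5) = 2 * (real_of_int p + 1)"
      using contr_sums(2)[OF lp l7] contr_sums(2)[OF l7 lp]
      by (simp add: t_def sum.distrib distrib_left flip: sum_distrib_left)
  qed
  also have "(\<Sum>j<6. t j j) = 6 * (real_of_int p + 1) * (of_bool (pmcong (l * p) 1) + of_bool (pmcong l 1))"
  proof -
    have "(\<Sum>j<6. t j j) = 2 * (p * (\<Sum>j<6. contr (l * p) l j j) + (\<Sum>j<6. contr l (l * p) j j))"
      by (simp only: t_def sum.distrib sum_distrib_left distrib_left)
    then show ?thesis unfolding contr_sums(1)[OF lp l7] contr_sums(1)[OF l7 lp] by (simp add: algebra_simps)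
  qed
  finally show ?thesis by (simp add: K_def)
qed

subsection \<open>The class number sums\<close>

text \<open>A matrix of determinant p that has the eigenvalue 1/l modulo 7 has trace c.\<close>

lemma hurwitz_sum_mod7:
  fixes p l c :: int
  assumes p: "prime p" and p7: "\<not> 7 dvd p" and l7: "\<not> 7 dvd l"
    and nd: "\<not> 7 dvd l^2 * p - 1" and c: "[l * c = l^2 * p + 1] (mod 7)"
  shows "(\<Sum>r\<in>{r. r^2 < 4 * p \<and> [r = c] (mod 7)}. hurwitz_H (4 * p - r^2))
    = (2 / 3 * (p + 1) - (p + 1) * (of_bool (pmcong (l * p) 1) + of_bool (pmcong l 1))
        + (p - 1) * (of_bool ([p + 1 = c] (mod 7)) + of_bool ([- (p + 1) = c] (mod 7)))) / 2"
proof -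
  have p1: "p > 1" and p0: "p > 0" using p prime_gt_1_int[of p] by auto
  define tr :: "imat \<Rightarrow> int" where "tr = (\<lambda>(a, b, c, d). a + d)"
  have trm: "{M \<in> det_mats p. tr M = r} = trace_mats p r" for r
    by (auto simp: tr_def det_mats_def trace_mats_def)
  define C where "C = (\<lambda>r. sum' coefw (trace_mats p r))"
  define R0 where "R0 = tr ` {M \<in> det_mats p. coefw M \<noteq> 0}"
  have "finite R0" using finite_coefw_p[OF p0] by (simp add: R0_def)
  \<comment> \<open>The range of traces is a symmetric interval, so that r -> - r permutes it; it
    contains all traces of matrices of nonzero weight, and through 2 p also the elliptic ones and
    those of absolute value p + 1.\<close>
  define B where "B = Max (abs ` insert (2 * p) R0)"
  have B: "\<bar>r\<bar> \<le> B" if "r \<in> insert (2 * p) R0" for r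
    unfolding B_def using that \<open>finite R0\<close> by (intro Max_ge) auto
  then have B2: "2 * p \<le> B" using p0 by fastforce
  define R where "R = {- B..B}"
  have R: "finite R" "R0 \<subseteq> R" using B by (auto simp: R_def abs_le_iff minus_le_iff)
  define fx where "fx = (\<lambda>s r. of_bool (7 dvd l^2 * p - s * l * r + 1) :: real)"
  have C_even: "C (- r) = C r" for r by (simp add: C_def sum_coefw_uminus)

  define g where "g = (\<lambda>M. \<Sum>x<24. coefw M * of_bool (veq (app l M (vec x)) (vec x)))"
  have "(\<Sum>x<24. kern p l (vec x) (vec x)) = sum' g (det_mats p)"
    unfolding kern_def g_def
    by (rule sum_sum'_swap(1)[OF finite_lessThan finite_mult_supp[OF finite_coefw_p[OF p0]]])
  also have "\<dots> = (\<Sum>r\<in>R. sum' g {M \<in> det_mats p. tr M = r})"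
  proof (rule sum'_group)
    show "finite {M \<in> det_mats p. g M \<noteq> 0}"
      by (rule finite_subset[OF _ finite_coefw_p[OF p0]]) (auto simp: g_def sum_distrib_left[symmetric])
    show "tr M \<in> R" if "M \<in> det_mats p" "g M \<noteq> 0" for M
      using that R(2) by (auto simp: g_def R0_def sum_distrib_left[symmetric])
  qed (rule R)
  also have "\<dots> = (\<Sum>r\<in>R. 3 * (fx 1 r + fx (-1) r) * C r)"
  proof (rule sum.cong[OF refl])
    fix r
    have "sum' g (trace_mats p r)
        = sum' (\<lambda>M. 3 * (fx 1 r + fx (-1) r) * coefw M) (trace_mats p r)"
    proof (rule sum.cong'[OF refl])
      fix M assume "M \<in> trace_mats p r"
      then show "g M = 3 * (fx 1 r + fx (-1) r) * coefw M"
        using fixed_count[OF _ nd] unfolding g_def sum_distrib_left[symmetric] by (simp add: fx_def)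
    qed
    then show "sum' g {M \<in> det_mats p. tr M = r}
        = 3 * (fx 1 r + fx (-1) r) * C r"
      by (simp add: trm C_def sum'_cmult)
  qed
  also have "\<dots> = 3 * ((\<Sum>r\<in>R. fx 1 r * C r) + (\<Sum>r\<in>R. fx (-1) r * C r))"
    by (simp add: sum.distrib sum_distrib_left distrib_right distrib_left mult.assoc)
  \<comment> \<open>The eigenvalues 1 / l and - 1 / l are exchanged by M -> - M, which preserves the
    weights.\<close>
  also have "(\<Sum>r\<in>R. fx (-1) r * C r) = (\<Sum>r\<in>R. fx 1 r * C r)"
    by (rule sum.reindex_bij_witness[where i = uminus and j = uminus]) (auto simp: R_def fx_def C_even)
  finally have T: "(\<Sum>x<24. kern p l (vec x) (vec x)) = 6 * (\<Sum>r\<in>R. fx 1 r * C r)" by simp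

  have cop: "coprime l 7" using l7 prime7 prime_imp_coprime coprime_commute by blast
  have fx_iff: "fx 1 r = of_bool ([r = c] (mod 7))" for r
  proof -
    have "7 dvd l^2 * p - 1 * l * r + 1 \<longleftrightarrow> [l^2 * p + 1 = l * r] (mod 7)"
      by (simp add: cong_iff_dvd_diff algebra_simps)
    also have "\<dots> \<longleftrightarrow> [l * r = l * c] (mod 7)" using c cong_sym cong_trans by blast
    also have "\<dots> \<longleftrightarrow> [r = c] (mod 7)" by (rule cong_mult_lcancel[OF cop])
    finally show ?thesis by (simp add: fx_def)
  qed
  define A where "A = {r. r^2 < 4 * p \<and> [r = c] (mod 7)}"
  define E where "E = {r \<in> {p + 1, - (p + 1)}. [r = c] (mod 7)}"
  have small: "\<bar>r\<bar> < 2 * p" if "r^2 < 4 * p" for r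
  proof (rule ccontr)
    assume "\<not> ?thesis"
    then have "(2 * p)^2 \<le> \<bar>r\<bar>^2" using p0 by (intro power_mono) auto
    moreover have "4 * p \<le> (2 * p)^2" using p0 by (simp add: power2_eq_square)
    ultimately show False using that by simp
  qed
  have "A \<subseteq> R" using small B2 by (force simp: A_def R_def)
  moreover have "E \<subseteq> R" using p1 B2 by (auto simp: E_def R_def)
  ultimately have sub: "A \<union> E \<subseteq> R" "finite A" using finite_subset[OF _ R(1)] by auto
  have big: "(p + 1)^2 > 4 * p"
  proof -
    have "(p + 1)^2 = 4 * p + (p - 1)^2" by (simp add: ring_eqs)
    moreover have "(p - 1)^2 > 0" using p1 by simp
    ultimately show ?thesis by linarith
  qed
  have disj: "A \<inter> E = {}" using big power2_minus[of "p + 1"] by (auto simp: A_def E_def)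
  have nsq: "r^2 \<noteq> 4 * p" for r
  proof
    assume "r^2 = 4 * p"
    then have "r^2 - 0^2 = 4 * p" by simp
    from prime_square_diff(1)[OF p this] have "r^2 = (p + 1)^2" by (metis power2_abs)
    then show False using big \<open>r^2 = 4 * p\<close> by simp
  qed
  have "(\<Sum>r\<in>R. fx 1 r * C r) = (\<Sum>r\<in>A \<union> E. C r)"
  proof (rule sum.mono_neutral_cong_right[OF R(1) sub(1)])
    show "\<forall>r\<in>R - (A \<union> E). fx 1 r * C r = 0"
    proof
      fix r assume r: "r \<in> R - (A \<union> E)"
      show "fx 1 r * C r = 0"
      proof (cases "[r = c] (mod 7)")
        case True
        then have "r^2 > 4 * p" "\<bar>r\<bar> \<noteq> p + 1"
          using r nsq[of r] by (auto simp: A_def E_def abs_if split: if_splits)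
        then show ?thesis using sum_coefw_hyperbolic[OF p] by (simp add: C_def)
      qed (simp add: fx_iff)
    qed
    show "fx 1 r * C r = C r" if "r \<in> A \<union> E" for r
      using that by (auto simp: fx_iff A_def E_def)
  qed
  also have "\<dots> = (\<Sum>r\<in>A. C r) + (\<Sum>r\<in>E. C r)"
    by (rule sum.union_disjoint) (use sub disj in \<open>auto simp: E_def\<close>)
  also have "(\<Sum>r\<in>A. C r) = 2 * (\<Sum>r\<in>A. hurwitz_H (4 * p - r^2))"
    unfolding sum_distrib_left C_def
    by (rule sum.cong[OF refl]) (use p0 in \<open>auto simp: A_def sum_coefw_elliptic\<close>)
  also have "(\<Sum>r\<in>E. C r) = (\<Sum>r\<in>E. 1 - p)"
    unfolding C_def of_int_sum
    by (rule sum.cong[OF refl]) (use p0 sum_coefw_split[OF p] in \<open>auto simp: E_def\<close>)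
  also have "\<dots> = (1 - p) * (of_bool ([p + 1 = c] (mod 7)) + of_bool ([- (p + 1) = c] (mod 7)))"
  proof -
    have ne: "p + 1 \<noteq> - (p + 1)" using p0 by simp
    have "E = (if [p + 1 = c] (mod 7) then {p + 1} else {}) \<union> (if [- (p + 1) = c] (mod 7) then {- (p + 1)} else {})"
      by (auto simp: E_def)
    then have "card E = of_bool ([p + 1 = c] (mod 7)) + of_bool ([- (p + 1) = c] (mod 7))"
      using ne by (simp split: if_splits)
    then show ?thesis by (simp add: algebra_simps)
  qed
  finally show ?thesis
    using T kern_trace[OF p p7 l7] unfolding A_def[symmetric] by (simp add: field_simps)
qed

theorem theorem6:
  fixes p :: nat and c :: int
  assumes "prime p"
  defines "S \<equiv> (\<Sum>r\<in>{r::int. real_of_int \<bar>r\<bar> < 2 * sqrt (real p) \<and> [r = c] (mod 7)}.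
                   hurwitz_H (4 * int p - r^2))"
  shows "([c = 0] (mod 7) \<and> p mod 7 \<in> {3, 5} \<longrightarrow> S = (real p + 1) / 3)
       \<and> ([c = 0] (mod 7) \<and> p mod 7 = 6 \<longrightarrow> S = (real p - 5) / 3)
       \<and> (([c = int p + 1] (mod 7) \<or> [c = - (int p + 1)] (mod 7)) \<and> p mod 7 \<in> {2, 3, 4, 5}
            \<longrightarrow> S = (real p - 2) / 3)
       \<and> (([c = 2] (mod 7) \<or> [c = -2] (mod 7)) \<and> p mod 7 = 6 \<longrightarrow> S = (real p + 1) / 3)"
proof -
  have pr: "prime (int p)" using assms(1) by simp
  have "real_of_int \<bar>r\<bar> < 2 * sqrt (real p) \<longleftrightarrow> r^2 < 4 * int p" for r
  proof -
    have "real_of_int \<bar>r\<bar> < 2 * sqrt (real p) \<longleftrightarrow> (real_of_int \<bar>r\<bar>)^2 < (2 * sqrt (real p))^2"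
      using power_strict_mono[of "real_of_int \<bar>r\<bar>" "2 * sqrt (real p)" 2]
        power2_less_imp_less[of "real_of_int \<bar>r\<bar>" "2 * sqrt (real p)"] by auto
    also have "\<dots> \<longleftrightarrow> real_of_int (r^2) < real_of_int (4 * int p)" by (simp add: power_mult_distrib)
    finally show ?thesis by (simp only: of_int_less_iff)
  qed
  then have S: "S = (\<Sum>r\<in>{r. r^2 < 4 * int p \<and> [r = c] (mod 7)}. hurwitz_H (4 * int p - r^2))"
    by (simp add: S_def)
  define q where "q = int p mod 7"
  have q: "int (p mod 7) = q" by (simp add: q_def zmod_int)
  define k where "k = c mod 7"
  have "[int p + 1 = q + 1] (mod 7)" by (intro cong_add cong_refl) (simp add: q_def)
  then have ps: "(int p + 1) mod 7 = (q + 1) mod 7" "(- (int p + 1)) mod 7 = (- (q + 1)) mod 7"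
    using cong_minus_minus_iff[of "int p + 1" "q + 1" 7] by (simp_all only: cong_def)
  \<comment> \<open>The formula depends only on p and c modulo 7. For each case there remains to
    find l such that 1 / l is an eigenvalue for trace k and determinant q, distinct from the other
    eigenvalue l q.\<close>
  have key: "S = (2 / 3 * (real p + 1) - (real p + 1) * (of_bool (pmcong (l * q) 1) + of_bool (pmcong l 1))
        + (real p - 1) * (of_bool ((q + 1) mod 7 = k) + of_bool ((- (q + 1)) mod 7 = k))) / 2"
    if "\<not> 7 dvd q" "\<not> 7 dvd l" "\<not> 7 dvd l^2 * q - 1" "(l * k) mod 7 = (l^2 * q + 1) mod 7" for l
  proof -
    have qp: "[q = int p] (mod 7)" and kc: "[k = c] (mod 7)" by (simp_all add: q_def k_def)
    have 1: "7 dvd q \<longleftrightarrow> 7 dvd int p" using qp by (rule cong_dvd_iff)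
    have 2: "7 dvd l^2 * q - 1 \<longleftrightarrow> 7 dvd l^2 * int p - 1"
      by (rule cong_dvd_iff) (intro cong_diff cong_scalar_left qp cong_refl)
    have 3: "[l * c = l^2 * int p + 1] (mod 7)"
    proof -
      have "[l * c = l * k] (mod 7)" by (intro cong_scalar_left cong_sym[OF kc])
      also have "[l * k = l^2 * q + 1] (mod 7)" using that(4) by (simp add: cong_def)
      also have "[l^2 * q + 1 = l^2 * int p + 1] (mod 7)" by (intro cong_add cong_scalar_left qp cong_refl)
      finally show ?thesis .
    qed
    have 4: "pmcong (l * int p) 1 = pmcong (l * q) 1"
      unfolding pmcong_def using cong_scalar_left[OF qp, of l] cong_trans cong_sym by blast
    have 5: "[int p + 1 = c] (mod 7) \<longleftrightarrow> (q + 1) mod 7 = k" "[- (int p + 1) = c] (mod 7) \<longleftrightarrow> (- (q + 1)) mod 7 = k"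
      by (simp_all only: cong_def k_def ps)
    show ?thesis
      using hurwitz_sum_mod7[OF pr, of l c] that(1-3) 3 unfolding S 1 2 4 5 by simp
  qed
  have kcong: "[c = t] (mod 7) \<longleftrightarrow> k = t mod 7" for t by (simp add: cong_def k_def)
  have pq: "p mod 7 = m \<longleftrightarrow> q = int m" for m using q by auto
  \<comment> \<open>Trace 0 requires l^2 q = -1 modulo 7: l = 3 for q = 3, since 28 = 4 * 7, and l =
    2 for q = 5, since 21 = 3 * 7.\<close>
  have c1: "S = (real p + 1) / 3" if "k = 0" "q = 3 \<or> q = 5"
    using that(2)
  proof
    assume "q = 3"
    then show ?thesis using key[of 3] that(1) by (simp add: pmcong_def cong_def)
  next
    assume "q = 5"
    then show ?thesis using key[of 2] that(1) by (simp add: pmcong_def cong_def)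
  qed
  \<comment> \<open>Here p + 1 and - (p + 1) both lie in the class of c, so the hyperbolic
    correction (p - 1) enters twice.\<close>
  have c2: "S = (real p - 5) / 3" if "k = 0" "q = 6"
    using key[of 1] that by (simp add: pmcong_def cong_def field_simps)
  \<comment> \<open>The eigenvalue is 1 or -1, the other one being q or - q.\<close>
  have c3: "S = (real p - 2) / 3" if k: "k = (q + 1) mod 7 \<or> k = (- (q + 1)) mod 7" and "q = 2 \<or> q = 3 \<or> q = 4 \<or> q = 5"
    using k
  proof
    assume "k = (q + 1) mod 7"
    with that(2) show ?thesis
      using key[of 1] by (elim disjE) (simp_all add: pmcong_def cong_def field_simps)
  next
    assume "k = (- (q + 1)) mod 7"
    with that(2) show ?thesis
      using key[of "-1"] by (elim disjE) (simp_all add: pmcong_def cong_def field_simps)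
  qed
  \<comment> \<open>With q = -1 the equation is l k = 1 - l^2 modulo 7, solved by l = 3 for k = 2
    and by l = 4 for k = 5.\<close>
  have c4: "S = (real p + 1) / 3" if "k = 2 \<or> k = 5" "q = 6"
    using that(1)
  proof
    assume "k = 2"
    then show ?thesis using key[of 3] that(2) by (simp add: pmcong_def cong_def)
  next
    assume "k = 5"
    then show ?thesis using key[of 4] that(2) by (simp add: pmcong_def cong_def)
  qed
  show ?thesis
    using c1 c2 c3 c4 unfolding kcong ps by (auto simp: pq)
qed

end
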